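(* Let $\mathbb E K\in(0,\infty]$. (i) As $n\to\infty$, $$\frac{\tau_n}{n}\longrightarrow\theta\,\mathbf 1_{\mathrm{Surv}^{\rm GW}}\quad\text{in probability},\qquad \frac{N_n(\tau_n)}{n}\longrightarrow p\,\mathbf 1_{\mathrm{Surv}^{\rm GW}}\quad\text{in probability},$$ where $\theta\in[0,\infty]$ is defined by: $\theta$ is the unique root in $(0,\infty)$ of $\frac{1-e^{-\theta}}{\theta}=\frac1{\mathbb E K}$ if $1<\mathbb E K<\infty$, $\theta=0$ if $\mathbb E K\le1$, $\theta=\infty$ if $\mathbb E K=\infty$; and $p=1-e^{-\theta}\in[0,1]$. (When $\theta=\infty$, $\infty\cdot 0=0$ and convergence is in $[0,\infty]$.) (ii) If $\mathbb E K\le1$, then $$\lim_{n\to\infty}[\tau_n+1]=\lim_{n\to\infty}N_n(\tau_n)=Z^{\rm GW}_{\rm tot}\quad\text{in probability.}$$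
   Context: $\mathbb N=\{0,1,2,\dots\}$, $\mathbb N^*=\{1,2,\dots\}$. $K$ is a generic random variable with law $\mu$ on $\mathbb N$, with $\mu(0)<1$ and $\mu(1)<1$. Galton--Watson tree. $\mathcal W=\bigcup_{k\ge0}(\mathbb N^* )^k$ is the set of finite words, $|w|$ the length of $w$, $\varnothing$ the empty word (root). $(K(w))_{w\in\mathcal W}$ are i.i.d. with law $\mu$. The tree $\mathcal T^{\rm GW}$ is the set of words $w=w_1\cdots w_k$ ($k\ge 0$) with $w_i\le K(w_1\cdots w_{i-1})$ for all $1\le i\le k$. $Z^{\rm GW}_k=\mathrm{card}\{w\in\mathcal T^{\rm GW}:|w|=k\}$, $Z^{\rm GW}_{\rm tot}=\sum_{k\ge0}Z^{\rm GW}_k$, and $\mathrm{Surv}^{\rm GW}=\{Z_k^{\rm GW}\ge1\ \forall k\}$. Words are ordered by: $w<w'$ if $|w|<|w'|$, or $|w|=|w'|$ and $w$ precedes $w'$ lexicographically. Coupon collector. For each $n\ge1$, independently of the tree, $\Delta_{i,n}$ ($1\le i\le n-1$) are independent, $\Delta_{i,n}$ geometric on $\mathbb N^*$ with success probability $1-i/n$; $T_{1,n}=0$, $T_{i,n}=\sum_{j=1}^{i-1}\Delta_{j,n}$, and $N_n(t)=\sum_{i=1}^n\mathbf 1_{\{T_{i,n}\le t\}}$, $t\in\mathbb N$. Transmission process. Start with $X(0)=\varnothing$, $\mathcal T^{\circ}(0)=\{\varnothing\}$, $\mathcal T^{\boxtimes}(0)=\{w\in\mathcal T^{\rm GW}:|w|=1\}$.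 Given the sets at time $t$: if $\mathcal T^{\boxtimes}(t)=\emptyset$, set $\tau_n=t$ and stop. Otherwise let $v=X(t+1)$ be the smallest element of $\mathcal T^{\boxtimes}(t)$ for the order $<$; if $N_n(t+1)=N_n(t)+1$, put $\mathcal T^\circ(t+1)=\mathcal T^\circ(t)\cup\{v\}$ and $\mathcal T^\boxtimes(t+1)=(\mathcal T^\boxtimes(t)\setminus\{v\})\cup\{v1,\dots,vK(v)\}$; if $N_n(t+1)=N_n(t)$, put $\mathcal T^\circ(t+1)=\mathcal T^\circ(t)$ and $\mathcal T^\boxtimes(t+1)=\mathcal T^\boxtimes(t)\setminus\{v\}$. Thus $\tau_n$ is the duration of the transmission and $N_n(\tau_n)=\mathrm{card}\,\mathcal T^\circ(\tau_n)$ the number of finally informed servers. *)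

theory Defs
  imports "HOL-Probability.Probability" "HOL-Library.List_Lenlexorder"
begin

section \<open>Galton--Watson tree\<close>

text \<open>
  The functionals below are deterministic: \<open>k w\<close> is the number of children of the word \<open>w\<close> in
  a given sample. Words are lists of positive integers. The order on words is the one of
  \<^theory>\<open>HOL-Library.List_Lenlexorder\<close> (length first, then lexicographic).
\<close>

definition words :: "nat list set" where
  "words = {w. \<forall>a\<in>set w. 1 \<le> a}"

definition gw_tree :: "(nat list \<Rightarrow> nat) \<Rightarrow> nat list set" where
  "gw_tree k = {w\<in>words. \<forall>i<length w. w ! i \<le> k (take i w)}"

definition gw_gen :: "(nat list \<Rightarrow> nat) \<Rightarrow> nat \<Rightarrow> nat" where
  "gw_gen k j = card {w\<in>gw_tree k. length w = j}"

definition gw_total :: "(nat list \<Rightarrow> nat) \<Rightarrow> ennreal" where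
  "gw_total k = (\<Sum>j. of_nat (gw_gen k j))"

definition gw_survives :: "(nat list \<Rightarrow> nat) \<Rightarrow> bool" where
  "gw_survives k \<longleftrightarrow> (\<forall>j. 1 \<le> gw_gen k j)"

section \<open>Coupon collector\<close>

text \<open>\<open>\<delta> i\<close> is the \<open>i\<close>-th waiting time, \<open>1 \<le> i \<le> n - 1\<close>.\<close>

definition coupon_time :: "(nat \<Rightarrow> nat) \<Rightarrow> nat \<Rightarrow> nat" where
  "coupon_time \<delta> i = (\<Sum>j\<in>{1..<i}. \<delta> j)"

definition coupon_count :: "nat \<Rightarrow> (nat \<Rightarrow> nat) \<Rightarrow> nat \<Rightarrow> nat" where
  "coupon_count n \<delta> t = (\<Sum>i\<in>{1..n}. if coupon_time \<delta> i \<le> t then 1 else 0)"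

section \<open>Transmission process\<close>

text \<open>
  The state at time \<open>t\<close> is the pair of the set of informed words and the set of pending words.
  After the transmission has stopped, the state is kept constant.
\<close>

fun transmission :: "nat \<Rightarrow> (nat list \<Rightarrow> nat) \<Rightarrow> (nat \<Rightarrow> nat) \<Rightarrow> nat \<Rightarrow> nat list set \<times> nat list set"
where
  "transmission n k \<delta> 0 = ({[]}, {w\<in>gw_tree k. length w = 1})"
| "transmission n k \<delta> (Suc t) =
    (let (I, P) = transmission n k \<delta> t; v = Min P in
     if P = {} then (I, P)
     else if coupon_count n \<delta> (t + 1) = coupon_count n \<delta> t + 1
       then (I \<union> {v}, (P - {v}) \<union> {v @ [i] | i. 1 \<le> i \<and> i \<le> k v})
     else (I, P - {v}))"

definition informed :: "nat \<Rightarrow> (nat list \<Rightarrow> nat) \<Rightarrow> (nat \<Rightarrow> nat) \<Rightarrow> nat \<Rightarrow> nat list set" where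
  "informed n k \<delta> t = fst (transmission n k \<delta> t)"

definition pending :: "nat \<Rightarrow> (nat list \<Rightarrow> nat) \<Rightarrow> (nat \<Rightarrow> nat) \<Rightarrow> nat \<Rightarrow> nat list set" where
  "pending n k \<delta> t = snd (transmission n k \<delta> t)"

definition duration :: "nat \<Rightarrow> (nat list \<Rightarrow> nat) \<Rightarrow> (nat \<Rightarrow> nat) \<Rightarrow> nat" where
  "duration n k \<delta> = (LEAST t. pending n k \<delta> t = {})"

text \<open>
  The pending sets are finite, so that \<^const>\<open>Min\<close> is meaningful, and the transmission always
  stops, so that the \<open>LEAST\<close> above is meaningful.
\<close>

lemma pending_0: "pending n k \<delta> 0 = (\<lambda>i. [i]) ` {1..k []}"
proof -
  have "{w\<in>gw_tree k. length w = 1} = (\<lambda>i. [i]) ` {1..k []}"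
    by (auto simp: gw_tree_def words_def length_Suc_conv)
  then show ?thesis by (simp add: pending_def)
qed

lemma pending_Suc:
  "pending n k \<delta> (Suc t) =
    (if pending n k \<delta> t = {} then {}
     else if coupon_count n \<delta> (t + 1) = coupon_count n \<delta> t + 1
       then (pending n k \<delta> t - {Min (pending n k \<delta> t)}) \<union>
            (\<lambda>i. Min (pending n k \<delta> t) @ [i]) ` {1..k (Min (pending n k \<delta> t))}
     else pending n k \<delta> t - {Min (pending n k \<delta> t)})"
  by (auto simp: pending_def Let_def split: prod.splits)

lemma finite_pending: "finite (pending n k \<delta> t)"
  by (induction t) (auto simp: pending_0 pending_Suc simp del: transmission.simps)

lemma coupon_count_late:
  assumes "coupon_time \<delta> n \<le> t"
  shows "coupon_count n \<delta> t = n"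
proof -
  have "coupon_time \<delta> i \<le> t" if "i \<in> {1..n}" for i
  proof -
    have "coupon_time \<delta> i \<le> coupon_time \<delta> n"
      unfolding coupon_time_def using that by (intro sum_mono2) auto
    with assms show ?thesis by simp
  qed
  then show ?thesis by (simp add: coupon_count_def)
qed

lemma transmission_stops: "\<exists>t. pending n k \<delta> t = {}"
proof -
  let ?s = "coupon_time \<delta> n"
  have "card (pending n k \<delta> (?s + j)) \<le> card (pending n k \<delta> ?s) - j" for j
  proof (induction j)
    case (Suc j)
    have "coupon_count n \<delta> (?s + j + 1) = n" "coupon_count n \<delta> (?s + j) = n"
      by (simp_all add: coupon_count_late)
    then have eq: "pending n k \<delta> (?s + Suc j) =
        pending n k \<delta> (?s + j) - {Min (pending n k \<delta> (?s + j))}"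
      using pending_Suc[of n k \<delta> "?s + j"] by auto
    show ?case
    proof (cases "pending n k \<delta> (?s + j) = {}")
      case False
      then have "Min (pending n k \<delta> (?s + j)) \<in> pending n k \<delta> (?s + j)"
        using finite_pending Min_in by blast
      then show ?thesis unfolding eq using Suc by simp
    next
      case True
      then show ?thesis unfolding eq by simp
    qed
  qed simp
  from this[of "card (pending n k \<delta> ?s)"]
  have "pending n k \<delta> (?s + card (pending n k \<delta> ?s)) = {}"
    using finite_pending by (metis card_0_eq diff_self_eq_0 le_zero_eq)
  then show ?thesis ..
qed

section \<open>The limiting constants\<close>

definition pmf_mean :: "nat pmf \<Rightarrow> ennreal" where
  "pmf_mean \<mu> = (\<integral>\<^sup>+ k. of_nat k \<partial>measure_pmf \<mu>)"

definition limit_theta :: "ennreal \<Rightarrow> ennreal" where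
  "limit_theta m =
    (if m \<le> 1 then 0
     else if m = \<infinity> then \<infinity>
     else ennreal (THE x. 0 < x \<and> (1 - exp (- x)) / x = 1 / enn2real m))"

text \<open>\<open>1 - exp (- \<theta>)\<close>, read as 1 for \<open>\<theta> = \<infinity>\<close>.\<close>

definition limit_p :: "ennreal \<Rightarrow> real" where
  "limit_p m =
    (if limit_theta m = \<infinity> then 1 else 1 - exp (- enn2real (limit_theta m)))"

lemma limit_theta_root:
  fixes a :: real
  assumes "1 < a"
  shows "\<exists>!x. 0 < x \<and> (1 - exp (- x)) / x = 1 / a"
proof -
  let ?f = "\<lambda>x::real. (1 - exp (- x)) / x"
  have anti: "?f y < ?f x" if "0 < x" "x < y" for x y
  proof (rule DERIV_neg_imp_decreasing[OF \<open>x < y\<close>])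
    fix z assume "x \<le> z" "z \<le> y"
    with that have z: "0 < z" by simp
    have "(?f has_real_derivative (exp (- z) * z - (1 - exp (- z))) / (z * z)) (at z)"
      using z by (auto intro!: derivative_eq_intros simp: field_simps)
    moreover have "exp (- z) * z - (1 - exp (- z)) < 0"
    proof -
      have "1 + z < exp z"
        using z exp_minus_greater[of "- z"] by simp
      then have "exp (- z) * (1 + z) < exp (- z) * exp z"
        by simp
      then show ?thesis by (simp add: algebra_simps flip: exp_add)
    qed
    ultimately show "\<exists>d. (?f has_real_derivative d) (at z) \<and> d < 0"
      using z by (intro exI[of _ "(exp (- z) * z - (1 - exp (- z))) / (z * z)"])
        (auto simp: divide_less_0_iff)
  qed
  have "(?f \<longlongrightarrow> 1) (at_right 0)" "(?f \<longlongrightarrow> 0) at_top"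
    by real_asymp+
  then have "eventually (\<lambda>x. 1 / a < ?f x) (at_right 0)" "eventually (\<lambda>x. ?f x < 1 / a) at_top"
    using assms order_tendstoD(1)[of ?f 1 "at_right 0" "1 / a"]
      order_tendstoD(2)[of ?f 0 at_top "1 / a"] by simp_all
  then obtain b B where b: "0 < b" "\<And>x. 0 < x \<Longrightarrow> x < b \<Longrightarrow> 1 / a < ?f x"
    and B: "\<And>x. B \<le> x \<Longrightarrow> ?f x < 1 / a"
    by (auto simp: eventually_at_right_field eventually_at_top_linorder)
  let ?x = "b / 2" and ?y = "max b B"
  have "\<exists>x\<ge>?x. x \<le> ?y \<and> ?f x = 1 / a"
    using b(1) b(2)[of ?x] B[of ?y]
    by (intro IVT2') (auto intro!: continuous_intros less_imp_le)
  then obtain x where x: "0 < x" "?f x = 1 / a"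
    using b(1) by (metis half_gt_zero less_le_trans)
  show ?thesis
  proof (rule ex1I[of _ x])
    fix y assume "0 < y \<and> ?f y = 1 / a"
    then show "y = x" using anti[of x y] anti[of y x] x by force
  qed (use x in simp)
qed

section \<open>Convergence in probability\<close>

text \<open>
  The metric is a parameter: it is \<^const>\<open>dist\<close> for real random variables and the metric
  \<open>ennreal_dist\<close> below for random variables in \<open>[0, \<infinity>]\<close>. Measurability is required because
  \<^const>\<open>measure\<close> is 0 on sets that are not measurable.
\<close>

definition tends_in_prob ::
  "'a measure \<Rightarrow> ('b::topological_space \<Rightarrow> 'b \<Rightarrow> real) \<Rightarrow> (nat \<Rightarrow> 'a \<Rightarrow> 'b) \<Rightarrow> ('a \<Rightarrow> 'b) \<Rightarrow> bool"
where
  "tends_in_prob M d X Y \<longleftrightarrow>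
    (\<forall>n. X n \<in> borel_measurable M) \<and> Y \<in> borel_measurable M \<and>
    (\<forall>\<epsilon>>0. (\<lambda>n. measure M {\<omega>\<in>space M. \<epsilon> < d (X n \<omega>) (Y \<omega>)}) \<longlonglongrightarrow> 0)"

text \<open>
  The metric on the compact space \<open>[0, \<infinity>]\<close> transported from \<open>[0, 1]\<close> by \<open>x \<mapsto> 1 / (1 + x)\<close>,
  with \<open>1 / (1 + \<infinity>) = 0\<close>; it induces the usual topology.
\<close>

definition ennreal_dist :: "ennreal \<Rightarrow> ennreal \<Rightarrow> real" where
  "ennreal_dist x y = \<bar>enn2real (1 / (1 + x)) - enn2real (1 / (1 + y))\<bar>"

lemma inverse_one_plus_less_iff:
  "enn2real (1 / (1 + x)) < enn2real (1 / (1 + y)) \<longleftrightarrow> y < (x::ennreal)"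
proof -
  have real: "enn2real (1 / (1 + ennreal r)) = 1 / (1 + r)" if "0 \<le> r" for r
  proof -
    have "1 + ennreal r = ennreal (1 + r)" using that by simp
    then have "1 / (1 + ennreal r) = ennreal (1 / (1 + r))"
      using that divide_ennreal[of 1 "1 + r"] by simp
    then show ?thesis using that by simp
  qed
  show ?thesis
    by (cases x; cases y) (auto simp: real divide_simps ennreal_less_iff)
qed

lemma tendsto_iff_ennreal_dist:
  "(f \<longlongrightarrow> l) F \<longleftrightarrow> ((\<lambda>x. ennreal_dist (f x) l) \<longlongrightarrow> 0) F"
proof
  let ?g = "\<lambda>x::ennreal. 1 / (1 + x)"
  assume "(f \<longlongrightarrow> l) F"
  then have "((\<lambda>x. 1 + f x) \<longlongrightarrow> 1 + l) F"
    by (intro tendsto_intros) auto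
  then have "((\<lambda>x. inverse (1 + f x)) \<longlongrightarrow> inverse (1 + l)) F"
    by (rule continuous_on_tendsto_compose[OF continuous_on_inverse_ennreal[OF continuous_on_id],
        where s = UNIV]) auto
  then have "((\<lambda>x. ?g (f x)) \<longlongrightarrow> ?g l) F" by (simp add: divide_ennreal_def)
  moreover have "ennreal (enn2real (?g l)) = ?g l"
    by (rule ennreal_enn2real) (simp add: divide_ennreal_def flip: less_top)
  ultimately have "((\<lambda>x. enn2real (?g (f x))) \<longlongrightarrow> enn2real (?g l)) F"
    by (intro tendsto_enn2real) simp_all
  then show "((\<lambda>x. ennreal_dist (f x) l) \<longlongrightarrow> 0) F"
    unfolding ennreal_dist_def tendsto_rabs_zero_iff by (rule LIM_zero)
next
  let ?\<phi> = "\<lambda>x::ennreal. enn2real (1 / (1 + x))"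
  assume "((\<lambda>x. ennreal_dist (f x) l) \<longlongrightarrow> 0) F"
  then have lim: "((\<lambda>x. ?\<phi> (f x)) \<longlongrightarrow> ?\<phi> l) F"
    unfolding ennreal_dist_def tendsto_rabs_zero_iff by (rule LIM_zero_cancel)
  show "(f \<longlongrightarrow> l) F"
  proof (rule order_tendstoI)
    fix a assume "a < l"
    then have "?\<phi> l < ?\<phi> a" by (simp only: inverse_one_plus_less_iff)
    from order_tendstoD(2)[OF lim this] show "\<forall>\<^sub>F x in F. a < f x"
      by (simp only: inverse_one_plus_less_iff)
  next
    fix a assume "l < a"
    then have "?\<phi> a < ?\<phi> l" by (simp only: inverse_one_plus_less_iff)
    from order_tendstoD(1)[OF lim this] show "\<forall>\<^sub>F x in F. f x < a"
      by (simp only: inverse_one_plus_less_iff)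
  qed
qed

end

theory Submission
  imports Defs
begin

text \<open>
  Read the offspring numbers in the order in which the words are informed: \<open>\<xi>\<^sub>0\<close> at the root,
  \<open>\<xi>\<^sub>j\<close> at the word of the \<open>j\<close>-th success. Which word is read next depends only on the waiting
  times and on the numbers already read, and no word is read twice, so the \<open>\<xi>\<^sub>j\<close> are i.i.d. with
  law \<open>\<mu>\<close> and independent of the waiting times. With \<open>S\<^sub>j = \<xi>\<^sub>0 + \<dots> + \<xi>\<^sub>j\<^sub>-\<^sub>1\<close> and
  \<open>T\<^sub>j = \<Delta>\<^sub>1 + \<dots> + \<Delta>\<^sub>j\<close>, the final number \<open>X\<close> of informed vertices is the first \<open>j\<close> with
  \<open>S\<^sub>j < T\<^sub>j\<close>, or \<open>n\<close>, and the duration is \<open>S\<^sub>X\<close>.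

  Since \<open>S\<^sub>j\<close> is about \<open>m j\<close> and \<open>T\<^sub>j\<close> is about \<open>- n ln (1 - j / n)\<close>, the sign of
  \<open>m y + ln (1 - y)\<close> decides whether \<open>X\<close> can stop before \<open>y n\<close>, and \<open>p = 1 - exp (- \<theta>)\<close> is the zero
  of this function. Below the zero, concavity of the logarithm makes a Chernoff bound for the
  probability of \<open>S\<^sub>j < T\<^sub>j\<close> decay geometrically in \<open>j\<close>, uniformly in \<open>n\<close>, so \<open>X\<close> is either bounded or at
  least \<open>y n\<close>. If \<open>X\<close> is bounded then with high probability no attempt failed, the whole tree has
  been explored, and it is finite. In the case of mean at most 1 the walk \<open>S\<^sub>j - j\<close> gets negative
  almost surely by a maximum principle, so the tree is finite.
\<close>

section \<open>The exploration as an adaptive reading of the offspring numbers\<close>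

text \<open>The reading order depends on \<open>n\<close>, so different \<open>n\<close> give
  different walks on the same tree. Nothing is coupled across \<open>n\<close>; each estimate is for
  one \<open>n\<close>, with constants that do not depend on it. Survival is not determined by such
  a walk. It enters only through a cutoff \<open>A\<close> fixed before \<open>n\<close> tends to
  infinity: the first \<open>A\<close> waiting times all equal 1 with probability at least
  \<open>1 - A^2 / n\<close>, and then stopping with at most \<open>A\<close> informed words means
  that the tree is finite. Stopping at steps between \<open>A\<close> and \<open>y n\<close> has to
  be excluded for all these steps at once, so a law of large numbers at single steps is too weak and
  a bound summable in \<open>j\<close> is needed. No moment beyond the mean is available, and the
  mean may be infinite. The lower tail of \<open>S\<close> is harmless, since Laplace transforms at
  negative arguments always exist; the upper tail comes from truncation, with Markov's inequality
  for the excess. The waiting times are positive only almost surely, while injectivity and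
  adaptedness of the reading are wanted for every sample, hence a modified version of these
  times.\<close>

text \<open>When nothing is pending, \<open>attempt\<close> returns a word longer than all words attempted before, so
  that attempts never repeat, even after the transmission has stopped.\<close>

definition attempt :: "nat \<Rightarrow> (nat \<Rightarrow> nat) \<Rightarrow> nat \<Rightarrow> (nat list \<Rightarrow> nat) \<Rightarrow> nat list" where
  "attempt n \<delta> t k =
    (if pending n k \<delta> t = {} then replicate (t + 2) 1 else Min (pending n k \<delta> t))"

text \<open>\<open>reader n \<delta> j\<close> is the word of the \<open>j\<close>-th success, with the root for \<open>j = 0\<close>; the attempt made
  at time \<open>t + 1\<close> is \<open>attempt n \<delta> t\<close>.\<close>

definition reader :: "nat \<Rightarrow> (nat \<Rightarrow> nat) \<Rightarrow> nat \<Rightarrow> (nat list \<Rightarrow> nat) \<Rightarrow> nat list" where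
  "reader n \<delta> j k = (if j = 0 then [] else attempt n \<delta> (coupon_time \<delta> (j + 1) - 1) k)"

section \<open>Elementary facts on the tree and on the clock of successes\<close>

lemma Nil_in_gw_tree [simp]: "[] \<in> gw_tree k"
  by (simp add: gw_tree_def words_def)

lemma snoc_in_gw_tree [simp]: "v @ [i] \<in> gw_tree k \<longleftrightarrow> v \<in> gw_tree k \<and> 1 \<le> i \<and> i \<le> k v"
proof -
  have "(\<forall>j<Suc (length v). (v @ [i]) ! j \<le> k (take j (v @ [i]))) \<longleftrightarrow>
    (\<forall>j<length v. v ! j \<le> k (take j v)) \<and> i \<le> k v"
    by (auto simp: less_Suc_eq nth_append)
  then show ?thesis by (auto simp: gw_tree_def words_def)
qed

lemma gw_tree_subset_words: "gw_tree k \<subseteq> words"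
  by (auto simp: gw_tree_def)

lemma informed_0: "informed n k \<delta> 0 = {[]}"
  by (simp add: informed_def)

lemma informed_Suc:
  "informed n k \<delta> (Suc t) =
    (if pending n k \<delta> t \<noteq> {} \<and> coupon_count n \<delta> (t + 1) = coupon_count n \<delta> t + 1
     then insert (Min (pending n k \<delta> t)) (informed n k \<delta> t) else informed n k \<delta> t)"
  by (auto simp: informed_def pending_def Let_def split: prod.splits)

lemma coupon_time_1 [simp]: "coupon_time \<delta> (Suc 0) = 0"
  by (simp add: coupon_time_def)

lemma coupon_time_Suc: "1 \<le> i \<Longrightarrow> coupon_time \<delta> (Suc i) = coupon_time \<delta> i + \<delta> i"
  by (simp add: coupon_time_def)

lemma coupon_time_mono: "i \<le> j \<Longrightarrow> coupon_time \<delta> i \<le> coupon_time \<delta> j"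
  unfolding coupon_time_def by (intro sum_mono2) auto

lemma coupon_time_cong:
  "(\<And>j. 1 \<le> j \<Longrightarrow> j < i \<Longrightarrow> \<delta> j = \<delta>' j) \<Longrightarrow> coupon_time \<delta> i = coupon_time \<delta>' i"
  unfolding coupon_time_def by (intro sum.cong) auto

lemma coupon_count_cong:
  assumes "\<And>j. 1 \<le> j \<Longrightarrow> j < n \<Longrightarrow> \<delta> j = \<delta>' j"
  shows "coupon_count n \<delta> = coupon_count n \<delta>'"
proof
  fix t show "coupon_count n \<delta> t = coupon_count n \<delta>' t"
    unfolding coupon_count_def
    by (intro sum.cong refl) (use assms coupon_time_cong[of _ \<delta> \<delta>'] in auto)
qed

lemma transmission_cong:
  assumes "\<And>j. 1 \<le> j \<Longrightarrow> j < n \<Longrightarrow> \<delta> j = \<delta>' j"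
  shows "transmission n k \<delta> t = transmission n k \<delta>' t"
proof -
  have "coupon_count n \<delta> = coupon_count n \<delta>'" using assms by (rule coupon_count_cong)
  then show ?thesis by (induction t) (simp_all add: Let_def split: prod.split)
qed

text \<open>The process for \<open>n\<close> sees the waiting times only at indices 1 to
  \<open>n - 1\<close>. Almost sure positivity of these finitely many times thus allows passing to a
  version that is positive at every index.\<close>

lemma duration_cong:
  assumes "\<And>j. 1 \<le> j \<Longrightarrow> j < n \<Longrightarrow> \<delta> j = \<delta>' j"
  shows "duration n k \<delta> = duration n k \<delta>'"
proof -
  have "transmission n k \<delta> = transmission n k \<delta>'" using assms by (intro ext transmission_cong)
  then show ?thesis by (simp add: duration_def pending_def)
qed

text \<open>Supplies the hypothesis \<open>U_cong\<close> of \<open>indep_adaptive_reading\<close>.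
  The time of success number \<open>i\<close> involves the waiting time of index \<open>i\<close>,
  hence \<open>i < n\<close>.\<close>

lemma reader_cong:
  assumes "\<And>j. 1 \<le> j \<Longrightarrow> j < n \<Longrightarrow> \<delta> j = \<delta>' j" "i < n"
  shows "reader n \<delta> i = reader n \<delta>' i"
proof -
  have "coupon_time \<delta> (i + 1) = coupon_time \<delta>' (i + 1)"
    using assms by (intro coupon_time_cong) auto
  moreover have "transmission n k \<delta> t = transmission n k \<delta>' t" for k t
    using assms(1) by (rule transmission_cong)
  ultimately show ?thesis
    by (simp add: fun_eq_iff reader_def attempt_def pending_def)
qed

lemma coupon_count_card: "coupon_count n \<delta> t = card {i\<in>{1..n}. coupon_time \<delta> i \<le> t}"
  unfolding coupon_count_def by (subst sum.inter_filter[symmetric]) auto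

lemma coupon_count_le: "coupon_count n \<delta> t \<le> n"
proof -
  have "card {i\<in>{1..n}. coupon_time \<delta> i \<le> t} \<le> card {1..n}" by (intro card_mono) auto
  then show ?thesis by (simp add: coupon_count_card)
qed

lemma coupon_count_mono: "s \<le> t \<Longrightarrow> coupon_count n \<delta> s \<le> coupon_count n \<delta> t"
  unfolding coupon_count_card by (intro card_mono) auto

text \<open>The duality between a counting process and its jump times: \<open>coupon_time\<close> is
  nondecreasing in the index, so the indices counted up to time \<open>t\<close> form an initial
  segment.\<close>

lemma le_coupon_count_iff:
  assumes "1 \<le> i" "i \<le> n"
  shows "i \<le> coupon_count n \<delta> t \<longleftrightarrow> coupon_time \<delta> i \<le> t"
proof
  assume "coupon_time \<delta> i \<le> t"
  then have "{1..i} \<subseteq> {i\<in>{1..n}. coupon_time \<delta> i \<le> t}"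
    using assms by (auto intro: order_trans[OF coupon_time_mono])
  then have "card {1..i} \<le> coupon_count n \<delta> t"
    unfolding coupon_count_card by (intro card_mono) auto
  then show "i \<le> coupon_count n \<delta> t" by simp
next
  assume *: "i \<le> coupon_count n \<delta> t"
  show "coupon_time \<delta> i \<le> t"
  proof (rule ccontr)
    assume "\<not> coupon_time \<delta> i \<le> t"
    then have "\<not> coupon_time \<delta> j \<le> t" if "i \<le> j" for j
      using coupon_time_mono[OF that, of \<delta>] by simp
    then have "{i\<in>{1..n}. coupon_time \<delta> i \<le> t} \<subseteq> {1..<i}" by (auto simp: not_le[symmetric])
    then have "coupon_count n \<delta> t \<le> card {1..<i}"
      unfolding coupon_count_card by (intro card_mono) auto
    with * assms show False by simp
  qed
qed

section \<open>State of the exploration at a given time\<close>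

lemma pending_duration: "pending n k \<delta> (duration n k \<delta>) = {}"
  unfolding duration_def by (rule LeastI_ex) (rule transmission_stops)

lemma pending_nonempty: "t < duration n k \<delta> \<Longrightarrow> pending n k \<delta> t \<noteq> {}"
  unfolding duration_def by (rule not_less_Least)

lemma Min_pending: "pending n k \<delta> t \<noteq> {} \<Longrightarrow> Min (pending n k \<delta> t) \<in> pending n k \<delta> t"
  by (rule Min_in[OF finite_pending])

lemma informed_mono: "s \<le> t \<Longrightarrow> informed n k \<delta> s \<subseteq> informed n k \<delta> t"
  by (rule lift_Suc_mono_le[of "informed n k \<delta>"]) (auto simp: informed_Suc)

lemma finite_informed: "finite (informed n k \<delta> t)"
  by (induction t) (auto simp: informed_0 informed_Suc)

lemma Nil_informed: "[] \<in> informed n k \<delta> t"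
  using informed_mono[of 0 t n k \<delta>] by (simp add: informed_0)

text \<open>Disjointness is not inductive by itself: the children of the newly informed word must be
  known not to be informed already. This follows if the informed set is closed under parents, a
  clause of \<open>inv\<close> which in turn needs that parents of pending words are informed. The
  length bound serves for comparison with the padding words of \<open>attempt\<close>, which have
  length \<open>t + 2\<close>.\<close>

lemma exploration_invariant:
  shows informed_pending_disjoint: "informed n k \<delta> t \<inter> pending n k \<delta> t = {}"
    and pending_parent: "w \<in> pending n k \<delta> t \<Longrightarrow> \<exists>v i. w = v @ [i] \<and> v \<in> informed n k \<delta> t"
    and explored_in_tree: "informed n k \<delta> t \<union> pending n k \<delta> t \<subseteq> gw_tree k"
    and explored_length: "w \<in> informed n k \<delta> t \<union> pending n k \<delta> t \<Longrightarrow> length w \<le> Suc t"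
proof -
  let ?I = "informed n k \<delta>" and ?P = "pending n k \<delta>"
  define inv where "inv t \<longleftrightarrow> ?I t \<inter> ?P t = {} \<and>
    (\<forall>w\<in>?P t. \<exists>v i. w = v @ [i] \<and> v \<in> ?I t) \<and>
    (\<forall>v i. v @ [i] \<in> ?I t \<longrightarrow> v \<in> ?I t) \<and> ?I t \<union> ?P t \<subseteq> gw_tree k \<and>
    (\<forall>w\<in>?I t \<union> ?P t. length w \<le> Suc t)" for t
  have "inv t"
  proof (induction t)
    case 0
    have "[i] \<in> gw_tree k" if "i \<in> {1..k []}" for i
      using snoc_in_gw_tree[of "[]" i k] that by simp
    then have tree: "(\<lambda>i. [i]) ` {1..k []} \<subseteq> gw_tree k" by blast
    show ?case unfolding inv_def informed_0 pending_0
    proof (intro conjI ballI allI impI)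
      fix w assume "w \<in> (\<lambda>i. [i]) ` {1..k []}"
      then obtain i where "w = [] @ [i]" by auto
      then show "\<exists>v i. w = v @ [i] \<and> v \<in> {[]}" by blast
    qed (use tree in auto)
  next
    case (Suc t)
    then have disj: "?I t \<inter> ?P t = {}" and par: "\<And>w. w \<in> ?P t \<Longrightarrow> \<exists>v i. w = v @ [i] \<and> v \<in> ?I t"
      and clo: "\<And>v i. v @ [i] \<in> ?I t \<Longrightarrow> v \<in> ?I t" and tree: "?I t \<union> ?P t \<subseteq> gw_tree k"
      and len: "\<And>w. w \<in> ?I t \<union> ?P t \<Longrightarrow> length w \<le> Suc t"
      by (auto simp: inv_def)
    have len': "length w \<le> Suc (Suc t)" if "w \<in> ?I t \<union> ?P t" for w
      using len[OF that] by simp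
    show ?case
    proof (cases "?P t = {}")
      case True
      then have "?I (Suc t) = ?I t" "?P (Suc t) = ?P t" by (simp_all add: informed_Suc pending_Suc)
      then show ?thesis using disj par clo tree len' unfolding inv_def by simp
    next
      case False
      define v where "v = Min (?P t)"
      have v: "v \<in> ?P t" "v \<notin> ?I t" using Min_pending[OF False] disj by (auto simp: v_def)
      show ?thesis
      proof (cases "coupon_count n \<delta> (t + 1) = coupon_count n \<delta> t + 1")
        case False
        with \<open>?P t \<noteq> {}\<close> have eqs: "?I (Suc t) = ?I t" "?P (Suc t) = ?P t - {v}"
          by (simp_all add: informed_Suc pending_Suc v_def)
        have "?I t \<inter> (?P t - {v}) = {}" "?I t \<union> (?P t - {v}) \<subseteq> gw_tree k" using disj tree by auto
        moreover have "\<forall>w\<in>?I t \<union> (?P t - {v}). length w \<le> Suc (Suc t)" using len' by auto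
        ultimately show ?thesis using par clo unfolding inv_def eqs by simp
      next
        case True
        with \<open>?P t \<noteq> {}\<close> have eqs: "?I (Suc t) = insert v (?I t)"
          "?P (Suc t) = ?P t - {v} \<union> (\<lambda>i. v @ [i]) ` {1..k v}"
          by (simp_all add: informed_Suc pending_Suc v_def)
        have par': "u \<in> ?I t" if "u @ [i] \<in> ?P t" for u i
          using par[OF that] by simp
        show ?thesis unfolding inv_def eqs
        proof (intro conjI)
          show "insert v (?I t) \<inter> (?P t - {v} \<union> (\<lambda>i. v @ [i]) ` {1..k v}) = {}"
            using disj v clo[of v] by auto
          show "\<forall>w\<in>?P t - {v} \<union> (\<lambda>i. v @ [i]) ` {1..k v}. \<exists>u i. w = u @ [i] \<and> u \<in> insert v (?I t)"
            using par by auto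
          show "\<forall>u i. u @ [i] \<in> insert v (?I t) \<longrightarrow> u \<in> insert v (?I t)"
            using clo par' v by auto
          show "insert v (?I t) \<union> (?P t - {v} \<union> (\<lambda>i. v @ [i]) ` {1..k v}) \<subseteq> gw_tree k"
            using tree v by auto
          show "\<forall>w\<in>insert v (?I t) \<union> (?P t - {v} \<union> (\<lambda>i. v @ [i]) ` {1..k v}). length w \<le> Suc (Suc t)"
            using len[of v] v len' by auto
        qed
      qed
    qed
  qed
  then show "?I t \<inter> ?P t = {}" "w \<in> ?P t \<Longrightarrow> \<exists>v i. w = v @ [i] \<and> v \<in> ?I t"
    "?I t \<union> ?P t \<subseteq> gw_tree k" "w \<in> ?I t \<union> ?P t \<Longrightarrow> length w \<le> Suc t" unfolding inv_def by blast+
qed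

lemma attempt_in_words: "attempt n \<delta> t k \<in> words"
proof (cases "pending n k \<delta> t = {}")
  case False
  then have "attempt n \<delta> t k \<in> pending n k \<delta> t"
    using Min_pending by (simp add: attempt_def)
  then show ?thesis
    using explored_in_tree[of n k \<delta> t] gw_tree_subset_words[of k] by blast
qed (simp add: attempt_def words_def)

lemma reader_in_words: "reader n \<delta> j k \<in> words"
proof (cases "j = 0")
  case True
  then show ?thesis by (simp add: reader_def words_def)
next
  case False
  then show ?thesis by (simp add: reader_def attempt_in_words)
qed

section \<open>Pathwise analysis of one sample with positive waiting times\<close>

locale coupon_collection =
  fixes n :: nat and \<delta> :: "nat \<Rightarrow> nat"
  assumes n_pos: "1 \<le> n" and waiting_pos: "1 \<le> \<delta> i"
begin

abbreviation "T \<equiv> coupon_time \<delta>"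
abbreviation "N \<equiv> coupon_count n \<delta>"

lemma T_strict_mono: "1 \<le> i \<Longrightarrow> i < j \<Longrightarrow> T i < T j"
proof -
  assume "1 \<le> i" "i < j"
  then have "T i < T (Suc i)" using waiting_pos[of i] by (simp add: coupon_time_Suc)
  also have "\<dots> \<le> T j" using \<open>i < j\<close> by (intro coupon_time_mono) simp
  finally show ?thesis .
qed

lemma le_T: "i \<le> T (Suc i)"
proof (induction i)
  case (Suc i)
  then show ?case using waiting_pos[of "Suc i"] coupon_time_Suc[of "Suc i" \<delta>] by simp
qed simp

lemma N_pos: "1 \<le> N t"
  using le_coupon_count_iff[of 1 n \<delta> t] n_pos by simp

lemma N_0: "N 0 = 1"
proof -
  have "\<not> 2 \<le> N 0"
  proof
    assume "2 \<le> N 0"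
    then have "T 2 \<le> 0"
      using le_coupon_count_iff[of 2 n \<delta> 0] coupon_count_le[of n \<delta> 0] by simp
    then show False using T_strict_mono[of 1 2] by simp
  qed
  with N_pos[of 0] show ?thesis by simp
qed

lemma less_T_Suc_N: "N t < n \<Longrightarrow> t < T (Suc (N t))"
  using le_coupon_count_iff[of "Suc (N t)" n \<delta> t] by simp

text \<open>Positive waiting times make \<open>T\<close> strictly increasing, so at most one success
  falls in a unit of time. The jump time in the second alternative is what identifies the attempted
  word with a value of \<open>reader\<close>.\<close>

lemma N_Suc: "N (Suc t) = N t \<or> N (Suc t) = Suc (N t) \<and> T (Suc (N t)) = Suc t \<and> N t < n"
proof (cases "N (Suc t) = N t")
  case False
  with coupon_count_mono[of t "Suc t" n \<delta>] have *: "Suc (N t) \<le> N (Suc t)" by simp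
  with coupon_count_le[of n \<delta> "Suc t"] have "N t < n" by simp
  have "\<not> Suc (Suc (N t)) \<le> N (Suc t)"
  proof
    assume **: "Suc (Suc (N t)) \<le> N (Suc t)"
    with coupon_count_le[of n \<delta> "Suc t"] have "T (Suc (Suc (N t))) \<le> Suc t"
      using le_coupon_count_iff[of "Suc (Suc (N t))" n \<delta> "Suc t"] by simp
    with T_strict_mono[of "Suc (N t)" "Suc (Suc (N t))"] less_T_Suc_N[OF \<open>N t < n\<close>]
    show False by simp
  qed
  moreover have "T (Suc (N t)) \<le> Suc t"
    using * le_coupon_count_iff[of "Suc (N t)" n \<delta> "Suc t"] \<open>N t < n\<close> by simp
  ultimately show ?thesis using * less_T_Suc_N[OF \<open>N t < n\<close>] \<open>N t < n\<close> by simp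
qed simp

text \<open>The instant just before success number \<open>j\<close> is where \<open>reader\<close>
  looks at the state. Positivity of the time makes the subtraction of naturals a true
  predecessor.\<close>

lemma N_before:
  assumes "1 \<le> j" "j < n" shows "N (T (Suc j) - 1) = j" "0 < T (Suc j)"
proof -
  have *: "T j < T (Suc j)" using T_strict_mono[of j "Suc j"] assms by simp
  then have "j \<le> N (T (Suc j) - 1)"
    using le_coupon_count_iff[of j n \<delta> "T (Suc j) - 1"] assms by simp
  moreover have "\<not> Suc j \<le> N (T (Suc j) - 1)"
    using le_coupon_count_iff[of "Suc j" n \<delta> "T (Suc j) - 1"] assms * by simp
  ultimately show "N (T (Suc j) - 1) = j" "0 < T (Suc j)" using * by simp_all
qed

lemma reader_success:
  assumes "N (Suc t) = Suc (N t)" "pending n k \<delta> t \<noteq> {}"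
  shows "reader n \<delta> (N t) k = Min (pending n k \<delta> t)"
proof -
  have "T (Suc (N t)) = Suc t" using N_Suc[of t] assms by auto
  moreover have "N t \<noteq> 0" using N_pos[of t] by simp
  ultimately show ?thesis using assms by (simp add: reader_def attempt_def)
qed

text \<open>The offspring numbers are consulted only at the root and at the word of each success. A
  success at time \<open>t + 1\<close> consults the word of index \<open>N t\<close>, and
  \<open>N t < N (Suc t) \<le> j\<close>, so agreement along the words read under \<open>k\<close>
  already forces the two explorations to coincide.\<close>

lemma transmission_adapted:
  assumes "\<And>i. i < j \<Longrightarrow> k (reader n \<delta> i k) = k' (reader n \<delta> i k)" "1 \<le> j" "N t \<le> j"
  shows "transmission n k \<delta> t = transmission n k' \<delta> t"
  using assms(3)
proof (induction t)
  case 0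
  have "k [] = k' []" using assms(1)[of 0] assms(2) by (simp add: reader_def)
  then have "pending n k \<delta> 0 = pending n k' \<delta> 0" by (simp add: pending_0)
  then show ?case by (simp add: pending_def)
next
  case (Suc t)
  then have "N t \<le> j" using coupon_count_mono[of t "Suc t" n \<delta>] by simp
  from Suc.IH[OF this] have eq: "transmission n k \<delta> t = transmission n k' \<delta> t" .
  then have P: "pending n k \<delta> t = pending n k' \<delta> t" and I: "informed n k \<delta> t = informed n k' \<delta> t"
    by (simp_all add: pending_def informed_def)
  have "k (Min (pending n k \<delta> t)) = k' (Min (pending n k \<delta> t))"
    if "N (Suc t) = Suc (N t)" "pending n k \<delta> t \<noteq> {}"
    using assms(1)[of "N t"] that Suc.prems by (simp add: reader_success)
  then have "pending n k \<delta> (Suc t) = pending n k' \<delta> (Suc t)"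
    "informed n k \<delta> (Suc t) = informed n k' \<delta> (Suc t)"
    by (simp_all add: pending_Suc informed_Suc P I)
  then show ?case by (simp add: pending_def informed_def prod_eq_iff)
qed

lemma reader_adapted:
  assumes "j < n" "\<And>i. i < j \<Longrightarrow> k (reader n \<delta> i k) = k' (reader n \<delta> i k)"
  shows "reader n \<delta> j k = reader n \<delta> j k'"
proof (cases "j = 0")
  case False
  then have "transmission n k \<delta> (T (Suc j) - 1) = transmission n k' \<delta> (T (Suc j) - 1)"
    using assms N_before(1)[of j] by (intro transmission_adapted[of j]) auto
  with False show ?thesis by (simp add: reader_def attempt_def pending_def)
qed (simp add: reader_def)

text \<open>The second equation is a balance: every attempt removes one pending word and every
  number read adds that many, so pending words plus attempts made equal the sum of the numbers read.
  After the duration time advances without attempts, which explains the restriction. The count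
  \<open>N t\<close> includes the root, so the indices run from 0 to \<open>N t - 1\<close>.\<close>

lemma reader_informed:
  assumes "t \<le> duration n k \<delta>"
  shows "informed n k \<delta> t = (\<lambda>j. reader n \<delta> j k) ` {..<N t}"
    and "card (pending n k \<delta> t) + t = (\<Sum>j<N t. k (reader n \<delta> j k))"
  using assms
proof (induction t)
  case 0
  case 1
  show ?case by (simp add: informed_0 N_0 reader_def lessThan_Suc)
  case 2
  show ?case by (simp add: pending_0 N_0 reader_def lessThan_Suc card_image inj_on_def)
next
  case (Suc t)
  let ?P = "pending n k \<delta> t" and ?I = "informed n k \<delta> t"
  {
    assume "Suc t \<le> duration n k \<delta>"
    then have ne: "?P \<noteq> {}" and le: "t \<le> duration n k \<delta>" using pending_nonempty[of t n k \<delta>] by auto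
    define v where "v = Min ?P"
    have v: "v \<in> ?P" "v \<notin> ?I" using Min_pending[OF ne] informed_pending_disjoint[of n k \<delta> t]
      by (auto simp: v_def)
    have "0 < card ?P" using v finite_pending[of n k \<delta> t] by (auto simp: card_gt_0_iff)
    then have card1: "Suc (card (?P - {v})) = card ?P"
      using v finite_pending[of n k \<delta> t] by simp
    have "informed n k \<delta> (Suc t) = (\<lambda>j. reader n \<delta> j k) ` {..<N (Suc t)} \<and>
      card (pending n k \<delta> (Suc t)) + Suc t = (\<Sum>j<N (Suc t). k (reader n \<delta> j k))"
    proof (cases "N (Suc t) = N t")
      case True
      then have "informed n k \<delta> (Suc t) = ?I" "pending n k \<delta> (Suc t) = ?P - {v}"
        using ne by (simp_all add: informed_Suc pending_Suc v_def)
      then show ?thesis using Suc(1)[OF le] Suc(2)[OF le] True card1 by simp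
    next
      case False
      with N_Suc[of t] have S: "N (Suc t) = Suc (N t)" by simp
      with ne have eqs: "informed n k \<delta> (Suc t) = insert v ?I"
        "pending n k \<delta> (Suc t) = ?P - {v} \<union> (\<lambda>i. v @ [i]) ` {1..k v}"
        by (simp_all add: informed_Suc pending_Suc v_def)
      have r: "reader n \<delta> (N t) k = v" using reader_success[OF S ne] by (simp add: v_def)
      \<comment> \<open>A child of \<open>v\<close> that was already pending would have its parent
        \<open>v\<close> informed, which is excluded.\<close>
      have "(?P - {v}) \<inter> (\<lambda>i. v @ [i]) ` {1..k v} = {}"
        using v pending_parent[of _ n k \<delta> t] by fastforce
      then have "card (pending n k \<delta> (Suc t)) = card (?P - {v}) + k v"
        unfolding eqs using finite_pending[of n k \<delta> t]
        by (subst card_Un_disjoint) (auto simp: card_image inj_on_def)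
      then show ?thesis using Suc(1)[OF le] Suc(2)[OF le] card1 r
        by (simp add: S eqs lessThan_Suc)
    qed
  }
  note * = this
  case 1 from *[OF this] show ?case by (rule conjunct1)
  case 2 from *[OF this] show ?case by (rule conjunct2)
qed

lemma duration_eq_sum:
  "duration n k \<delta> = (\<Sum>j<N (duration n k \<delta>). k (reader n \<delta> j k))"
  using reader_informed(2)[of "duration n k \<delta>" k] by (simp add: pending_duration)

lemma attempt_alive:
  assumes "1 \<le> j" "j < n" "T (Suc j) \<le> duration n k \<delta>"
  shows "reader n \<delta> j k \<in> pending n k \<delta> (T (Suc j) - 1)"
proof -
  have "T (Suc j) - 1 < duration n k \<delta>" using N_before(2)[of j] assms by simp
  from Min_pending[OF pending_nonempty[OF this]] pending_nonempty[OF this] show ?thesis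
    using assms by (simp add: reader_def attempt_def)
qed

lemma pending_late: "duration n k \<delta> \<le> t \<Longrightarrow> pending n k \<delta> t = {}"
  by (induction t rule: dec_induct) (simp_all add: pending_duration pending_Suc)

lemma reader_length:
  assumes "j < n"
  shows "length (reader n \<delta> j k) \<le> Suc (T (Suc j))"
proof (cases "1 \<le> j \<and> T (Suc j) \<le> duration n k \<delta>")
  case True
  then have "reader n \<delta> j k \<in> pending n k \<delta> (T (Suc j) - 1)"
    using attempt_alive assms by blast
  then show ?thesis using explored_length[of "reader n \<delta> j k" n k \<delta> "T (Suc j) - 1"] by simp
next
  case False
  have "j = 0 \<or> 0 < T (Suc j) \<and> pending n k \<delta> (T (Suc j) - 1) = {}"
    using False N_before(2)[of j] assms by (auto intro!: pending_late)
  then show ?thesis by (auto simp: reader_def attempt_def)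
qed

text \<open>If attempt \<open>j\<close> is genuine, the earlier word is informed at that moment
  while word \<open>j\<close> is pending. Otherwise word \<open>j\<close> is padding of length
  exactly \<open>T (Suc j) + 1\<close>, longer than anything read earlier by
  \<open>reader_length\<close>, since the success times increase strictly.\<close>

lemma inj_reader: "inj_on (\<lambda>j. reader n \<delta> j k) {..<n}"
proof -
  have "reader n \<delta> i k \<noteq> reader n \<delta> j k" if ij: "i < j" "j < n" for i j
  proof (cases "T (Suc j) \<le> duration n k \<delta>")
    case True
    have TT: "T (Suc i) < T (Suc j)" using T_strict_mono[of "Suc i" "Suc j"] ij by simp
    have "N (T (Suc j) - 1) = j" using N_before[of j] ij by simp
    then have "reader n \<delta> i k \<in> informed n k \<delta> (T (Suc j) - 1)"
      using reader_informed(1)[of "T (Suc j) - 1" k] True ij by auto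
    moreover have "reader n \<delta> j k \<in> pending n k \<delta> (T (Suc j) - 1)"
      using attempt_alive True ij by simp
    ultimately show ?thesis using informed_pending_disjoint[of n k \<delta> "T (Suc j) - 1"] by auto
  next
    case False
    have "0 < T (Suc j)" using N_before(2)[of j] ij by simp
    moreover have "pending n k \<delta> (T (Suc j) - 1) = {}"
      using False by (intro pending_late) simp
    ultimately have "length (reader n \<delta> j k) = Suc (T (Suc j))"
      using ij by (simp add: reader_def attempt_def)
    moreover have "length (reader n \<delta> i k) \<le> Suc (T (Suc i))"
      using reader_length[of i k] ij by simp
    moreover have "T (Suc i) < T (Suc j)" using T_strict_mono[of "Suc i" "Suc j"] ij by simp
    ultimately show ?thesis by auto
  qed
  then show ?thesis by (intro inj_onI) (metis lessThan_iff linorder_neqE_nat)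
qed

text \<open>Just before time \<open>T (Suc j)\<close> exactly \<open>j\<close> numbers have been
  read and at least one word is pending, so by the balance in \<open>reader_informed\<close> the sum
  exceeds \<open>T (Suc j) - 1\<close>.\<close>

lemma sum_ge_if_continued:
  assumes "1 \<le> j" "j < N (duration n k \<delta>)"
  shows "T (Suc j) \<le> (\<Sum>i<j. k (reader n \<delta> i k))"
proof -
  have jn: "j < n" using assms coupon_count_le[of n \<delta> "duration n k \<delta>"] by simp
  let ?t = "T (Suc j) - 1"
  have "T (Suc j) \<le> duration n k \<delta>"
    using assms jn le_coupon_count_iff[of "Suc j" n \<delta> "duration n k \<delta>"] by simp
  then have t: "?t < duration n k \<delta>" "0 < T (Suc j)" using N_before(2)[of j] assms jn by auto
  then have "0 < card (pending n k \<delta> ?t)"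
    using pending_nonempty finite_pending by (simp add: card_gt_0_iff)
  moreover have "card (pending n k \<delta> ?t) + ?t = (\<Sum>i<j. k (reader n \<delta> i k))"
    using reader_informed(2)[of ?t k] t N_before(1)[of j] assms jn by simp
  ultimately show ?thesis using t by simp
qed

text \<open>The witness is the final count itself: at the end the sum equals the duration, and the
  next success has not occurred yet.\<close>

lemma sum_less_if_stopped:
  assumes "N (duration n k \<delta>) \<le> j" "j < n"
  shows "\<exists>i\<in>{1..j}. (\<Sum>l<i. k (reader n \<delta> l k)) < T (Suc i)"
proof
  show "N (duration n k \<delta>) \<in> {1..j}" using assms N_pos by simp
  show "(\<Sum>l<N (duration n k \<delta>). k (reader n \<delta> l k)) < T (Suc (N (duration n k \<delta>)))"
    using less_T_Suc_N[of "duration n k \<delta>"] assms duration_eq_sum[of k] by simp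
qed

lemma card_informed: "card (informed n k \<delta> (duration n k \<delta>)) = N (duration n k \<delta>)"
proof -
  have "inj_on (\<lambda>j. reader n \<delta> j k) {..<N (duration n k \<delta>)}"
    by (rule inj_on_subset[OF inj_reader]) (use coupon_count_le[of n \<delta>] in auto)
  then show ?thesis by (simp add: reader_informed card_image)
qed

lemma count_le_card_tree:
  assumes "finite (gw_tree k)"
  shows "N (duration n k \<delta>) \<le> card (gw_tree k)"
  unfolding card_informed[symmetric]
  using explored_in_tree assms by (intro card_mono) auto

text \<open>The duration counts the children of informed words. These are distinct vertices of the
  tree and none is the root, whence strictness.\<close>

lemma duration_less_card_tree:
  assumes "finite (gw_tree k)"
  shows "duration n k \<delta> < card (gw_tree k)"
proof -
  let ?I = "informed n k \<delta> (duration n k \<delta>)"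
  have "inj_on (\<lambda>j. reader n \<delta> j k) {..<N (duration n k \<delta>)}"
    by (rule inj_on_subset[OF inj_reader]) (use coupon_count_le[of n \<delta>] in auto)
  then have "duration n k \<delta> = (\<Sum>v\<in>?I. k v)"
    by (subst duration_eq_sum) (simp add: reader_informed sum.reindex)
  also have "\<dots> = card (Sigma ?I (\<lambda>v. {1..k v}))"
    using finite_informed by (simp add: card_SigmaI)
  also have "\<dots> = card ((\<lambda>(v, i). v @ [i]) ` Sigma ?I (\<lambda>v. {1..k v}))"
    by (intro card_image[symmetric]) (auto simp: inj_on_def)
  also have "\<dots> < card (gw_tree k)"
  proof (rule psubset_card_mono[OF assms])
    have "(\<lambda>(v, i). v @ [i]) ` Sigma ?I (\<lambda>v. {1..k v}) \<subseteq> gw_tree k"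
      using explored_in_tree by fastforce
    moreover have "[] \<in> gw_tree k" "[] \<notin> (\<lambda>(v, i). v @ [i]) ` Sigma ?I (\<lambda>v. {1..k v})" by auto
    ultimately show "(\<lambda>(v, i). v @ [i]) ` Sigma ?I (\<lambda>v. {1..k v}) \<subset> gw_tree k" by blast
  qed
  finally show ?thesis .
qed

text \<open>A sum of \<open>j\<close> waiting times, each at least 1, equals \<open>j\<close> only
  if all are 1, and then every unit of time brings a success.\<close>

lemma N_eq_of_no_failure:
  assumes "j < n" "T (Suc j) = j" "t < j"
  shows "N t = Suc t"
proof -
  have T: "T (Suc i) = i" if "i \<le> j" for i
  proof -
    have "i + (j - i) \<le> T (Suc j) \<and> T (Suc i) + (j - i) \<le> T (Suc j)"
      using that
    proof (induction j rule: dec_induct)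
      case base then show ?case using le_T[of i] by simp
    next
      case (step m)
      then show ?case using T_strict_mono[of "Suc m" "Suc (Suc m)"] by arith
    qed
    then show ?thesis using assms le_T[of i] that by simp
  qed
  have "Suc t \<le> N t" using le_coupon_count_iff[of "Suc t" n \<delta> t] T[of t] assms by simp
  moreover have "\<not> Suc (Suc t) \<le> N t"
    using le_coupon_count_iff[of "Suc (Suc t)" n \<delta> t] T[of "Suc t"] assms by simp
  ultimately show ?thesis by simp
qed

text \<open>While no attempt fails, words leave the pending set only by becoming informed, so every
  child of an informed word is informed or still pending. When nothing is pending, the informed set
  contains the root and is closed under children.\<close>

lemma tree_explored:
  assumes "j < n" "T (Suc j) = j" "N (duration n k \<delta>) \<le> j"
  shows "finite (gw_tree k)" "card (gw_tree k) = N (duration n k \<delta>)"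
    "duration n k \<delta> + 1 = N (duration n k \<delta>)"
proof -
  let ?\<tau> = "duration n k \<delta>"
  \<comment> \<open>Success number \<open>j\<close> would happen at time \<open>j\<close> and has
    not happened by the end, so the whole run lies in the stretch without failures.\<close>
  have \<tau>: "?\<tau> < j"
    using le_coupon_count_iff[of "Suc j" n \<delta> ?\<tau>] assms by simp
  have closed: "v @ [i] \<in> informed n k \<delta> t \<union> pending n k \<delta> t"
    if "t \<le> ?\<tau>" "v \<in> informed n k \<delta> t" "1 \<le> i" "i \<le> k v" for v i t
    using that
  proof (induction t)
    case 0
    then show ?case by (simp add: informed_0 pending_0)
  next
    case (Suc t)
    then have ne: "pending n k \<delta> t \<noteq> {}" using pending_nonempty[of t n k \<delta>] by simp
    have "N (Suc t) = Suc (N t)"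
      using Suc.prems(1) \<tau> assms N_eq_of_no_failure[of j t] N_eq_of_no_failure[of j "Suc t"] by simp
    with ne have eqs: "informed n k \<delta> (Suc t) = insert (Min (pending n k \<delta> t)) (informed n k \<delta> t)"
      "pending n k \<delta> (Suc t) = pending n k \<delta> t - {Min (pending n k \<delta> t)} \<union>
        (\<lambda>i. Min (pending n k \<delta> t) @ [i]) ` {1..k (Min (pending n k \<delta> t))}"
      by (simp_all add: informed_Suc pending_Suc)
    show ?case
    proof (cases "v = Min (pending n k \<delta> t)")
      case True
      then show ?thesis using Suc.prems unfolding eqs by auto
    next
      case False
      then have "v \<in> informed n k \<delta> t" using Suc.prems unfolding eqs by auto
      then have "v @ [i] \<in> informed n k \<delta> t \<union> pending n k \<delta> t"
        using Suc.IH Suc.prems by simp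
      then show ?thesis unfolding eqs by auto
    qed
  qed
  have "w \<in> informed n k \<delta> ?\<tau>" if "w \<in> gw_tree k" for w
    using that
  proof (induction w rule: rev_induct)
    case Nil
    show ?case by (rule Nil_informed)
  next
    case (snoc i v)
    then show ?case using closed[of ?\<tau> v i] by (simp add: pending_duration)
  qed
  then have eq: "informed n k \<delta> ?\<tau> = gw_tree k" using explored_in_tree by blast
  show "finite (gw_tree k)" using finite_informed unfolding eq[symmetric] .
  show "card (gw_tree k) = N ?\<tau>" using card_informed[of k] unfolding eq .
  show "?\<tau> + 1 = N ?\<tau>" using N_eq_of_no_failure[OF assms(1,2) \<tau>] by simp
qed

end

section \<open>Generations, survival and total progeny of a fixed tree\<close>

lemma gw_level_Suc:
  "{w\<in>gw_tree k. length w = Suc j} = (\<Union>v\<in>{w\<in>gw_tree k. length w = j}. (\<lambda>i. v @ [i]) ` {1..k v})"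
  by (auto simp: length_Suc_conv_rev)

lemma finite_gw_level: "finite {w\<in>gw_tree k. length w = j}"
proof (induction j)
  case 0
  have "{w\<in>gw_tree k. length w = 0} = {[]}" by auto
  then show ?case by simp
qed (simp add: gw_level_Suc)

lemma gw_survives_iff: "gw_survives k \<longleftrightarrow> (\<forall>j. \<exists>w\<in>gw_tree k. length w = j)"
proof -
  have "1 \<le> gw_gen k j \<longleftrightarrow> (\<exists>w\<in>gw_tree k. length w = j)" for j
    using finite_gw_level[of k j] by (simp add: gw_gen_def Suc_le_eq card_gt_0_iff) blast
  then show ?thesis by (simp add: gw_survives_def)
qed

text \<open>Every generation is finite, and an empty generation makes all later ones empty. In this
  form survival can be refuted by a finished exploration.\<close>

lemma gw_survives_iff_infinite: "gw_survives k \<longleftrightarrow> infinite (gw_tree k)"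
proof
  assume s: "gw_survives k"
  show "infinite (gw_tree k)"
  proof
    assume "finite (gw_tree k)"
    then have "finite (length ` gw_tree k)" by simp
    moreover have "length ` gw_tree k = UNIV" using s unfolding gw_survives_iff by (metis UNIV_eq_I imageI)
    ultimately show False by simp
  qed
next
  assume inf: "infinite (gw_tree k)"
  show "gw_survives k"
  proof (rule ccontr)
    assume "\<not> gw_survives k"
    then obtain j where j: "{w\<in>gw_tree k. length w = j} = {}" unfolding gw_survives_iff by blast
    have "{w\<in>gw_tree k. length w = i} = {}" if "j \<le> i" for i
      using that by (induction i rule: dec_induct) (use j gw_level_Suc[of k] in auto)
    then have "gw_tree k \<subseteq> (\<Union>i<j. {w\<in>gw_tree k. length w = i})"
      by (auto simp: not_less[symmetric])
    with inf finite_gw_level show False using finite_subset by blast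
  qed
qed

lemma gw_total_eq_card: "finite (gw_tree k) \<Longrightarrow> gw_total k = of_nat (card (gw_tree k))"
proof -
  assume fin: "finite (gw_tree k)"
  then have fl: "finite (length ` gw_tree k)" by simp
  have z: "gw_gen k j = 0" if "j \<notin> length ` gw_tree k" for j
    using that by (auto simp: gw_gen_def card_eq_0_iff)
  have "gw_total k = (\<Sum>j\<in>length ` gw_tree k. of_nat (gw_gen k j))"
    unfolding gw_total_def by (rule suminf_finite[OF fl]) (simp add: z)
  also have "\<dots> = of_nat (\<Sum>j\<in>length ` gw_tree k. card {w\<in>gw_tree k. length w = j})"
    by (simp add: gw_gen_def)
  also have "(\<Sum>j\<in>length ` gw_tree k. card {w\<in>gw_tree k. length w = j}) = card (gw_tree k)"
    using sum.group[OF fin fl subset_refl, of "\<lambda>_. 1::nat"] by simp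
  finally show ?thesis .
qed

section \<open>Independence along an adaptive path\<close>

lemma ball_Plus: "(\<forall>z\<in>A <+> B. P z) \<longleftrightarrow> (\<forall>a\<in>A. P (Inl a)) \<and> (\<forall>b\<in>B. P (Inr b))"
  by auto

context prob_space
begin

text \<open>The joint vector lives in a countable space, so its law is determined by the masses of
  points. Measurability of the single variables is derived from that of the point events, which
  suits variables read at random places.\<close>

lemma indep_vars_of_point_law:
  fixes X :: "'i \<Rightarrow> 'a \<Rightarrow> nat" and p :: "'i \<Rightarrow> nat pmf"
  assumes I: "finite I" "I \<noteq> {}"
    and point: "\<And>f. {\<omega>\<in>space M. \<forall>i\<in>I. X i \<omega> = f i} \<in> events"
      "\<And>f. prob {\<omega>\<in>space M. \<forall>i\<in>I. X i \<omega> = f i} = (\<Prod>i\<in>I. pmf (p i) (f i))"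
  shows "indep_vars (\<lambda>_. count_space UNIV) X I"
    and "i \<in> I \<Longrightarrow> distr M (count_space UNIV) (X i) = measure_pmf (p i)"
proof -
  let ?F = "\<lambda>\<omega>. \<lambda>i\<in>I. X i \<omega>" and ?C = "PiE I (\<lambda>_. UNIV :: nat set)"
  let ?P = "PiM I (\<lambda>_. count_space (UNIV :: nat set))" and ?Q = "PiM I (\<lambda>i. measure_pmf (p i))"
  have cs: "?P = count_space ?C" using count_space_PiM_finite[OF I(1), of "\<lambda>_. UNIV :: nat set"] by simp
  have countable: "countable ?C" using I(1) by (intro countable_PiE) auto
  have vim: "?F -` {f} \<inter> space M = {\<omega>\<in>space M. \<forall>i\<in>I. X i \<omega> = f i}" if "f \<in> ?C" for f
    using that by (auto simp: fun_eq_iff PiE_def extensional_def)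
  have F: "?F \<in> measurable M ?P"
    unfolding cs measurable_count_space_eq_countable[OF countable] using point(1) vim by auto
  interpret Q: product_prob_space "\<lambda>i. measure_pmf (p i)" I by unfold_locales
  have setsQ: "sets ?Q = sets ?P" by (intro sets_PiM_cong) auto
  have Q_eq: "distr M ?P ?F = ?Q"
  proof (rule measure_eqI_countable[OF _ _ countable])
    show "sets (distr M ?P ?F) = Pow ?C" "sets ?Q = Pow ?C" using setsQ by (simp_all add: cs)
    fix f assume f: "f \<in> ?C"
    then have "emeasure (distr M ?P ?F) {f} = ennreal (\<Prod>i\<in>I. pmf (p i) (f i))"
      by (subst emeasure_distr[OF F])
        (auto simp: cs vim point(2) emeasure_eq_measure)
    also have "\<dots> = (\<Prod>i\<in>I. emeasure (measure_pmf (p i)) {f i})"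
      by (subst prod_ennreal[symmetric]) (auto simp: emeasure_pmf_single)
    also have "\<dots> = emeasure ?Q (PiE I (\<lambda>i. {f i}))"
      using I by (intro Q.emeasure_PiM[symmetric]) auto
    also have "PiE I (\<lambda>i. {f i}) = {f}" using f by (intro PiE_singleton) (simp add: PiE_def)
    finally show "emeasure (distr M ?P ?F) {f} = emeasure ?Q {f}" .
  qed
  have law: "random_variable (count_space UNIV) (X i) \<and>
    distr M (count_space UNIV) (X i) = measure_pmf (p i)" if i: "i \<in> I" for i
  proof
    have comp: "(\<lambda>g. g i) \<in> measurable ?P (count_space UNIV)"
      using measurable_component_singleton[OF i] .
    have eq: "(\<lambda>\<omega>. (?F \<omega>) i) = X i" using i by auto
    show "random_variable (count_space UNIV) (X i)"
      using measurable_compose[OF F comp] unfolding eq .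
    have "measure_pmf (p i) = distr ?Q (measure_pmf (p i)) (\<lambda>g. g i)"
      by (rule Q.PiM_component[symmetric, OF i])
    also have "\<dots> = distr (distr M ?P ?F) (count_space UNIV) (\<lambda>g. g i)"
      unfolding Q_eq by (intro distr_cong) auto
    also have "\<dots> = distr M (count_space UNIV) (X i)"
      unfolding distr_distr[OF comp F] using i by (intro distr_cong) auto
    finally show "distr M (count_space UNIV) (X i) = measure_pmf (p i)" ..
  qed
  then show "i \<in> I \<Longrightarrow> distr M (count_space UNIV) (X i) = measure_pmf (p i)" by blast
  show "indep_vars (\<lambda>_. count_space UNIV) X I"
  proof (subst indep_vars_iff_distr_eq_PiM'[OF I(2)])
    show "distr M ?P ?F = PiM I (\<lambda>i. distr M (count_space UNIV) (X i))"
      unfolding Q_eq using law by (intro PiM_cong) auto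
  qed (use law in auto)
qed

text \<open>For prescribed values of all readings and of \<open>D\<close>, the strategy can be run
  in advance on these values and then visits certain fixed words. By adaptedness the readings take
  the prescribed values exactly when the field takes them at these words. The event thus concerns
  fixed distinct coordinates, and its probability is a product of point masses.\<close>

lemma indep_adaptive_reading:
  fixes K :: "'a \<Rightarrow> 'w \<Rightarrow> nat" and D :: "'a \<Rightarrow> 'b \<Rightarrow> nat"
    and U :: "('b \<Rightarrow> nat) \<Rightarrow> nat \<Rightarrow> ('w \<Rightarrow> nat) \<Rightarrow> 'w"
  assumes indep: "indep_vars (\<lambda>_. count_space UNIV)
      (\<lambda>z \<omega>. case z of Inl w \<Rightarrow> K \<omega> w | Inr b \<Rightarrow> D \<omega> b) (W <+> B)"
    and K_law: "\<And>w. w \<in> W \<Longrightarrow> distr M (count_space UNIV) (\<lambda>\<omega>. K \<omega> w) = measure_pmf \<mu>"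
    and D_law: "\<And>b. b \<in> B \<Longrightarrow> distr M (count_space UNIV) (\<lambda>\<omega>. D \<omega> b) = measure_pmf (\<nu> b)"
    and "finite B" "0 < n"
    and U_in: "\<And>d j k. U d j k \<in> W"
    and U_inj: "\<And>d k. inj_on (\<lambda>j. U d j k) {..<n}"
    and U_adapted: "\<And>d j k k'. j < n \<Longrightarrow> (\<And>i. i < j \<Longrightarrow> k (U d i k) = k' (U d i k)) \<Longrightarrow> U d j k = U d j k'"
    and U_cong: "\<And>d d' j. (\<And>b. b \<in> B \<Longrightarrow> d b = d' b) \<Longrightarrow> j < n \<Longrightarrow> U d j = U d' j"
  shows "indep_vars (\<lambda>_. count_space UNIV)
      (\<lambda>z \<omega>. case z of Inl j \<Rightarrow> K \<omega> (U (D \<omega>) j (K \<omega>)) | Inr b \<Rightarrow> D \<omega> b) ({..<n} <+> B)"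
    and "j < n \<Longrightarrow> distr M (count_space UNIV) (\<lambda>\<omega>. K \<omega> (U (D \<omega>) j (K \<omega>))) = measure_pmf \<mu>"
proof -
  let ?X = "\<lambda>z \<omega>. case z of Inl w \<Rightarrow> K \<omega> w | Inr b \<Rightarrow> D \<omega> b"
  let ?Z = "\<lambda>z \<omega>. case z of Inl j \<Rightarrow> K \<omega> (U (D \<omega>) j (K \<omega>)) | Inr b \<Rightarrow> D \<omega> b"
  let ?p = "\<lambda>z. case z of Inl _ \<Rightarrow> \<mu> | Inr b \<Rightarrow> \<nu> b"
  let ?I = "{..<n} <+> B"
  have rv: "random_variable (count_space UNIV) (?X z)" if "z \<in> W <+> B" for z
    using indep that unfolding indep_vars_def2 by blast
  define q where "q z = (case z of Inl _ \<Rightarrow> \<mu> | Inr b \<Rightarrow> \<nu> b)" for z :: "'w + 'b"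
  have prob_X: "prob (?X z -` {a} \<inter> space M) = pmf (q z) a" if "z \<in> W <+> B" for z a
  proof -
    have "prob (?X z -` {a} \<inter> space M) = measure (distr M (count_space UNIV) (?X z)) {a}"
      using rv[OF that] by (simp add: measure_distr)
    also have "distr M (count_space UNIV) (?X z) = measure_pmf (q z)"
      using that K_law D_law by (auto simp: q_def)
    finally show ?thesis by (simp add: measure_pmf_single)
  qed
  \<comment> \<open>The value at the next word is overwritten; by injectivity this touches no word
    read before, and by adaptedness it leaves the reading order up to there unchanged.\<close>
  have path: "\<exists>k. \<forall>j<m. k (U d j k) = a j" if "m \<le> n" for d a m
    using that
  proof (induction m)
    case (Suc m)
    then obtain k where k: "\<forall>j<m. k (U d j k) = a j" by auto
    let ?k = "k(U d m k := a m)"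
    have ne: "U d j k \<noteq> U d m k" if "j < m" for j
      using inj_onD[OF U_inj[of d k], of j m] that Suc.prems by auto
    have "U d j k = U d j ?k" if "j \<le> m" for j
      using that Suc.prems ne by (intro U_adapted) auto
    then have "?k (U d j ?k) = a j" if "j < Suc m" for j
      using that k ne by (metis fun_upd_apply less_Suc_eq less_Suc_eq_le)
    then show ?case by blast
  qed simp
  have point: "{\<omega>\<in>space M. \<forall>z\<in>?I. ?Z z \<omega> = f z} \<in> events \<and>
    prob {\<omega>\<in>space M. \<forall>z\<in>?I. ?Z z \<omega> = f z} = (\<Prod>z\<in>?I. pmf (?p z) (f z))" for f
  proof -
    define d where "d b = f (Inr b)" for b
    obtain k where k: "\<forall>j<n. k (U d j k) = f (Inl j)"
      using path[of n d "\<lambda>j. f (Inl j)"] by blast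
    define v where "v j = U d j k" for j
    have inj: "inj_on v {..<n}" using U_inj[of d k] by (simp add: v_def inj_on_def)
    define J where "J = v ` {..<n} <+> B"
    define g where "g z = (case z of Inl w \<Rightarrow> k w | Inr b \<Rightarrow> d b)" for z
    have J: "J \<subseteq> W <+> B" "finite J" "J \<noteq> {}"
      using U_in \<open>finite B\<close> \<open>0 < n\<close> by (auto simp: J_def v_def)
    \<comment> \<open>In both directions adaptedness shows that reading from
      \<open>K \<omega>\<close> visits the same words as reading from \<open>k\<close>. If
      \<open>D \<omega>\<close> differs from \<open>d\<close> somewhere on \<open>B\<close>, both
      sides are false.\<close>
    have iff: "(\<forall>z\<in>?I. ?Z z \<omega> = f z) \<longleftrightarrow> (\<forall>z\<in>J. ?X z \<omega> = g z)" for \<omega>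
    proof (cases "\<forall>b\<in>B. D \<omega> b = d b")
      case True
      then have U: "U (D \<omega>) j = U d j" if "j < n" for j using that by (intro U_cong) auto
      have "(\<forall>j<n. K \<omega> (U d j (K \<omega>)) = f (Inl j)) \<longleftrightarrow> (\<forall>j<n. K \<omega> (v j) = k (v j))"
      proof
        assume *: "\<forall>j<n. K \<omega> (U d j (K \<omega>)) = f (Inl j)"
        have "U d j (K \<omega>) = v j" if "j < n" for j
          using that
        proof (induction j rule: less_induct)
          case (less j)
          have "K \<omega> (U d i (K \<omega>)) = k (U d i (K \<omega>))" if "i < j" for i
          proof -
            have "i < n" "U d i (K \<omega>) = U d i k" using less that by (auto simp: v_def)
            then show ?thesis using * k by metis
          qed
          then show ?case unfolding v_def using less.prems by (intro U_adapted) auto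
        qed
        then show "\<forall>j<n. K \<omega> (v j) = k (v j)" using * k by (auto simp: v_def)
      next
        assume *: "\<forall>j<n. K \<omega> (v j) = k (v j)"
        have "v j = U d j (K \<omega>)" if "j < n" for j
          unfolding v_def using that * by (intro U_adapted) (auto simp: v_def)
        then show "\<forall>j<n. K \<omega> (U d j (K \<omega>)) = f (Inl j)" using * k by (auto simp: v_def)
      qed
      with True U show ?thesis by (simp add: J_def g_def ball_Plus d_def) (simp add: Ball_def)
    next
      case False
      then show ?thesis by (auto simp: J_def g_def ball_Plus d_def)
    qed
    have ev: "{\<omega>\<in>space M. \<forall>z\<in>?I. ?Z z \<omega> = f z} = (\<Inter>z\<in>J. ?X z -` {g z} \<inter> space M)"
      unfolding iff using J(3) by auto
    have "?X z -` {g z} \<inter> space M \<in> events" if "z \<in> J" for z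
      using rv[of z] J that by (intro measurable_sets[of _ M "count_space UNIV"]) auto
    then have "{\<omega>\<in>space M. \<forall>z\<in>?I. ?Z z \<omega> = f z} \<in> events"
      unfolding ev using J by (intro sets.finite_INT) auto
    moreover have "prob (\<Inter>z\<in>J. ?X z -` {g z} \<inter> space M) = (\<Prod>z\<in>J. prob (?X z -` {g z} \<inter> space M))"
      by (rule indep_varsD[OF indep J(3,2,1)]) auto
    moreover have "\<dots> = (\<Prod>z\<in>J. pmf (q z) (g z))"
      using J prob_X by (intro prod.cong) auto
    moreover have "\<dots> = (\<Prod>j<n. pmf \<mu> (k (v j))) * (\<Prod>b\<in>B. pmf (\<nu> b) (d b))"
      using \<open>finite B\<close> inj by (simp add: J_def prod.Plus prod.reindex q_def g_def)
    moreover have "\<dots> = (\<Prod>z\<in>?I. pmf (?p z) (f z))"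
      using \<open>finite B\<close> k by (simp add: prod.Plus d_def v_def)
    ultimately show ?thesis unfolding ev by simp
  qed
  have fin: "finite ?I" "?I \<noteq> {}" using \<open>finite B\<close> \<open>0 < n\<close> by auto
  from indep_vars_of_point_law(1)[OF fin, of ?Z ?p] point
  show "indep_vars (\<lambda>_. count_space UNIV) ?Z ?I" by blast
  show "distr M (count_space UNIV) (\<lambda>\<omega>. K \<omega> (U (D \<omega>) j (K \<omega>))) = measure_pmf \<mu>" if "j < n"
  proof -
    have "Inl j \<in> ?I" using that by auto
    with indep_vars_of_point_law(2)[OF fin, of ?Z ?p "Inl j"] point show ?thesis by simp
  qed
qed

end

section \<open>Measurability\<close>

lemma take_in_words: "w \<in> words \<Longrightarrow> take i w \<in> words"
  by (auto simp: words_def dest: in_set_takeD)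

lemma measurable_coupon_count:
  assumes "\<And>i. 1 \<le> i \<Longrightarrow> i < n \<Longrightarrow> (\<lambda>\<omega>. d \<omega> i) \<in> measurable M (count_space UNIV)"
  shows "(\<lambda>\<omega>. coupon_count n (d \<omega>) t) \<in> measurable M (count_space UNIV)"
proof -
  have "(\<lambda>\<omega>. coupon_time (d \<omega>) i) \<in> measurable M (count_space UNIV)" if "i \<in> {1..n}" for i
    unfolding coupon_time_def using that assms by (intro measurable_sum_nat) auto
  then show ?thesis
    unfolding coupon_count_def by (intro measurable_sum_nat measurable_If) (auto intro!: measurable_compose[where g = "\<lambda>m. m \<le> t"])
qed

text \<open>The offspring number of a random word is a composition. It is handled by letting the
  state range over the countable set of pairs of finite sets of words, so that the next state can be
  treated for each fixed present one. Subsets of \<open>words\<close> are taken because the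
  offspring numbers are known to be measurable there.\<close>

lemma measurable_transmission:
  assumes K: "\<And>w. w \<in> words \<Longrightarrow> (\<lambda>\<omega>. k \<omega> w) \<in> measurable M (count_space UNIV)"
    and d: "\<And>i. 1 \<le> i \<Longrightarrow> i < n \<Longrightarrow> (\<lambda>\<omega>. d \<omega> i) \<in> measurable M (count_space UNIV)"
  defines "F \<equiv> {A. finite A \<and> A \<subseteq> words}"
  shows "(\<lambda>\<omega>. (informed n (k \<omega>) (d \<omega>) t, pending n (k \<omega>) (d \<omega>) t)) \<in> measurable M (count_space (F \<times> F))"
proof (induction t)
  case 0
  have "(\<lambda>m. ({[]}, (\<lambda>i. [i]) ` {1..m})) \<in> measurable (count_space UNIV) (count_space (F \<times> F))"
    by (auto simp: F_def words_def)
  from measurable_compose[OF K[of "[]"] this] show ?case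
    by (simp add: informed_0 pending_0 words_def)
next
  case (Suc t)
  define S where "S c \<omega> = (if snd c = {} then c
    else if coupon_count n (d \<omega>) (t + 1) = coupon_count n (d \<omega>) t + 1
    then (insert (Min (snd c)) (fst c),
          snd c - {Min (snd c)} \<union> (\<lambda>i. Min (snd c) @ [i]) ` {1..k \<omega> (Min (snd c))})
    else (fst c, snd c - {Min (snd c)}))" for c :: "nat list set \<times> nat list set" and \<omega>
  have "countable F"
    using countable_Collect_finite by (rule countable_subset[rotated]) (auto simp: F_def)
  then have "countable (F \<times> F)" by auto
  moreover have "S c \<in> measurable M (count_space (F \<times> F))" if c: "c \<in> F \<times> F" for c
  proof (cases "snd c = {}")
    case True
    then show ?thesis using c by (simp add: S_def[abs_def])
  next
    case False
    let ?v = "Min (snd c)"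
    have v: "?v \<in> words" using c False Min_in[of "snd c"] by (fastforce simp: F_def)
    have pred: "Measurable.pred M (\<lambda>\<omega>. coupon_count n (d \<omega>) (t + 1) = coupon_count n (d \<omega>) t + 1)"
    proof -
      have [measurable]: "(\<lambda>\<omega>. coupon_count n (d \<omega>) t) \<in> measurable M (count_space UNIV)" for t
        by (rule measurable_coupon_count) (rule d)
      show ?thesis
        by (rule measurable_compose_countable[where g = "\<lambda>\<omega>. coupon_count n (d \<omega>) t" and
              f = "\<lambda>i \<omega>. coupon_count n (d \<omega>) (t + 1) = i + 1"]) measurable
    qed
    have "(\<lambda>m. (insert ?v (fst c), snd c - {?v} \<union> (\<lambda>i. ?v @ [i]) ` {1..m}))
        \<in> measurable (count_space UNIV) (count_space (F \<times> F))"
      using c v by (auto simp: F_def words_def)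
    from measurable_compose[OF K[OF v] this]
    have "(\<lambda>\<omega>. (insert ?v (fst c), snd c - {?v} \<union> (\<lambda>i. ?v @ [i]) ` {1..k \<omega> ?v}))
        \<in> measurable M (count_space (F \<times> F))" .
    moreover have "(\<lambda>\<omega>. (fst c, snd c - {?v})) \<in> measurable M (count_space (F \<times> F))"
      using c by (intro measurable_const) (auto simp: F_def)
    ultimately show ?thesis
      unfolding S_def[abs_def] using False pred by (simp only: if_False) (rule measurable_If; simp)
  qed
  ultimately have "(\<lambda>\<omega>. S (informed n (k \<omega>) (d \<omega>) t, pending n (k \<omega>) (d \<omega>) t) \<omega>)
      \<in> measurable M (count_space (F \<times> F))"
    using Suc by (intro measurable_compose_countable'[where I = "F \<times> F" and f = S and
        g = "\<lambda>\<omega>. (informed n (k \<omega>) (d \<omega>) t, pending n (k \<omega>) (d \<omega>) t)"]) auto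
  then show ?case
    by (rule measurable_cong[THEN iffD1, rotated]) (simp add: S_def informed_Suc pending_Suc)
qed

lemma measurable_duration:
  assumes "\<And>w. w \<in> words \<Longrightarrow> (\<lambda>\<omega>. k \<omega> w) \<in> measurable M (count_space UNIV)"
    and "\<And>i. 1 \<le> i \<Longrightarrow> i < n \<Longrightarrow> (\<lambda>\<omega>. d \<omega> i) \<in> measurable M (count_space UNIV)"
  shows "(\<lambda>\<omega>. duration n (k \<omega>) (d \<omega>)) \<in> measurable M (count_space UNIV)"
proof -
  have "Measurable.pred M (\<lambda>\<omega>. pending n (k \<omega>) (d \<omega>) t = {})" for t
    using measurable_compose[OF measurable_transmission[of k M n d t, OF assms],
      of "\<lambda>c. snd c = {}" "count_space UNIV"] by simp
  then show ?thesis unfolding duration_def by (rule measurable_Least)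
qed

lemma measurable_coupon_count_duration:
  assumes "\<And>w. w \<in> words \<Longrightarrow> (\<lambda>\<omega>. k \<omega> w) \<in> measurable M (count_space UNIV)"
    and "\<And>i. 1 \<le> i \<Longrightarrow> i < n \<Longrightarrow> (\<lambda>\<omega>. d \<omega> i) \<in> measurable M (count_space UNIV)"
  shows "(\<lambda>\<omega>. coupon_count n (d \<omega>) (duration n (k \<omega>) (d \<omega>))) \<in> measurable M (count_space UNIV)"
  by (rule measurable_compose_countable) (use assms in \<open>auto intro!: measurable_coupon_count measurable_duration\<close>)

text \<open>A generation is a variable with countably many values, and each of its point events is a
  countable combination of membership events.\<close>

lemma measurable_gw_level:
  assumes [measurable]: "\<And>w. w \<in> words \<Longrightarrow> (\<lambda>\<omega>. k \<omega> w) \<in> measurable M (count_space UNIV)"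
  shows "(\<lambda>\<omega>. {w\<in>gw_tree (k \<omega>). length w = j}) \<in> measurable M (count_space {A. finite A})"
proof -
  have tree: "Measurable.pred M (\<lambda>\<omega>. w \<in> gw_tree (k \<omega>))" for w
  proof (cases "w \<in> words")
    case True
    then have "Measurable.pred M (\<lambda>\<omega>. w ! i \<le> k \<omega> (take i w))" for i
      using take_in_words by measurable
    with True show ?thesis by (simp add: gw_tree_def)
  qed (simp add: gw_tree_def)
  have "{\<omega>\<in>space M. {w\<in>gw_tree (k \<omega>). length w = j} = A} \<in> sets M" for A
  proof -
    have "Measurable.pred M (\<lambda>\<omega>. \<forall>w. (w \<in> gw_tree (k \<omega>) \<and> length w = j) = (w \<in> A))"
      using tree by measurable
    also have "(\<lambda>\<omega>. \<forall>w. (w \<in> gw_tree (k \<omega>) \<and> length w = j) = (w \<in> A)) =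
        (\<lambda>\<omega>. {w\<in>gw_tree (k \<omega>). length w = j} = A)"
      by (auto simp: set_eq_iff)
    finally show ?thesis by (simp add: pred_def)
  qed
  moreover have "(\<lambda>\<omega>. {w\<in>gw_tree (k \<omega>). length w = j}) -` {A} \<inter> space M =
      {\<omega>\<in>space M. {w\<in>gw_tree (k \<omega>). length w = j} = A}" for A
    by auto
  ultimately show ?thesis
    by (subst measurable_count_space_eq_countable[OF countable_Collect_finite])
      (auto simp: finite_gw_level)
qed

lemma measurable_gw_gen:
  assumes "\<And>w. w \<in> words \<Longrightarrow> (\<lambda>\<omega>. k \<omega> w) \<in> measurable M (count_space UNIV)"
  shows "(\<lambda>\<omega>. gw_gen (k \<omega>) j) \<in> measurable M (count_space UNIV)"
  unfolding gw_gen_def by (rule measurable_compose[OF measurable_gw_level[OF assms]]) simp_all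

lemma pred_gw_survives:
  assumes "\<And>w. w \<in> words \<Longrightarrow> (\<lambda>\<omega>. k \<omega> w) \<in> measurable M (count_space UNIV)"
  shows "Measurable.pred M (\<lambda>\<omega>. gw_survives (k \<omega>))"
  unfolding gw_survives_def using measurable_gw_gen[of k M, OF assms] by measurable

lemma measurable_gw_total:
  assumes "\<And>w. w \<in> words \<Longrightarrow> (\<lambda>\<omega>. k \<omega> w) \<in> measurable M (count_space UNIV)"
  shows "(\<lambda>\<omega>. gw_total (k \<omega>)) \<in> borel_measurable M"
  unfolding gw_total_def using measurable_gw_gen[of k M, OF assms] by measurable

section \<open>The random model\<close>

text \<open>Independence is assumed for each \<open>n\<close> separately, between the whole
  offspring field and the waiting times for that \<open>n\<close>. This suffices since convergence
  in probability involves one \<open>n\<close> at a time and the limit variables depend on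
  \<open>K\<close> alone.\<close>

locale gw_coupon = prob_space +
  fixes \<mu> :: "nat pmf" and K :: "'a \<Rightarrow> nat list \<Rightarrow> nat" and \<Delta> :: "nat \<Rightarrow> 'a \<Rightarrow> nat \<Rightarrow> nat"
  assumes K_law: "\<And>w. w \<in> words \<Longrightarrow> distr M (count_space UNIV) (\<lambda>\<omega>. K \<omega> w) = measure_pmf \<mu>"
    and \<Delta>_law: "\<And>n i. 1 \<le> i \<Longrightarrow> i \<le> n - 1 \<Longrightarrow> distr M (count_space UNIV) (\<lambda>\<omega>. \<Delta> n \<omega> i) =
      measure_pmf (map_pmf Suc (geometric_pmf (1 - real i / real n)))"
    and indep: "\<And>n. 1 \<le> n \<Longrightarrow> indep_vars (\<lambda>_. count_space UNIV)
      (\<lambda>j \<omega>. case j of Inl w \<Rightarrow> K \<omega> w | Inr i \<Rightarrow> \<Delta> n \<omega> i) (words <+> {1..n - 1})"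
begin

lemma measurable_K: "w \<in> words \<Longrightarrow> (\<lambda>\<omega>. K \<omega> w) \<in> measurable M (count_space UNIV)"
  using indep[of 1] unfolding indep_vars_def2 by (auto simp: ball_Plus)

lemma measurable_\<Delta>:
  "1 \<le> i \<Longrightarrow> i < n \<Longrightarrow> (\<lambda>\<omega>. \<Delta> n \<omega> i) \<in> measurable M (count_space UNIV)"
  using indep[of n] unfolding indep_vars_def2 by (auto simp: ball_Plus)

text \<open>The waiting times are positive only almost surely; \<open>D\<close> is a version that is positive everywhere.\<close>

definition "D n \<omega> i = max 1 (\<Delta> n \<omega> i)"
definition "\<tau> n \<omega> = duration n (K \<omega>) (D n \<omega>)"
definition "X n \<omega> = coupon_count n (D n \<omega>) (\<tau> n \<omega>)"
definition "\<xi> n j \<omega> = K \<omega> (reader n (D n \<omega>) j (K \<omega>))"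
definition "S n j \<omega> = (\<Sum>i<j. \<xi> n i \<omega>)"
definition "T n j \<omega> = (\<Sum>i\<in>{1..j}. D n \<omega> i)"

lemma measurable_D: "1 \<le> i \<Longrightarrow> i < n \<Longrightarrow> (\<lambda>\<omega>. D n \<omega> i) \<in> measurable M (count_space UNIV)"
  unfolding D_def by (rule measurable_compose[OF measurable_\<Delta>]) simp_all

lemma AE_D_eq: "AE \<omega> in M. \<forall>i. 1 \<le> i \<longrightarrow> i < n \<longrightarrow> D n \<omega> i = \<Delta> n \<omega> i"
proof -
  have "AE \<omega> in M. D n \<omega> i = \<Delta> n \<omega> i" if i: "1 \<le> i" "i < n" for i
  proof -
    have "AE m in distr M (count_space UNIV) (\<lambda>\<omega>. \<Delta> n \<omega> i). 1 \<le> m"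
      using i by (subst \<Delta>_law) (auto simp: AE_measure_pmf_iff)
    then have "AE \<omega> in M. 1 \<le> \<Delta> n \<omega> i"
      using i by (subst (asm) AE_distr_iff[OF measurable_\<Delta>]) auto
    then show ?thesis by eventually_elim (simp add: D_def)
  qed
  then show ?thesis by (simp add: AE_all_countable)
qed

lemma coupon_collection_D: "1 \<le> n \<Longrightarrow> coupon_collection n (D n \<omega>)"
  by (simp add: coupon_collection_def D_def)

lemma T_eq_coupon_time: "T n j \<omega> = coupon_time (D n \<omega>) (Suc j)"
  by (simp add: T_def coupon_time_def atLeastLessThanSuc_atLeastAtMost)

lemma reading:
  assumes "1 \<le> n"
  shows indep_\<xi>_\<Delta>: "indep_vars (\<lambda>_. count_space UNIV)
      (\<lambda>z \<omega>. case z of Inl j \<Rightarrow> \<xi> n j \<omega> | Inr i \<Rightarrow> \<Delta> n \<omega> i) ({..<n} <+> {1..n - 1})"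
    and \<xi>_law: "j < n \<Longrightarrow> distr M (count_space UNIV) (\<xi> n j) = measure_pmf \<mu>"
proof -
  \<comment> \<open>Taking the maximum inside the strategy makes injectivity and adaptedness hold
    for every argument \<open>d\<close>, while the independence hypothesis stays one about
    \<Delta>.\<close>
  define U where "U d j k = reader n (\<lambda>i. max 1 (d i)) j k" for d j k
  have cc: "coupon_collection n (\<lambda>i. max 1 (d i))" for d :: "nat \<Rightarrow> nat"
    using assms by (simp add: coupon_collection_def)
  have \<xi>: "\<xi> n j \<omega> = K \<omega> (U (\<Delta> n \<omega>) j (K \<omega>))" for j \<omega>
    by (simp add: \<xi>_def U_def D_def[abs_def])
  have \<xi>': "\<xi> n j = (\<lambda>\<omega>. K \<omega> (U (\<Delta> n \<omega>) j (K \<omega>)))" for j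
    by (simp add: \<xi> fun_eq_iff)
  have inj: "inj_on (\<lambda>j. U d j k) {..<n}" for d k
    unfolding U_def by (rule coupon_collection.inj_reader[OF cc])
  have adapted: "U d j k = U d j k'"
    if "j < n" "\<And>i. i < j \<Longrightarrow> k (U d i k) = k' (U d i k)" for d j k k'
    unfolding U_def using that
    by (intro coupon_collection.reader_adapted[OF cc[of d] that(1)]) (simp add: U_def)
  have cong: "U d j = U d' j" if "\<And>b. b \<in> {1..n - 1} \<Longrightarrow> d b = d' b" "j < n" for d d' j
    unfolding U_def using that by (intro ext reader_cong[THEN fun_cong]) auto
  have words: "U d j k \<in> words" for d j k by (simp add: U_def reader_in_words)
  have laws: "distr M (count_space UNIV) (\<lambda>\<omega>. \<Delta> n \<omega> i) =
      measure_pmf (map_pmf Suc (geometric_pmf (1 - real i / real n)))" if "i \<in> {1..n - 1}" for i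
    using that by (intro \<Delta>_law) auto
  have "finite {1..n - 1}" "0 < n" using assms by auto
  note reading = indep_adaptive_reading[OF indep[OF assms] K_law laws this words inj adapted cong]
  show "indep_vars (\<lambda>_. count_space UNIV)
      (\<lambda>z \<omega>. case z of Inl j \<Rightarrow> \<xi> n j \<omega> | Inr i \<Rightarrow> \<Delta> n \<omega> i) ({..<n} <+> {1..n - 1})"
    unfolding \<xi> by (rule reading(1))
  show "distr M (count_space UNIV) (\<xi> n j) = measure_pmf \<mu>" if "j < n"
    unfolding \<xi>' using that by (rule reading(2)[rotated -1])
qed

lemma measurable_\<xi>: "j < n \<Longrightarrow> \<xi> n j \<in> measurable M (count_space UNIV)"
  using indep_\<xi>_\<Delta>[of n] unfolding indep_vars_def2 by (auto simp: ball_Plus)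

lemma measurable_S: "j \<le> n \<Longrightarrow> S n j \<in> measurable M (count_space UNIV)"
  unfolding S_def[abs_def] by (intro measurable_sum_nat measurable_\<xi>) auto

lemma measurable_T: "j < n \<Longrightarrow> T n j \<in> measurable M (count_space UNIV)"
  unfolding T_def[abs_def] by (intro measurable_sum_nat measurable_D) auto

lemma T_le_S_if_continued:
  assumes "1 \<le> j" "j < X n \<omega>"
  shows "T n j \<omega> \<le> S n j \<omega>"
proof -
  have "1 \<le> n" using assms coupon_count_le[of n "D n \<omega>" "\<tau> n \<omega>"] unfolding X_def by linarith
  then interpret cc: coupon_collection n "D n \<omega>" by (rule coupon_collection_D)
  show ?thesis
    using cc.sum_ge_if_continued[of j "K \<omega>"] assms
    by (simp add: T_eq_coupon_time S_def \<xi>_def X_def \<tau>_def)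
qed

lemma S_less_T_if_stopped:
  assumes "X n \<omega> \<le> j" "j < n"
  shows "\<exists>i\<in>{1..j}. S n i \<omega> < T n i \<omega>"
proof -
  interpret cc: coupon_collection n "D n \<omega>" using assms by (intro coupon_collection_D) simp
  show ?thesis
    using cc.sum_less_if_stopped[of "K \<omega>" j] assms
    by (simp add: T_eq_coupon_time S_def \<xi>_def X_def \<tau>_def)
qed

lemma \<tau>_eq_S:
  assumes "1 \<le> n"
  shows "\<tau> n \<omega> = S n (X n \<omega>) \<omega>"
proof -
  interpret cc: coupon_collection n "D n \<omega>" using assms by (rule coupon_collection_D)
  show ?thesis
    unfolding S_def \<xi>_def X_def \<tau>_def by (rule cc.duration_eq_sum)
qed

lemma T_le_\<tau>: "j < X n \<omega> \<Longrightarrow> T n j \<omega> \<le> \<tau> n \<omega>"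
  unfolding T_eq_coupon_time X_def
  using le_coupon_count_iff[of "Suc j" n "D n \<omega>" "\<tau> n \<omega>"] coupon_count_le[of n "D n \<omega>" "\<tau> n \<omega>"]
  by simp

lemma tree_bounds:
  assumes "1 \<le> n" "finite (gw_tree (K \<omega>))"
  shows "X n \<omega> \<le> card (gw_tree (K \<omega>))" "\<tau> n \<omega> < card (gw_tree (K \<omega>))"
  using coupon_collection.count_le_card_tree coupon_collection.duration_less_card_tree
    coupon_collection_D assms unfolding X_def \<tau>_def by blast+

lemma tree_explored:
  assumes "T n j \<omega> = j" "X n \<omega> \<le> j" "j < n"
  shows "finite (gw_tree (K \<omega>))" "X n \<omega> = card (gw_tree (K \<omega>))" "\<tau> n \<omega> + 1 = X n \<omega>"
proof -
  interpret cc: coupon_collection n "D n \<omega>" using assms by (intro coupon_collection_D) simp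
  show "finite (gw_tree (K \<omega>))" "X n \<omega> = card (gw_tree (K \<omega>))" "\<tau> n \<omega> + 1 = X n \<omega>"
    using cc.tree_explored[of j "K \<omega>"] assms by (simp_all add: T_eq_coupon_time X_def \<tau>_def)
qed

lemma X_le: "X n \<omega> \<le> n"
  unfolding X_def by (rule coupon_count_le)

lemma measurable_\<tau>: "\<tau> n \<in> measurable M (count_space UNIV)"
  unfolding \<tau>_def[abs_def] by (intro measurable_duration measurable_K measurable_D)

lemma measurable_X: "X n \<in> measurable M (count_space UNIV)"
  unfolding X_def[abs_def] \<tau>_def
  by (intro measurable_coupon_count_duration measurable_K measurable_D)

lemma AE_\<tau>_X_eq:
  "AE \<omega> in M. \<tau> n \<omega> = duration n (K \<omega>) (\<Delta> n \<omega>) \<and>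
    X n \<omega> = coupon_count n (\<Delta> n \<omega>) (duration n (K \<omega>) (\<Delta> n \<omega>))"
  using AE_D_eq[of n]
proof eventually_elim
  case (elim \<omega>)
  have "duration n k (D n \<omega>) = duration n k (\<Delta> n \<omega>)" for k
    using elim by (intro duration_cong) auto
  moreover have "coupon_count n (D n \<omega>) = coupon_count n (\<Delta> n \<omega>)"
    using elim by (intro coupon_count_cong) auto
  ultimately show ?case by (simp add: \<tau>_def X_def)
qed

end

section \<open>Laplace transforms of the steps\<close>

text \<open>The sum is the expected time of success number \<open>j\<close>, compared here with the
  integral of \<open>n / (n - x)\<close>; termwise this is
  \<open>1 / q \<le> ln (q / (q - 1)) \<le> 1 / (q - 1)\<close>. The correction in the upper bound
  telescopes and is bounded as long as \<open>j / n\<close> stays away from 1.\<close>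

lemma sum_reciprocal_bounds:
  assumes "j < n"
  shows "real n * ln (real n / (real n - real j)) \<le> (\<Sum>i\<in>{1..j}. real n / (real n - real i))"
    and "(\<Sum>i\<in>{1..j}. real n / (real n - real i)) \<le>
      real n * ln (real n / (real n - real j)) + real n / (real n - real j) - 1"
proof -
  have "n * ln (n / (real n - real j)) \<le> (\<Sum>i\<in>{1..j}. real n / (real n - real i)) \<and>
    (\<Sum>i\<in>{1..j}. real n / (real n - real i)) \<le> n * ln (n / (real n - real j)) + n / (real n - real j) - 1"
    using assms
  proof (induction j)
    case 0
    then show ?case by simp
  next
    case (Suc j)
    define q where "q = real n - real j"
    have q: "q \<ge> 2" and eq: "real n - real (Suc j) = q - 1" using Suc.prems by (auto simp: q_def)
    have "ln (q / (q - 1)) = ln (1 + 1 / (q - 1))" using q by (simp add: field_simps)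
    then have up: "ln (q / (q - 1)) \<le> 1 / (q - 1)" using q ln_add_one_self_le_self[of "1 / (q - 1)"] by simp
    have "ln ((q - 1) / q) \<le> (q - 1) / q - 1" using q by (intro ln_le_minus_one) simp
    also have "(q - 1) / q - 1 = - (1 / q)" using q by (simp add: field_simps)
    finally have low: "1 / q \<le> ln (q / (q - 1))" using q by (simp add: ln_div)
    have ln: "ln (n / (q - 1)) = ln (n / q) + ln (q / (q - 1))"
      using q Suc.prems by (simp add: ln_div)
    have "n * ln (q / (q - 1)) \<le> n / (q - 1)" "n / q \<le> n * ln (q / (q - 1))"
      using mult_left_mono[OF up, of n] mult_left_mono[OF low, of n] by simp_all
    moreover have "(\<Sum>i\<in>{1..Suc j}. real n / (real n - real i)) =
        (\<Sum>i\<in>{1..j}. real n / (real n - real i)) + real n / (q - 1)"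
      by (simp add: q_def algebra_simps)
    moreover have "real n * ln (n / (q - 1)) = real n * ln (n / q) + n * ln (q / (q - 1))"
      by (simp add: ln distrib_left)
    moreover have "n * ln (n / q) \<le> (\<Sum>i\<in>{1..j}. real n / (real n - real i))"
        "(\<Sum>i\<in>{1..j}. real n / (real n - real i)) \<le> n * ln (n / q) + n / q - 1"
      using Suc unfolding q_def by simp_all
    ultimately show ?case unfolding eq by (intro conjI) linarith+
  qed
  then show "real n * ln (real n / (real n - real j)) \<le> (\<Sum>i\<in>{1..j}. real n / (real n - real i))"
    "(\<Sum>i\<in>{1..j}. real n / (real n - real i)) \<le>
      real n * ln (real n / (real n - real j)) + real n / (real n - real j) - 1"
    by simp_all
qed

text \<open>A concave function lies above its chord. This turns the logarithm in the mean of
  \<open>T\<close> into a bound linear in \<open>j\<close>, which makes the tail in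
  \<open>prob_S_less_T_le\<close> geometric.\<close>

lemma ln_one_minus_ge_chord:
  fixes x y :: real
  assumes "0 \<le> x" "x \<le> y" "0 < y" "y < 1"
  shows "(x / y) * ln (1 - y) \<le> ln (1 - x)"
proof -
  have "(1 - x / y) * ln 1 + (x / y) * ln (1 - y) \<le> ln ((1 - x / y) *\<^sub>R 1 + (x / y) *\<^sub>R (1 - y))"
    using assms by (intro concave_onD[OF ln_concave]) auto
  also have "(1 - x / y) *\<^sub>R 1 + (x / y) *\<^sub>R (1 - y) = 1 - x" using assms by (simp add: field_simps)
  finally show ?thesis by simp
qed

lemma nn_integral_Suc_geometric:
  fixes p z :: real
  assumes p: "0 < p" "p \<le> 1" and z: "0 < z" "(1 - p) * z < 1"
  shows "(\<integral>\<^sup>+k. ennreal (z ^ k) \<partial>measure_pmf (map_pmf Suc (geometric_pmf p))) =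
    ennreal (p * z / (1 - (1 - p) * z))"
proof -
  have "(\<integral>\<^sup>+k. ennreal (z ^ k) \<partial>measure_pmf (map_pmf Suc (geometric_pmf p))) =
      (\<integral>\<^sup>+k. ennreal (z ^ Suc k) \<partial>measure_pmf (geometric_pmf p))"
    by simp
  also have "\<dots> = (\<integral>\<^sup>+k. ennreal (p * z * ((1 - p) * z) ^ k) \<partial>count_space UNIV)"
    unfolding nn_integral_measure_pmf using p z
    by (intro nn_integral_cong) (simp add: ennreal_mult[symmetric] pmf_geometric power_mult_distrib mult_ac)
  also have "\<dots> = (\<Sum>k. ennreal (p * z * ((1 - p) * z) ^ k))"
    by (rule nn_integral_count_space_nat)
  also have "\<dots> = ennreal (\<Sum>k. p * z * ((1 - p) * z) ^ k)"
    using p z by (intro suminf_ennreal2) (auto intro!: summable_mult summable_geometric)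
  also have "(\<Sum>k. p * z * ((1 - p) * z) ^ k) = p * z / (1 - (1 - p) * z)"
    using p z by (subst suminf_mult) (auto simp: suminf_geometric summable_geometric)
  finally show ?thesis .
qed

text \<open>The transform equals \<open>1 / (1 - x)\<close> with
  \<open>x = (1 - exp (- l)) / p \<le> l / p \<le> 1 / 2\<close>, and
  \<open>- ln (1 - x) \<le> x + 2 * x^2\<close> there. The exponent is \<open>l\<close> times the
  mean \<open>1 / p\<close> plus a quadratic error.\<close>

lemma geometric_mgf_le:
  fixes p l :: real
  assumes p: "0 < p" "p \<le> 1" and l: "0 \<le> l" "l \<le> p / 2"
  shows "(\<integral>\<^sup>+k. ennreal (exp (l * real k)) \<partial>measure_pmf (map_pmf Suc (geometric_pmf p)))
    \<le> ennreal (exp (l / p + 2 * (l / p)\<^sup>2))"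
proof -
  define x where "x = (1 - exp (- l)) / p"
  have "1 - exp (- l) \<le> l" using exp_ge_add_one_self[of "- l"] by simp
  then have x: "0 \<le> x" "x \<le> l / p" using p l by (simp_all add: x_def divide_right_mono)
  have "l / p \<le> 1 / 2" using p l by (simp add: field_simps)
  with x have x2: "x \<le> 1 / 2" by linarith
  have z: "(1 - p) * exp l < 1"
  proof -
    have "exp (- l) > 1 - p" using \<open>1 - exp (- l) \<le> l\<close> l p by linarith
    then have "(1 - p) * exp l < exp (- l) * exp l" by (intro mult_strict_right_mono) auto
    then show ?thesis by (simp flip: exp_add)
  qed
  have "p * exp l / (1 - (1 - p) * exp l) = 1 / (1 - x)"
  proof -
    have "1 - x = (1 - (1 - p) * exp l) / (p * exp l)"
      using p by (simp add: x_def exp_minus field_simps)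
    then show ?thesis by simp
  qed
  also have "\<dots> \<le> exp (x + 2 * x\<^sup>2)"
  proof -
    have "exp (- (x + 2 * x\<^sup>2)) \<le> exp (ln (1 - x))"
      using ln_one_minus_pos_lower_bound[OF x(1) x2] by simp
    also have "\<dots> = 1 - x" using x2 by simp
    finally have "1 / (1 - x) \<le> 1 / exp (- (x + 2 * x\<^sup>2))" using x2 by (intro divide_left_mono) auto
    moreover have "1 / exp (- a) = exp a" for a :: real by (simp add: exp_minus inverse_eq_divide)
    ultimately show ?thesis by metis
  qed
  also have "\<dots> \<le> exp (l / p + 2 * (l / p)\<^sup>2)"
    using x by (simp add: add_mono power_mono)
  finally have le: "p * exp l / (1 - (1 - p) * exp l) \<le> exp (l / p + 2 * (l / p)\<^sup>2)" .
  have "exp (l * real k) = exp l ^ k" for k by (rule exp_of_nat2_mult)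
  then show ?thesis
    using nn_integral_Suc_geometric[OF p _ z] le by (simp add: ennreal_leI)
qed

text \<open>The transform equals \<open>1 / (1 + (exp l - 1) / p)\<close>, which is at most
  \<open>1 / (1 + x) \<le> 1 - x + x^2\<close> for \<open>x = l / p\<close>.\<close>

lemma geometric_laplace_le:
  fixes p l :: real
  assumes p: "0 < p" "p \<le> 1" and l: "0 \<le> l"
  shows "(\<integral>\<^sup>+k. ennreal (exp (- l * real k)) \<partial>measure_pmf (map_pmf Suc (geometric_pmf p)))
    \<le> ennreal (exp (- (l / p) + (l / p)\<^sup>2))"
proof -
  define x where "x = l / p"
  have x: "0 \<le> x" using p l by (simp add: x_def)
  have z: "(1 - p) * exp (- l) < 1"
  proof (cases "l = 0")
    case False
    then have "(1 - p) * exp (- l) \<le> exp (- l)" using p by (simp add: mult_left_le_one_le)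
    also have "\<dots> < 1" using False l by simp
    finally show ?thesis .
  qed (use p in simp)
  have "p * exp (- l) / (1 - (1 - p) * exp (- l)) = 1 / (1 + (exp l - 1) / p)"
  proof -
    have "1 + (exp l - 1) / p = (1 - (1 - p) * exp (- l)) / (p * exp (- l))"
      using p by (simp add: exp_minus field_simps)
    then show ?thesis by simp
  qed
  also have "\<dots> \<le> 1 / (1 + x)"
  proof (rule divide_left_mono)
    show "1 + x \<le> 1 + (exp l - 1) / p"
    proof -
      have "l \<le> exp l - 1" using exp_ge_add_one_self[of l] by linarith
      then show ?thesis using p by (simp add: x_def divide_right_mono)
    qed
    show "0 < (1 + (exp l - 1) / p) * (1 + x)" using p l x by (intro mult_pos_pos add_pos_nonneg) auto
  qed simp
  also have "\<dots> \<le> 1 - x + x\<^sup>2"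
  proof -
    have "(1 - x + x\<^sup>2) * (1 + x) = 1 + x ^ 3" by (simp add: algebra_simps power2_eq_square power3_eq_cube)
    then show ?thesis using x by (simp add: divide_le_eq)
  qed
  also have "\<dots> \<le> exp (- x + x\<^sup>2)" by (rule order_trans[OF _ exp_ge_add_one_self]) simp
  finally have le: "p * exp (- l) / (1 - (1 - p) * exp (- l)) \<le> exp (- x + x\<^sup>2)" .
  have "exp (- l * real k) = exp (- l) ^ k" for k by (rule exp_of_nat2_mult)
  then show ?thesis
    using nn_integral_Suc_geometric[OF p _ z] le by (simp add: ennreal_leI x_def)
qed

lemma truncated_mean_gt:
  assumes "ennreal m' < pmf_mean \<mu>" "0 \<le> m'"
  shows "\<exists>C::nat. m' < measure_pmf.expectation \<mu> (\<lambda>k. if k \<le> C then real k else 0)"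
proof -
  let ?f = "\<lambda>C k::nat. if k \<le> C then of_nat k else (0::ennreal)"
  have sup: "(SUP C. ?f C k) = of_nat k" for k
  proof (rule antisym)
    show "(SUP C. ?f C k) \<le> of_nat k" by (intro SUP_least) auto
    show "of_nat k \<le> (SUP C. ?f C k)" by (intro SUP_upper2[of k]) auto
  qed
  have "pmf_mean \<mu> = (\<integral>\<^sup>+k. (SUP C. ?f C k) \<partial>measure_pmf \<mu>)" unfolding pmf_mean_def sup ..
  also have "\<dots> = (SUP C. \<integral>\<^sup>+k. ?f C k \<partial>measure_pmf \<mu>)"
    by (intro nn_integral_monotone_convergence_SUP) (auto simp: incseq_def le_fun_def)
  finally obtain C where C: "ennreal m' < (\<integral>\<^sup>+k. ?f C k \<partial>measure_pmf \<mu>)"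
    using assms by (auto simp: less_SUP_iff)
  have "(\<integral>\<^sup>+k. ?f C k \<partial>measure_pmf \<mu>) = (\<integral>\<^sup>+k. ennreal (if k \<le> C then real k else 0) \<partial>measure_pmf \<mu>)"
    by (intro nn_integral_cong) (auto simp: ennreal_of_nat_eq_real_of_nat)
  also have "\<dots> = ennreal (measure_pmf.expectation \<mu> (\<lambda>k. if k \<le> C then real k else 0))"
    by (intro nn_integral_eq_integral measure_pmf.integrable_const_bound[where B = "real C"]) auto
  finally show ?thesis using C assms by (auto simp: ennreal_less_iff)
qed

text \<open>Truncation at a level \<open>C\<close> keeps the mean above \<open>m'\<close>, also when
  the mean is infinite, and gives a bounded variable whose transform can be expanded to second
  order. For small \<open>l\<close> the surplus of the truncated mean over \<open>m'\<close> pays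
  for the quadratic term.\<close>

lemma laplace_le:
  assumes "ennreal m' < pmf_mean \<mu>" "0 \<le> m'"
  shows "\<exists>l0>0. \<forall>l. 0 < l \<longrightarrow> l \<le> l0 \<longrightarrow>
    (\<integral>\<^sup>+k. ennreal (exp (- l * real k)) \<partial>measure_pmf \<mu>) \<le> ennreal (exp (- l * m'))"
proof -
  obtain C :: nat where C: "m' < measure_pmf.expectation \<mu> (\<lambda>k. if k \<le> C then real k else 0)"
    (is "_ < ?E") using truncated_mean_gt[OF assms] by blast
  have C0: "C \<noteq> 0"
  proof
    assume "C = 0"
    then have "(\<lambda>k. if k \<le> C then real k else 0) = (\<lambda>_. 0)" by auto
    with C assms show False by simp
  qed
  \<comment> \<open>At this value the quadratic term \<open>l^2 * C^2\<close> equals the gain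
    \<open>l * (?E - m')\<close>.\<close>
  define l0 where "l0 = (?E - m') / (real C)\<^sup>2"
  have l0: "0 < l0" using C C0 by (simp add: l0_def)
  have int: "integrable (measure_pmf \<mu>) (\<lambda>k. if k \<le> C then real k else 0)"
    by (intro measure_pmf.integrable_const_bound[where B = "real C"]) auto
  have "(\<integral>\<^sup>+k. ennreal (exp (- l * real k)) \<partial>measure_pmf \<mu>) \<le> ennreal (exp (- l * m'))"
    if l: "0 < l" "l \<le> l0" for l
  proof -
    let ?t = "\<lambda>k::nat. if k \<le> C then real k else 0"
    have pw: "exp (- l * real k) \<le> 1 - l * ?t k + l\<^sup>2 * (real C)\<^sup>2" for k
    proof (cases "k \<le> C")
      case True
      have "exp (- (l * real k)) \<le> 1 / (1 + l * real k)"
        using exp_ge_add_one_self[of "l * real k"] l by (simp add: exp_minus inverse_eq_divide frac_le add_pos_nonneg)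
      also have "\<dots> \<le> 1 - l * real k + (l * real k)\<^sup>2"
      proof -
        have "(1 - l * real k + (l * real k)\<^sup>2) * (1 + l * real k) = 1 + (l * real k) ^ 3"
          by (simp add: algebra_simps power2_eq_square power3_eq_cube)
        then show ?thesis using l by (simp add: divide_le_eq add_pos_nonneg)
      qed
      also have "(l * real k)\<^sup>2 \<le> l\<^sup>2 * (real C)\<^sup>2"
        using True by (simp add: power_mult_distrib mult_left_mono power_mono)
      finally show ?thesis using True by simp
    next
      case False
      have "exp (- (l * real k)) \<le> 1" using l by simp
      with False show ?thesis by (simp add: add_increasing2)
    qed
    have "measure_pmf.expectation \<mu> (\<lambda>k. exp (- l * real k)) \<le>
        measure_pmf.expectation \<mu> (\<lambda>k. 1 - l * ?t k + l\<^sup>2 * (real C)\<^sup>2)"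
    proof (rule integral_mono)
      show "integrable (measure_pmf \<mu>) (\<lambda>k. exp (- l * real k))"
        using l by (intro measure_pmf.integrable_const_bound[where B = 1]) auto
      show "integrable (measure_pmf \<mu>) (\<lambda>k. 1 - l * ?t k + l\<^sup>2 * (real C)\<^sup>2)"
        using int by (intro Bochner_Integration.integrable_add Bochner_Integration.integrable_diff
          integrable_mult_right) auto
    qed (rule pw)
    also have "\<dots> = 1 - l * ?E + l\<^sup>2 * (real C)\<^sup>2" using int by simp
    also have "\<dots> \<le> 1 - l * m'"
    proof -
      have "l * (real C)\<^sup>2 \<le> ?E - m'" using l C0 by (simp add: l0_def pos_le_divide_eq)
      then have "l * (l * (real C)\<^sup>2) \<le> l * (?E - m')" using l by (intro mult_left_mono) auto
      then show ?thesis by (simp add: algebra_simps power2_eq_square)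
    qed
    also have "\<dots> \<le> exp (- l * m')" using exp_ge_add_one_self[of "- l * m'"] by simp
    finally have "measure_pmf.expectation \<mu> (\<lambda>k. exp (- l * real k)) \<le> exp (- l * m')" .
    moreover have "(\<integral>\<^sup>+k. ennreal (exp (- l * real k)) \<partial>measure_pmf \<mu>) =
        ennreal (measure_pmf.expectation \<mu> (\<lambda>k. exp (- l * real k)))"
      using l by (intro nn_integral_eq_integral measure_pmf.integrable_const_bound[where B = 1]) auto
    ultimately show ?thesis by (simp add: ennreal_leI)
  qed
  with l0 show ?thesis by blast
qed

text \<open>Subtraction of naturals is truncated, so the integrand is the excess of \<open>k\<close>
  over \<open>C\<close>; it vanishes for \<open>C \<ge> k\<close> and is dominated by
  \<open>k\<close>.\<close>

lemma excess_tendsto_0: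
  assumes "pmf_mean \<mu> < \<infinity>"
  shows "(\<lambda>C. \<integral>\<^sup>+k. of_nat (k - C) \<partial>measure_pmf \<mu>) \<longlonglongrightarrow> 0"
proof -
  have "(\<lambda>C. \<integral>\<^sup>+k. of_nat (k - C) \<partial>measure_pmf \<mu>) \<longlonglongrightarrow> (\<integral>\<^sup>+k. 0 \<partial>measure_pmf \<mu>)"
  proof (rule nn_integral_dominated_convergence[where w = of_nat])
    show "AE k in measure_pmf \<mu>. (\<lambda>C. of_nat (k - C) :: ennreal) \<longlonglongrightarrow> 0"
    proof (rule AE_I2)
      fix k :: nat
      have "eventually (\<lambda>C. (of_nat (k - C) :: ennreal) = 0) sequentially"
        using eventually_ge_at_top[of k] by eventually_elim simp
      then show "(\<lambda>C. of_nat (k - C) :: ennreal) \<longlonglongrightarrow> 0" by (rule tendsto_eventually)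
    qed
    show "(\<integral>\<^sup>+k. of_nat k \<partial>measure_pmf \<mu>) < \<infinity>" using assms by (simp add: pmf_mean_def)
  qed auto
  then show ?thesis by simp
qed

text \<open>With only a first moment at hand, the exponential moment is that of the truncated
  variable: \<open>exp x \<le> 1 + x + x^2\<close> on the unit interval, the linear term being
  compared with \<open>l * k\<close> and the quadratic one with \<open>l^2 * C^2\<close>.\<close>

lemma truncated_mgf_le:
  assumes "pmf_mean \<mu> = ennreal m" "0 \<le> m" "0 \<le> l" "l * real C \<le> 1"
  shows "(\<integral>\<^sup>+k. ennreal (exp (l * real (min k C))) \<partial>measure_pmf \<mu>) \<le> ennreal (exp (l * m + l\<^sup>2 * (real C)\<^sup>2))"
proof -
  have "exp (l * real (min k C)) \<le> 1 + l\<^sup>2 * (real C)\<^sup>2 + l * real k" for k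
  proof -
    let ?x = "l * real (min k C)"
    have x: "0 \<le> ?x" "?x \<le> l * real C" "?x \<le> l * real k" using assms by (auto intro!: mult_left_mono)
    then have "exp ?x \<le> 1 + ?x + ?x\<^sup>2" using assms by (intro exp_bound) auto
    moreover have "?x\<^sup>2 \<le> (l * real C)\<^sup>2" using x by (intro power_mono) auto
    ultimately show ?thesis using x by (simp add: power_mult_distrib)
  qed
  then have "(\<integral>\<^sup>+k. ennreal (exp (l * real (min k C))) \<partial>measure_pmf \<mu>) \<le>
      (\<integral>\<^sup>+k. ennreal (1 + l\<^sup>2 * (real C)\<^sup>2) + ennreal l * of_nat k \<partial>measure_pmf \<mu>)"
    using assms by (intro nn_integral_mono)
      (auto simp: ennreal_of_nat_eq_real_of_nat simp flip: ennreal_mult ennreal_plus intro!: ennreal_leI)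
  also have "\<dots> = ennreal (1 + l\<^sup>2 * (real C)\<^sup>2) + ennreal l * pmf_mean \<mu>"
    by (simp add: nn_integral_add nn_integral_cmult pmf_mean_def)
  also have "\<dots> = ennreal (1 + (l * m + l\<^sup>2 * (real C)\<^sup>2))"
    using assms by (simp add: ac_simps flip: ennreal_mult ennreal_plus)
  also have "\<dots> \<le> ennreal (exp (l * m + l\<^sup>2 * (real C)\<^sup>2))" by (intro ennreal_leI exp_ge_add_one_self)
  finally show ?thesis .
qed

section \<open>Deviation estimates\<close>

context gw_coupon
begin

abbreviation "geom n i \<equiv> map_pmf Suc (geometric_pmf (1 - real i / real n))"

text \<open>Values in \<open>ennreal\<close> avoid integrability conditions. Either product may be
  empty, which covers the estimates for \<open>S\<close> alone and for \<open>T\<close>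
  alone.\<close>

lemma nn_integral_prod:
  fixes f :: "nat \<Rightarrow> ennreal" and g :: "nat \<Rightarrow> ennreal"
  assumes "1 \<le> n" "j \<le> n" "l < n"
  shows "(\<integral>\<^sup>+\<omega>. (\<Prod>i<j. f (\<xi> n i \<omega>)) * (\<Prod>i\<in>{1..l}. g (\<Delta> n \<omega> i)) \<partial>M) =
    (\<integral>\<^sup>+k. f k \<partial>measure_pmf \<mu>) ^ j * (\<Prod>i\<in>{1..l}. \<integral>\<^sup>+k. g k \<partial>measure_pmf (geom n i))"
proof -
  let ?Z = "\<lambda>z \<omega>. case z of Inl i \<Rightarrow> \<xi> n i \<omega> | Inr i \<Rightarrow> \<Delta> n \<omega> i"
  let ?h = "\<lambda>z. case z of Inl _ \<Rightarrow> f | Inr _ \<Rightarrow> g"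
  let ?I = "{..<j} <+> {1..l}"
  have "indep_vars (\<lambda>_. count_space UNIV) ?Z ?I"
    using assms by (intro indep_vars_subset[OF indep_\<xi>_\<Delta>[of n]]) auto
  then have ind: "indep_vars (\<lambda>_. borel) (\<lambda>z \<omega>. ?h z (?Z z \<omega>)) ?I"
    by (rule indep_vars_compose2) simp
  have "(\<Prod>i<j. f (\<xi> n i \<omega>)) * (\<Prod>i\<in>{1..l}. g (\<Delta> n \<omega> i)) = (\<Prod>z\<in>?I. ?h z (?Z z \<omega>))" for \<omega>
    by (simp add: prod.Plus)
  then have "(\<integral>\<^sup>+\<omega>. (\<Prod>i<j. f (\<xi> n i \<omega>)) * (\<Prod>i\<in>{1..l}. g (\<Delta> n \<omega> i)) \<partial>M) =
      (\<integral>\<^sup>+\<omega>. (\<Prod>z\<in>?I. ?h z (?Z z \<omega>)) \<partial>M)" by simp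
  also have "\<dots> = (\<Prod>z\<in>?I. \<integral>\<^sup>+\<omega>. ?h z (?Z z \<omega>) \<partial>M)"
    by (rule indep_vars_nn_integral[OF _ ind]) auto
  also have "\<dots> = (\<Prod>i<j. \<integral>\<^sup>+\<omega>. f (\<xi> n i \<omega>) \<partial>M) * (\<Prod>i\<in>{1..l}. \<integral>\<^sup>+\<omega>. g (\<Delta> n \<omega> i) \<partial>M)"
    by (simp add: prod.Plus)
  also have "(\<Prod>i<j. \<integral>\<^sup>+\<omega>. f (\<xi> n i \<omega>) \<partial>M) = (\<Prod>i<j. \<integral>\<^sup>+k. f k \<partial>measure_pmf \<mu>)"
  proof (rule prod.cong[OF refl])
    fix i assume i: "i \<in> {..<j}"
    with assms have "(\<integral>\<^sup>+\<omega>. f (\<xi> n i \<omega>) \<partial>M) = (\<integral>\<^sup>+k. f k \<partial>distr M (count_space UNIV) (\<xi> n i))"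
      by (intro nn_integral_distr[symmetric] measurable_\<xi>) auto
    also have "distr M (count_space UNIV) (\<xi> n i) = measure_pmf \<mu>"
      using i assms by (intro \<xi>_law) auto
    finally show "(\<integral>\<^sup>+\<omega>. f (\<xi> n i \<omega>) \<partial>M) = (\<integral>\<^sup>+k. f k \<partial>measure_pmf \<mu>)" .
  qed
  also have "(\<Prod>i\<in>{1..l}. \<integral>\<^sup>+\<omega>. g (\<Delta> n \<omega> i) \<partial>M) = (\<Prod>i\<in>{1..l}. \<integral>\<^sup>+k. g k \<partial>measure_pmf (geom n i))"
  proof (rule prod.cong[OF refl])
    fix i assume i: "i \<in> {1..l}"
    with assms have "(\<integral>\<^sup>+\<omega>. g (\<Delta> n \<omega> i) \<partial>M) = (\<integral>\<^sup>+k. g k \<partial>distr M (count_space UNIV) (\<lambda>\<omega>. \<Delta> n \<omega> i))"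
      by (intro nn_integral_distr[symmetric] measurable_\<Delta>) auto
    also have "distr M (count_space UNIV) (\<lambda>\<omega>. \<Delta> n \<omega> i) = measure_pmf (geom n i)"
      using i assms by (intro \<Delta>_law) auto
    finally show "(\<integral>\<^sup>+\<omega>. g (\<Delta> n \<omega> i) \<partial>M) = (\<integral>\<^sup>+k. g k \<partial>measure_pmf (geom n i))" .
  qed
  finally show ?thesis by simp
qed

lemma measurable_prod_factors:
  fixes f :: "nat \<Rightarrow> ennreal" and g :: "nat \<Rightarrow> ennreal"
  assumes "j \<le> n" "l < n"
  shows "(\<lambda>\<omega>. (\<Prod>i<j. f (\<xi> n i \<omega>)) * (\<Prod>i\<in>{1..l}. g (\<Delta> n \<omega> i))) \<in> borel_measurable M"
proof -
  have "(\<lambda>\<omega>. f (\<xi> n i \<omega>)) \<in> borel_measurable M" if "i < j" for i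
    using that assms by (intro measurable_compose[OF measurable_\<xi>[of i n]]) auto
  moreover have "(\<lambda>\<omega>. g (\<Delta> n \<omega> i)) \<in> borel_measurable M" if "i \<in> {1..l}" for i
    using that assms by (intro measurable_compose[OF measurable_\<Delta>[of i n]]) auto
  ultimately show ?thesis
    by (intro borel_measurable_times_ennreal borel_measurable_prod_ennreal) auto
qed

text \<open>The common form of the Chernoff and Markov bounds below. The comparison is only almost
  sure because \<open>T\<close> is built from \<open>D\<close>, whereas the laws are given for
  \<Delta>.\<close>

lemma prob_le_nn_integral:
  fixes f :: "'a \<Rightarrow> ennreal"
  assumes f: "f \<in> borel_measurable M" and Q: "AE \<omega> in M. Q \<omega> \<longrightarrow> 1 \<le> f \<omega>"
    and le: "(\<integral>\<^sup>+\<omega>. f \<omega> \<partial>M) \<le> ennreal r" "0 \<le> r"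
  shows "prob {\<omega>\<in>space M. Q \<omega>} \<le> r"
proof -
  have "emeasure M {\<omega>\<in>space M. Q \<omega>} \<le> emeasure M {\<omega>\<in>space M. 1 \<le> f \<omega>}"
    using Q f by (intro emeasure_mono_AE) auto
  also have "\<dots> \<le> (\<integral>\<^sup>+\<omega>. f \<omega> \<partial>M)"
    using nn_integral_Markov_inequality[of f "space M" M 1] f
    by (simp cong: nn_integral_cong)
  also note le(1)
  finally show ?thesis using le(2) by (simp add: emeasure_eq_measure)
qed

lemma prod_nn_integral_le:
  assumes "\<And>i. i \<in> {1..l} \<Longrightarrow> (\<integral>\<^sup>+k. g k \<partial>measure_pmf (geom n i)) \<le> ennreal (exp (b i))"
  shows "(\<Prod>i\<in>{1..l}. \<integral>\<^sup>+k. g k \<partial>measure_pmf (geom n i)) \<le> ennreal (exp (\<Sum>i\<in>{1..l}. b i))"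
proof -
  have "(\<Prod>i\<in>{1..l}. \<integral>\<^sup>+k. g k \<partial>measure_pmf (geom n i)) \<le> (\<Prod>i\<in>{1..l}. ennreal (exp (b i)))"
    by (rule prod_mono_ennreal) (rule assms)
  then show ?thesis by (simp add: exp_sum prod_ennreal)
qed

lemma prod_exp_ennreal: "finite A \<Longrightarrow> (\<Prod>i\<in>A. ennreal (exp (b i))) = ennreal (exp (\<Sum>i\<in>A. b i))"
  by (simp add: exp_sum prod_ennreal)

lemma waiting_prob_bounds:
  assumes "0 < y" "y < 1" "1 \<le> n" "real j \<le> y * real n" "i \<in> {1..j}"
  shows "0 < 1 - real i / real n" "1 - real i / real n \<le> 1" "1 - y \<le> 1 - real i / real n"
    "1 / (1 - real i / real n) = real n / (real n - real i)" "j < n"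
proof -
  have "real i \<le> y * real n" using assms by auto
  then have "real i / real n \<le> y" using assms by (simp add: divide_le_eq)
  then show "0 < 1 - real i / real n" "1 - real i / real n \<le> 1" "1 - y \<le> 1 - real i / real n"
    using assms by (linarith, simp, linarith)
  then show "1 / (1 - real i / real n) = real n / (real n - real i)"
    using assms by (simp add: field_simps)
  have "y * real n < real n" using assms by simp
  then show "j < n" using assms by linarith
qed

text \<open>Exponential Markov inequality for \<open>T - S\<close>. By the chord bound the mean of
  \<open>T\<close> is at most \<open>j * (m' - c) + 1 / (1 - y)\<close>, so the linear part of the
  exponent is \<open>- l * c * j\<close> up to the constant \<open>l / (1 - y)\<close>. The bound
  \<open>l \<le> (1 - y) / 2\<close> admits \<open>geometric_mgf_le\<close>, and the one involving
  \<open>c\<close> lets the quadratic error consume at most half of the linear gain.\<close>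

lemma prob_S_less_T_le:
  assumes y: "0 < y" "y < 1" and l: "0 < l" "l \<le> (1 - y) / 2" "l \<le> c * (1 - y)\<^sup>2 / 4"
    and laplace: "(\<integral>\<^sup>+k. ennreal (exp (- l * real k)) \<partial>measure_pmf \<mu>) \<le> ennreal (exp (- l * m'))"
    and c: "c = m' + ln (1 - y) / y" and n: "1 \<le> n" "real j \<le> y * real n"
  shows "prob {\<omega>\<in>space M. S n j \<omega> < T n j \<omega>} \<le> exp (l / (1 - y)) * exp (- (l * c / 2)) ^ j"
proof -
  have jn: "j < n"
  proof -
    have "y * real n < real n" using y n by simp
    then show ?thesis using n by linarith
  qed
  define f where "f k = ennreal (exp (- l * real k))" for k
  define g where "g k = ennreal (exp (l * real k))" for k
  have f_prod: "(\<Prod>i<j. f (\<xi> n i \<omega>)) = ennreal (exp (- l * real (S n j \<omega>)))" for \<omega>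
    unfolding f_def by (simp add: prod_exp_ennreal S_def sum_distrib_left sum_negf)
  have g_int: "(\<integral>\<^sup>+k. g k \<partial>measure_pmf (geom n i)) \<le> ennreal (exp (l * (real n / (real n - real i)) + 2 * (l / (1 - y))\<^sup>2))"
    if i: "i \<in> {1..j}" for i
  proof -
    note p = waiting_prob_bounds[OF y n i]
    let ?p = "1 - real i / real n"
    have "(\<integral>\<^sup>+k. g k \<partial>measure_pmf (geom n i)) \<le> ennreal (exp (l / ?p + 2 * (l / ?p)\<^sup>2))"
      unfolding g_def using p l by (intro geometric_mgf_le) auto
    also have "\<dots> \<le> ennreal (exp (l * (real n / (real n - real i)) + 2 * (l / (1 - y))\<^sup>2))"
    proof -
      have "l / ?p = l * (real n / (real n - real i))" using p(4) by (metis mult.right_neutral times_divide_eq_right)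
      moreover have "(l / ?p)\<^sup>2 \<le> (l / (1 - y))\<^sup>2"
        using p l y by (intro power_mono divide_left_mono) auto
      ultimately show ?thesis by (intro ennreal_leI) simp
    qed
    finally show ?thesis .
  qed
  have "prob {\<omega>\<in>space M. S n j \<omega> < T n j \<omega>} \<le> exp (- (l * m' * j)) * exp (l * (\<Sum>i\<in>{1..j}. real n / (real n - real i)) + j * (2 * (l / (1 - y))\<^sup>2))"
  proof (rule prob_le_nn_integral[OF measurable_prod_factors[of j n j f g]])
    show "AE \<omega> in M. S n j \<omega> < T n j \<omega> \<longrightarrow> 1 \<le> (\<Prod>i<j. f (\<xi> n i \<omega>)) * (\<Prod>i\<in>{1..j}. g (\<Delta> n \<omega> i))"
      using AE_D_eq[of n]
    proof eventually_elim
      case (elim \<omega>)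
      then have "(\<Prod>i\<in>{1..j}. g (\<Delta> n \<omega> i)) = (\<Prod>i\<in>{1..j}. g (D n \<omega> i))"
        using jn by (intro prod.cong) auto
      also have "\<dots> = ennreal (exp (l * real (T n j \<omega>)))"
        unfolding g_def by (simp add: prod_exp_ennreal T_def sum_distrib_left)
      finally have "(\<Prod>i<j. f (\<xi> n i \<omega>)) * (\<Prod>i\<in>{1..j}. g (\<Delta> n \<omega> i)) =
          ennreal (exp (l * (real (T n j \<omega>) - real (S n j \<omega>))))"
        unfolding f_prod by (simp add: algebra_simps flip: ennreal_mult exp_add)
      then show ?case using l by simp
    qed
    have "(\<integral>\<^sup>+\<omega>. (\<Prod>i<j. f (\<xi> n i \<omega>)) * (\<Prod>i\<in>{1..j}. g (\<Delta> n \<omega> i)) \<partial>M) \<le>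
        ennreal (exp (- l * m')) ^ j * ennreal (exp (\<Sum>i\<in>{1..j}. l * (real n / (real n - real i)) + 2 * (l / (1 - y))\<^sup>2))"
      unfolding nn_integral_prod[OF n(1) less_imp_le[OF jn] jn]
    proof (intro mult_mono power_mono prod_nn_integral_le g_int)
      show "(\<integral>\<^sup>+k. f k \<partial>measure_pmf \<mu>) \<le> ennreal (exp (- l * m'))"
        using laplace by (simp add: f_def)
    qed auto
    also have "\<dots> = ennreal (exp (- (l * m' * j)) * exp (l * (\<Sum>i\<in>{1..j}. real n / (real n - real i)) + j * (2 * (l / (1 - y))\<^sup>2)))"
      by (simp add: ennreal_power exp_of_nat_mult[symmetric] sum.distrib sum_distrib_left ennreal_mult ac_simps)
    finally show "(\<integral>\<^sup>+\<omega>. (\<Prod>i<j. f (\<xi> n i \<omega>)) * (\<Prod>i\<in>{1..j}. g (\<Delta> n \<omega> i)) \<partial>M) \<le>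
      ennreal (exp (- (l * m' * j)) * exp (l * (\<Sum>i\<in>{1..j}. real n / (real n - real i)) + j * (2 * (l / (1 - y))\<^sup>2)))" .
  qed (use jn in auto)
  also have "\<dots> \<le> exp (l / (1 - y)) * exp (- (l * c / 2)) ^ j"
  proof -
    let ?x = "real j / real n"
    have x: "0 \<le> ?x" "?x \<le> y" using n by (simp_all add: divide_le_eq)
    have "real n / (real n - real j) \<le> 1 / (1 - y)"
    proof -
      have "(1 - y) * real n \<le> real n - real j" using n by (simp add: algebra_simps)
      then show ?thesis using y jn by (simp add: divide_le_eq le_divide_eq mult.commute)
    qed
    moreover have "real n * ln (real n / (real n - real j)) \<le> j * (m' - c)"
    proof -
      have "real n / (real n - real j) = 1 / (1 - ?x)" using jn by (simp add: field_simps)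
      then have "ln (real n / (real n - real j)) = - ln (1 - ?x)"
        using jn by (simp add: ln_div)
      also have "\<dots> \<le> - ((?x / y) * ln (1 - y))" using ln_one_minus_ge_chord[OF x y] by simp
      also have "\<dots> = ?x * (m' - c)" using y by (simp add: c)
      finally have "real n * ln (real n / (real n - real j)) \<le> real n * (?x * (m' - c))"
        by (intro mult_left_mono) auto
      then show ?thesis using n by simp
    qed
    ultimately have "(\<Sum>i\<in>{1..j}. real n / (real n - real i)) \<le> j * (m' - c) + 1 / (1 - y)"
      using sum_reciprocal_bounds(2)[OF jn] by linarith
    then have "l * (\<Sum>i\<in>{1..j}. real n / (real n - real i)) \<le> l * (j * (m' - c) + 1 / (1 - y))"
      using l by (intro mult_left_mono) auto
    moreover have "2 * (l / (1 - y))\<^sup>2 \<le> l * c / 2"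
    proof -
      have "4 * l / (1 - y)\<^sup>2 \<le> c" using l(3) y by (simp add: field_simps)
      then have "l * (4 * l / (1 - y)\<^sup>2) \<le> l * c" using l by (intro mult_left_mono) auto
      then show ?thesis by (simp add: power_divide power2_eq_square mult.left_commute)
    qed
    then have "j * (2 * (l / (1 - y))\<^sup>2) \<le> j * (l * c / 2)" by (intro mult_left_mono) auto
    ultimately have "- (l * m' * j) + (l * (\<Sum>i\<in>{1..j}. real n / (real n - real i)) + j * (2 * (l / (1 - y))\<^sup>2)) \<le>
      l / (1 - y) - j * (l * c / 2)"
      by (simp add: algebra_simps)
    then have "exp (- (l * m' * j)) * exp (l * (\<Sum>i\<in>{1..j}. real n / (real n - real i)) + j * (2 * (l / (1 - y))\<^sup>2)) \<le>
      exp (l / (1 - y) + j * (- (l * c / 2)))"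
      unfolding exp_add[symmetric] by simp
    also have "\<dots> = exp (l / (1 - y)) * exp (- (l * c / 2)) ^ j"
      unfolding exp_add exp_of_nat_mult ..
    finally show ?thesis .
  qed
  finally show ?thesis .
qed

text \<open>Since the constants depend neither on \<open>n\<close> nor on \<open>j\<close>, the
  bounds can be summed over all \<open>j\<close> from a fixed level up to \<open>y * n\<close>. The
  condition on \<open>m'\<close> says that the drift along the chord,
  \<open>m' + ln (1 - y) / y\<close>, is positive.\<close>

lemma lower_tail:
  assumes y: "0 < y" "y < 1" and m': "ennreal m' < pmf_mean \<mu>" "0 < m' * y + ln (1 - y)"
  shows "\<exists>B \<rho>. 0 \<le> B \<and> 0 < \<rho> \<and> \<rho> < 1 \<and> (\<forall>n j. 1 \<le> n \<longrightarrow> real j \<le> y * real n \<longrightarrow>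
    prob {\<omega>\<in>space M. S n j \<omega> < T n j \<omega>} \<le> B * \<rho> ^ j)"
proof -
  define c where "c = m' + ln (1 - y) / y"
  have c: "0 < c" using m' y by (simp add: c_def field_simps)
  have "ln (1 - y) < 0" using y by simp
  with m' have "0 < m' * y" by linarith
  then have "0 \<le> m'" using y by (simp add: zero_less_mult_iff)
  then obtain l0 where l0: "0 < l0" "\<And>l. 0 < l \<Longrightarrow> l \<le> l0 \<Longrightarrow>
      (\<integral>\<^sup>+k. ennreal (exp (- l * real k)) \<partial>measure_pmf \<mu>) \<le> ennreal (exp (- l * m'))"
    using laplace_le[OF m'(1)] by blast
  define l where "l = min l0 (min ((1 - y) / 2) (c * (1 - y)\<^sup>2 / 4))"
  have l: "0 < l" "l \<le> l0" "l \<le> (1 - y) / 2" "l \<le> c * (1 - y)\<^sup>2 / 4"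
  proof -
    show "0 < l" using l0 y c by (simp add: l_def)
    show "l \<le> l0" "l \<le> (1 - y) / 2" "l \<le> c * (1 - y)\<^sup>2 / 4" unfolding l_def by linarith+
  qed
  show ?thesis
    using prob_S_less_T_le[OF y l(1,3,4) l0(2)[OF l(1,2)] c_def] l c
    by (intro exI[of _ "exp (l / (1 - y))"] exI[of _ "exp (- (l * c / 2))"]) auto
qed

text \<open>Waiting time number \<open>i\<close> differs from 1 with probability
  \<open>i / n\<close>; the union bound over indices up to the fixed \<open>A\<close> gives
  \<open>A^2 / n\<close>.\<close>

lemma no_failure:
  "(\<lambda>n. prob {\<omega>\<in>space M. T n A \<omega> \<noteq> A}) \<longlonglongrightarrow> 0"
proof (rule tendsto_sandwich[OF _ _ tendsto_const])
  show "\<forall>\<^sub>F n in sequentially. prob {\<omega>\<in>space M. T n A \<omega> \<noteq> A} \<le> real A * real A / real n"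
    using eventually_gt_at_top[of A]
  proof eventually_elim
    case (elim n)
    let ?B = "\<lambda>i. (\<lambda>\<omega>. \<Delta> n \<omega> i) -` {k. k \<noteq> 1} \<inter> space M"
    have B: "?B i \<in> events" "prob (?B i) \<le> real A / real n" if i: "i \<in> {1..A}" for i
    proof -
      have m: "(\<lambda>\<omega>. \<Delta> n \<omega> i) \<in> measurable M (count_space UNIV)"
        using i elim by (intro measurable_\<Delta>) auto
      then show "?B i \<in> events" by (rule measurable_sets) simp
      have "prob (?B i) = measure (distr M (count_space UNIV) (\<lambda>\<omega>. \<Delta> n \<omega> i)) {k. k \<noteq> 1}"
        using m by (simp add: measure_distr)
      also have "distr M (count_space UNIV) (\<lambda>\<omega>. \<Delta> n \<omega> i) = measure_pmf (geom n i)"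
        using i elim by (intro \<Delta>_law) auto
      also have "measure_pmf.prob (geom n i) {k. k \<noteq> 1} = 1 - measure_pmf.prob (geom n i) {1}"
        using measure_pmf.prob_compl[of "{1}" "geom n i"] by (simp add: Compl_eq_Diff_UNIV[symmetric] Collect_neg_eq)
      also have "measure_pmf.prob (geom n i) {1} = 1 - real i / real n"
      proof -
        have "Suc -` {1} = {0}" by auto
        moreover have "real i / real n < 1" using i elim by simp
        ultimately show ?thesis
          using pmf_map_inj'[of Suc "geometric_pmf (1 - real i / real n)" 0] i
          by (simp add: measure_pmf_single)
      qed
      finally show "prob (?B i) \<le> real A / real n" using i by (simp add: divide_right_mono)
    qed
    have "{\<omega>\<in>space M. T n A \<omega> \<noteq> A} \<subseteq> (\<Union>i\<in>{1..A}. ?B i)"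
    proof safe
      fix \<omega> assume \<omega>: "\<omega> \<in> space M" "T n A \<omega> \<noteq> A"
      have "\<exists>i\<in>{1..A}. \<Delta> n \<omega> i \<noteq> 1"
      proof (rule ccontr)
        assume "\<not> ?thesis"
        then have "T n A \<omega> = (\<Sum>i\<in>{1..A}. 1)" unfolding T_def D_def by (intro sum.cong) auto
        with \<omega> show False by simp
      qed
      with \<omega> show "\<omega> \<in> (\<Union>i\<in>{1..A}. ?B i)" by auto
    qed
    then have "prob {\<omega>\<in>space M. T n A \<omega> \<noteq> A} \<le> prob (\<Union>i\<in>{1..A}. ?B i)"
      using B(1) by (intro finite_measure_mono sets.finite_UN) auto
    also have "\<dots> \<le> (\<Sum>i\<in>{1..A}. prob (?B i))"
      using B by (intro finite_measure_subadditive_finite) auto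
    also have "\<dots> \<le> (\<Sum>i\<in>{1..A}. real A / real n)" using B by (intro sum_mono) auto
    finally show ?case by simp
  qed
  show "(\<lambda>n. real A * real A / real n) \<longlonglongrightarrow> 0" by real_asymp
qed simp

end

section \<open>Clock, walk and informed count at a fixed fraction of \<open>n\<close>\<close>

context gw_coupon
begin

text \<open>Exponential Markov inequality at a negative parameter. Of the slack \<open>e\<close> one
  quarter is lost to rounding \<open>y * n\<close> down and one quarter to the quadratic term; the
  remaining half is the rate of decay.\<close>

lemma tendsto_T_small:
  assumes y: "0 < y" "y < 1" and a: "a < - ln (1 - y)"
  shows "(\<lambda>n. prob {\<omega>\<in>space M. real (T n (nat \<lfloor>y * real n\<rfloor>) \<omega>) \<le> a * real n}) \<longlonglongrightarrow> 0"
proof -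
  define e where "e = - ln (1 - y) - a"
  \<comment> \<open>Makes the quadratic term \<open>(l / (1 - y))^2\<close> equal to
    \<open>l * e / 4\<close>.\<close>
  define l where "l = e * (1 - y)\<^sup>2 / 4"
  have e: "0 < e" and l: "0 < l" using a y by (simp_all add: e_def l_def)
  have "(\<lambda>n. - ln (1 - y + 1 / real n)) \<longlonglongrightarrow> - ln (1 - y + 0)"
    using y by (intro tendsto_intros lim_1_over_n) auto
  then have "eventually (\<lambda>n. - ln (1 - y) - e / 4 < - ln (1 - y + 1 / real n)) sequentially"
    using e by (intro order_tendstoD(1)) auto
  then have "eventually (\<lambda>n. prob {\<omega>\<in>space M. real (T n (nat \<lfloor>y * real n\<rfloor>) \<omega>) \<le> a * real n}
      \<le> exp (- (l * e / 2) * real n)) sequentially"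
    using eventually_ge_at_top[of 1]
  proof eventually_elim
    case (elim n)
    define j where "j = nat \<lfloor>y * real n\<rfloor>"
    have j: "real j \<le> y * real n" "y * real n - 1 \<le> real j"
      using y elim unfolding j_def by (auto intro: of_nat_floor)
    have jn: "j < n"
    proof -
      have "y * real n < real n" using y elim by simp
      then show ?thesis using j by linarith
    qed
    define g where "g k = ennreal (exp (- l * real k))" for k
    have g_int: "(\<integral>\<^sup>+k. g k \<partial>measure_pmf (geom n i)) \<le> ennreal (exp (- (l * (real n / (real n - real i))) + (l / (1 - y))\<^sup>2))"
      if i: "i \<in> {1..j}" for i
    proof -
      note p = waiting_prob_bounds[OF y elim(2) j(1) i]
      let ?p = "1 - real i / real n"
      have "(\<integral>\<^sup>+k. g k \<partial>measure_pmf (geom n i)) \<le> ennreal (exp (- (l / ?p) + (l / ?p)\<^sup>2))"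
        unfolding g_def using p l by (intro geometric_laplace_le) auto
      also have "\<dots> \<le> ennreal (exp (- (l * (real n / (real n - real i))) + (l / (1 - y))\<^sup>2))"
      proof -
        have "l / ?p = l * (real n / (real n - real i))" using p(4) by (metis mult.right_neutral times_divide_eq_right)
        moreover have "(l / ?p)\<^sup>2 \<le> (l / (1 - y))\<^sup>2"
          using p l y by (intro power_mono divide_left_mono) auto
        ultimately show ?thesis by (intro ennreal_leI) simp
      qed
      finally show ?thesis .
    qed
    let ?s = "\<Sum>i\<in>{1..j}. real n / (real n - real i)"
    let ?f = "\<lambda>\<omega>. (\<Prod>i<(0::nat). (1::ennreal)) * (\<Prod>i\<in>{1..j}. g (\<Delta> n \<omega> i))"
    have "prob {\<omega>\<in>space M. real (T n j \<omega>) \<le> a * real n} \<le> exp (l * (a * real n)) * exp (- (l * ?s) + j * (l / (1 - y))\<^sup>2)"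
    proof (rule prob_le_nn_integral[of "\<lambda>\<omega>. ennreal (exp (l * (a * real n))) * ?f \<omega>"])
      have m: "?f \<in> borel_measurable M"
        using measurable_prod_factors[of 0 n j "\<lambda>_. 1" g] jn by simp
      then show "(\<lambda>\<omega>. ennreal (exp (l * (a * real n))) * ?f \<omega>) \<in> borel_measurable M" by measurable
      show "AE \<omega> in M. real (T n j \<omega>) \<le> a * real n \<longrightarrow> 1 \<le> ennreal (exp (l * (a * real n))) * ?f \<omega>"
        using AE_D_eq[of n]
      proof eventually_elim
        case (elim \<omega>)
        then have "(\<Prod>i\<in>{1..j}. g (\<Delta> n \<omega> i)) = (\<Prod>i\<in>{1..j}. g (D n \<omega> i))"
          using jn by (intro prod.cong) auto
        also have "\<dots> = ennreal (exp (- l * real (T n j \<omega>)))"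
          unfolding g_def by (simp add: prod_exp_ennreal T_def sum_distrib_left sum_negf)
        finally have "ennreal (exp (l * (a * real n))) * ?f \<omega> =
            ennreal (exp (l * (a * real n - real (T n j \<omega>))))"
          by (simp add: right_diff_distrib flip: ennreal_mult exp_add)
        then show ?case using l by simp
      qed
      have "(\<integral>\<^sup>+\<omega>. ennreal (exp (l * (a * real n))) * ?f \<omega> \<partial>M) = ennreal (exp (l * (a * real n))) * (\<integral>\<^sup>+\<omega>. ?f \<omega> \<partial>M)"
        using m by (rule nn_integral_cmult)
      also have "(\<integral>\<^sup>+\<omega>. ?f \<omega> \<partial>M) = (\<Prod>i\<in>{1..j}. \<integral>\<^sup>+k. g k \<partial>measure_pmf (geom n i))"
        using nn_integral_prod[OF elim(2) le0 jn, of "\<lambda>_. 1" g] by simp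
      also have "ennreal (exp (l * (a * real n))) * \<dots> \<le> ennreal (exp (l * (a * real n))) *
          ennreal (exp (\<Sum>i\<in>{1..j}. - (l * (real n / (real n - real i))) + (l / (1 - y))\<^sup>2))"
        by (intro mult_left_mono prod_nn_integral_le g_int) auto
      also have "\<dots> = ennreal (exp (l * (a * real n)) * exp (- (l * ?s) + j * (l / (1 - y))\<^sup>2))"
        by (simp add: sum.distrib sum_distrib_left sum_negf ennreal_mult sum_subtractf)
      finally show "(\<integral>\<^sup>+\<omega>. ennreal (exp (l * (a * real n))) * ?f \<omega> \<partial>M) \<le>
          ennreal (exp (l * (a * real n)) * exp (- (l * ?s) + j * (l / (1 - y))\<^sup>2))" .
    qed simp
    also have "\<dots> \<le> exp (- (l * e / 2) * real n)"
    proof -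
      have "real n / (real n - real j) = 1 / (1 - real j / real n)" using jn by (simp add: field_simps)
      moreover have "1 - real j / real n \<le> 1 - y + 1 / real n"
      proof -
        have "(y * real n - 1) / real n \<le> real j / real n" using j by (intro divide_right_mono) auto
        then show ?thesis using elim(2) by (simp add: diff_divide_distrib)
      qed
      moreover have "0 < 1 - real j / real n" using jn by simp
      ultimately have "ln (1 - real j / real n) \<le> ln (1 - y + 1 / real n)"
        "ln (real n / (real n - real j)) = - ln (1 - real j / real n)"
        by (simp_all only: ln_mono) (simp add: ln_div)
      then have "- ln (1 - y + 1 / real n) \<le> ln (real n / (real n - real j))" by simp
      then have "real n * (- ln (1 - y) - e / 4) \<le> real n * ln (real n / (real n - real j))"
        using elim by (intro mult_left_mono) auto
      then have "real n * (a + 3 * e / 4) \<le> ?s"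
        using sum_reciprocal_bounds(1)[OF jn] by (simp add: e_def field_simps)
      then have "l * (real n * (a + 3 * e / 4)) \<le> l * ?s" using l by (intro mult_left_mono) auto
      moreover have "j * (l / (1 - y))\<^sup>2 \<le> real n * (l * e / 4)"
      proof -
        have "(l / (1 - y))\<^sup>2 = l * (l / (1 - y)\<^sup>2)" by (simp add: power_divide power2_eq_square)
        also have "l / (1 - y)\<^sup>2 = e / 4" using y by (simp add: l_def)
        finally have "(l / (1 - y))\<^sup>2 = l * e / 4" by simp
        then show ?thesis using l e jn by (metis less_imp_le mult_right_mono of_nat_le_iff zero_le_power2)
      qed
      ultimately show ?thesis unfolding exp_add[symmetric] by (simp add: algebra_simps)
    qed
    finally show ?case by (simp add: j_def)
  qed
  moreover have "(\<lambda>n. exp (- (l * e / 2) * real n)) \<longlonglongrightarrow> 0"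
    using l e by real_asymp
  ultimately show ?thesis
    by (rule tendsto_sandwich[OF _ _ tendsto_const, rotated]) simp
qed

text \<open>As only the mean is finite, \<open>S\<close> is split at a truncation level: the
  truncated part \<open>S1\<close> is controlled by an exponential moment, the excess
  \<open>S2\<close> by Markov's inequality. The slack \<open>a - m * y\<close> is shared equally
  between them.\<close>

lemma tendsto_S_large:
  assumes m: "pmf_mean \<mu> = ennreal m" "0 \<le> m" and y: "0 < y" "y \<le> 1" and a: "m * y < a"
  shows "(\<lambda>n. prob {\<omega>\<in>space M. a * real n \<le> real (S n (nat \<lfloor>y * real n\<rfloor>) \<omega>)}) \<longlonglongrightarrow> 0"
proof (rule order_tendstoI)
  fix \<epsilon> :: real assume \<epsilon>: "0 < \<epsilon>"
  define h where "h = (a - m * y) / 2"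
  have h: "0 < h" using a by (simp add: h_def)
  \<comment> \<open>At such a level Markov's inequality leaves at most \<open>\<epsilon> / 2\<close>
    for the excess to reach \<open>h * n\<close>.\<close>
  have "eventually (\<lambda>C. (\<integral>\<^sup>+k. of_nat (k - C) \<partial>measure_pmf \<mu>) < ennreal (\<epsilon> * h / (2 * y))) sequentially"
    using excess_tendsto_0[of \<mu>] m y h \<epsilon> by (intro order_tendstoD(2)[of _ 0]) auto
  then obtain C where C: "(\<integral>\<^sup>+k. of_nat (k - C) \<partial>measure_pmf \<mu>) < ennreal (\<epsilon> * h / (2 * y))"
    by (auto simp: eventually_sequentially)
  \<comment> \<open>The first bound gives \<open>l * C \<le> 1\<close> for
    \<open>truncated_mgf_le\<close>, the second makes the quadratic term cost at most half of
    \<open>h\<close>; the added ones guard against \<open>C = 0\<close>.\<close>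
  define l where "l = min (1 / (real C + 1)) (h / (2 * y * ((real C)\<^sup>2 + 1)))"
  have l: "0 < l" using h y by (simp add: l_def add_nonneg_pos)
  have lC: "l * real C \<le> 1"
  proof -
    have "l * real C \<le> 1 / (real C + 1) * real C" by (intro mult_right_mono) (auto simp: l_def)
    also have "\<dots> \<le> 1" by simp
    finally show ?thesis .
  qed
  have lh: "y * (l * (real C)\<^sup>2) \<le> h / 2"
  proof -
    have "l \<le> h / (2 * y * ((real C)\<^sup>2 + 1))" by (simp add: l_def)
    then have "l * (2 * y * ((real C)\<^sup>2 + 1)) \<le> h"
      using y by (subst (asm) pos_le_divide_eq) (auto intro!: mult_pos_pos add_nonneg_pos)
    moreover have "0 \<le> l * y" using l y by simp
    ultimately show ?thesis by (simp add: algebra_simps)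
  qed
  have "(\<lambda>n. exp (- (l * h / 2) * real n)) \<longlonglongrightarrow> 0" using l h by real_asymp
  then have "eventually (\<lambda>n. exp (- (l * h / 2) * real n) < \<epsilon> / 2) sequentially"
    using \<epsilon> by (intro order_tendstoD(2)) auto
  then show "eventually (\<lambda>n. prob {\<omega>\<in>space M. a * real n \<le> real (S n (nat \<lfloor>y * real n\<rfloor>) \<omega>)} < \<epsilon>) sequentially"
    using eventually_ge_at_top[of 1]
  proof eventually_elim
    case (elim n)
    define j where "j = nat \<lfloor>y * real n\<rfloor>"
    have j: "real j \<le> y * real n" using y unfolding j_def by (intro of_nat_floor) auto
    have jn: "j \<le> n"
    proof -
      have "y * real n \<le> real n" using y by (simp add: mult_left_le_one_le)
      then show ?thesis using j by linarith
    qed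
    have n0: "0 < n" using elim by simp
    define f where "f k = ennreal (exp (l * real (min k C)))" for k
    define S1 where "S1 \<omega> = (\<Sum>i<j. min (\<xi> n i \<omega>) C)" for \<omega>
    define S2 where "S2 \<omega> = (\<Sum>i<j. \<xi> n i \<omega> - C)" for \<omega>
    have S_split: "S n j \<omega> = S1 \<omega> + S2 \<omega>" for \<omega>
      unfolding S_def S1_def S2_def sum.distrib[symmetric] by (intro sum.cong) auto
    have m1: "S1 \<in> measurable M (count_space UNIV)" and m2: "S2 \<in> measurable M (count_space UNIV)"
      unfolding S1_def[abs_def] S2_def[abs_def] using jn
      by (auto intro!: measurable_sum_nat measurable_compose[OF measurable_\<xi>])
    have p1: "prob {\<omega>\<in>space M. (a - h) * real n \<le> real (S1 \<omega>)} \<le> exp (- (l * h / 2) * real n)"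
    proof (rule order_trans)
      let ?f = "\<lambda>\<omega>. (\<Prod>i<j. f (\<xi> n i \<omega>)) * (\<Prod>i\<in>{1..0::nat}. (1::ennreal))"
      show "prob {\<omega>\<in>space M. (a - h) * real n \<le> real (S1 \<omega>)} \<le>
        exp (- (l * ((a - h) * real n))) * exp (j * (l * m + l\<^sup>2 * (real C)\<^sup>2))"
      proof (rule prob_le_nn_integral[of "\<lambda>\<omega>. ennreal (exp (- (l * ((a - h) * real n)))) * ?f \<omega>"])
        have mf: "?f \<in> borel_measurable M"
          using measurable_prod_factors[of j n 0 f "\<lambda>_. 1"] jn n0 by simp
        then show "(\<lambda>\<omega>. ennreal (exp (- (l * ((a - h) * real n)))) * ?f \<omega>) \<in> borel_measurable M" by measurable
        show "AE \<omega> in M. (a - h) * real n \<le> real (S1 \<omega>) \<longrightarrow> 1 \<le> ennreal (exp (- (l * ((a - h) * real n)))) * ?f \<omega>"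
        proof (rule AE_I2)
          fix \<omega>
          have "?f \<omega> = ennreal (exp (l * real (S1 \<omega>)))"
            unfolding f_def by (simp add: prod_exp_ennreal S1_def sum_distrib_left)
          then have "ennreal (exp (- (l * ((a - h) * real n)))) * ?f \<omega> =
              ennreal (exp (l * (real (S1 \<omega>) - (a - h) * real n)))"
            by (simp add: right_diff_distrib flip: ennreal_mult exp_add)
          then show "(a - h) * real n \<le> real (S1 \<omega>) \<longrightarrow> 1 \<le> ennreal (exp (- (l * ((a - h) * real n)))) * ?f \<omega>"
            using l by simp
        qed
        have "(\<integral>\<^sup>+\<omega>. ennreal (exp (- (l * ((a - h) * real n)))) * ?f \<omega> \<partial>M) =
            ennreal (exp (- (l * ((a - h) * real n)))) * (\<integral>\<^sup>+\<omega>. ?f \<omega> \<partial>M)"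
          using mf by (rule nn_integral_cmult)
        also have "(\<integral>\<^sup>+\<omega>. ?f \<omega> \<partial>M) = (\<integral>\<^sup>+k. f k \<partial>measure_pmf \<mu>) ^ j"
          using nn_integral_prod[OF elim(2) jn n0, of f "\<lambda>_. 1"] by simp
        also have "ennreal (exp (- (l * ((a - h) * real n)))) * \<dots> \<le> ennreal (exp (- (l * ((a - h) * real n)))) *
            ennreal (exp (l * m + l\<^sup>2 * (real C)\<^sup>2)) ^ j"
          unfolding f_def using truncated_mgf_le[OF m _ lC] l
          by (intro mult_left_mono power_mono) auto
        also have "\<dots> = ennreal (exp (- (l * ((a - h) * real n))) * exp (j * (l * m + l\<^sup>2 * (real C)\<^sup>2)))"
          by (simp add: ennreal_power exp_of_nat_mult ennreal_mult)
        finally show "(\<integral>\<^sup>+\<omega>. ennreal (exp (- (l * ((a - h) * real n)))) * ?f \<omega> \<partial>M) \<le>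
          ennreal (exp (- (l * ((a - h) * real n))) * exp (j * (l * m + l\<^sup>2 * (real C)\<^sup>2)))" .
      qed simp
      have "j * (l * m + l\<^sup>2 * (real C)\<^sup>2) \<le> (y * real n) * (l * m + l\<^sup>2 * (real C)\<^sup>2)"
        using j l m by (intro mult_right_mono) auto
      also have "\<dots> = real n * l * (m * y + y * (l * (real C)\<^sup>2))" by (simp add: algebra_simps power2_eq_square)
      also have "\<dots> \<le> real n * l * (m * y + h / 2)" using lh l by (intro mult_left_mono) auto
      finally have "- (l * ((a - h) * real n)) + j * (l * m + l\<^sup>2 * (real C)\<^sup>2) \<le>
          - (l * ((a - h) * real n)) + real n * l * (m * y + h / 2)" by simp
      also have "\<dots> = - (l * h / 2) * real n" by (simp add: h_def field_simps)
      finally show "exp (- (l * ((a - h) * real n))) * exp (j * (l * m + l\<^sup>2 * (real C)\<^sup>2)) \<le> exp (- (l * h / 2) * real n)"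
        unfolding exp_add[symmetric] by simp
    qed
    have p2: "prob {\<omega>\<in>space M. h * real n \<le> real (S2 \<omega>)} \<le> \<epsilon> / 2"
    proof (rule prob_le_nn_integral[of "\<lambda>\<omega>. ennreal (1 / (h * real n)) * of_nat (S2 \<omega>)"])
      have of_nat: "(\<lambda>\<omega>. of_nat (S2 \<omega>) :: ennreal) \<in> borel_measurable M"
        by (rule measurable_compose[OF m2]) simp
      then show "(\<lambda>\<omega>. ennreal (1 / (h * real n)) * of_nat (S2 \<omega>)) \<in> borel_measurable M" by measurable
      show "AE \<omega> in M. h * real n \<le> real (S2 \<omega>) \<longrightarrow> 1 \<le> ennreal (1 / (h * real n)) * of_nat (S2 \<omega>)"
        using h n0 by (intro AE_I2) (auto simp: ennreal_of_nat_eq_real_of_nat field_simps simp flip: ennreal_mult ennreal_1)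
      have xi: "(\<integral>\<^sup>+\<omega>. of_nat (\<xi> n i \<omega> - C) \<partial>M) = (\<integral>\<^sup>+k. of_nat (k - C) \<partial>measure_pmf \<mu>)" if "i < j" for i
      proof -
        have i: "i < n" using that jn by simp
        then have "(\<integral>\<^sup>+\<omega>. of_nat (\<xi> n i \<omega> - C) \<partial>M) = (\<integral>\<^sup>+k. of_nat (k - C) \<partial>distr M (count_space UNIV) (\<xi> n i))"
          by (intro nn_integral_distr[symmetric] measurable_\<xi>) auto
        then show ?thesis using \<xi>_law[OF elim(2) i] by simp
      qed
      have "(\<integral>\<^sup>+\<omega>. ennreal (1 / (h * real n)) * of_nat (S2 \<omega>) \<partial>M) = ennreal (1 / (h * real n)) * (\<integral>\<^sup>+\<omega>. of_nat (S2 \<omega>) \<partial>M)"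
        using of_nat by (rule nn_integral_cmult)
      also have "(\<integral>\<^sup>+\<omega>. of_nat (S2 \<omega>) \<partial>M) = (\<Sum>i<j. \<integral>\<^sup>+\<omega>. of_nat (\<xi> n i \<omega> - C) \<partial>M)"
        unfolding S2_def of_nat_sum using jn
        by (intro nn_integral_sum) (auto intro!: measurable_compose[OF measurable_\<xi>])
      also have "\<dots> = of_nat j * (\<integral>\<^sup>+k. of_nat (k - C) \<partial>measure_pmf \<mu>)" using xi by simp
      also have "\<dots> \<le> ennreal (y * real n) * ennreal (\<epsilon> * h / (2 * y))"
        using C j by (intro mult_mono) (auto simp: ennreal_of_nat_eq_real_of_nat intro: ennreal_leI less_imp_le)
      also have "ennreal (1 / (h * real n)) * \<dots> = ennreal (1 / (h * real n) * (y * real n * (\<epsilon> * h / (2 * y))))"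
      proof -
        have "ennreal (y * real n) * ennreal (\<epsilon> * h / (2 * y)) = ennreal (y * real n * (\<epsilon> * h / (2 * y)))"
          using h y \<epsilon> by (intro ennreal_mult[symmetric]) auto
        moreover have "ennreal (1 / (h * real n)) * ennreal (y * real n * (\<epsilon> * h / (2 * y))) =
            ennreal (1 / (h * real n) * (y * real n * (\<epsilon> * h / (2 * y))))"
          using h y \<epsilon> by (intro ennreal_mult[symmetric]) auto
        ultimately show ?thesis by (simp only:)
      qed
      also have "1 / (h * real n) * (y * real n * (\<epsilon> * h / (2 * y))) = \<epsilon> / 2"
        using h n0 y by (simp add: field_simps)
      finally show "(\<integral>\<^sup>+\<omega>. ennreal (1 / (h * real n)) * of_nat (S2 \<omega>) \<partial>M) \<le> ennreal (\<epsilon> / 2)"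
        by (simp add: mult_left_mono)
    qed (use \<epsilon> in simp)
    have "prob {\<omega>\<in>space M. a * real n \<le> real (S n j \<omega>)} \<le>
        prob ({\<omega>\<in>space M. (a - h) * real n \<le> real (S1 \<omega>)} \<union> {\<omega>\<in>space M. h * real n \<le> real (S2 \<omega>)})"
    proof (rule finite_measure_mono)
      show "{\<omega>\<in>space M. a * real n \<le> real (S n j \<omega>)} \<subseteq>
        {\<omega>\<in>space M. (a - h) * real n \<le> real (S1 \<omega>)} \<union> {\<omega>\<in>space M. h * real n \<le> real (S2 \<omega>)}"
        by (auto simp: S_split algebra_simps)
      show "{\<omega>\<in>space M. (a - h) * real n \<le> real (S1 \<omega>)} \<union> {\<omega>\<in>space M. h * real n \<le> real (S2 \<omega>)} \<in> events"
        using m1 m2 by measurable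
    qed
    also have "\<dots> \<le> prob {\<omega>\<in>space M. (a - h) * real n \<le> real (S1 \<omega>)} + prob {\<omega>\<in>space M. h * real n \<le> real (S2 \<omega>)}"
      using m1 m2 by (intro measure_Un_le; measurable)
    also have "\<dots> < \<epsilon>" using p1 p2 elim(1) by linarith
    finally show ?case by (simp add: j_def)
  qed
qed (intro always_eventually allI, erule less_le_trans, simp)

text \<open>The cutoff \<open>A\<close> is chosen first, from the geometric tail alone, and
  \<open>n\<close> is sent to infinity afterwards; uniformity of the tail in \<open>n\<close>
  permits this order. The union bound separates crossings at steps from \<open>A\<close> on and the
  event that one of the first \<open>A\<close> waiting times exceeds 1.\<close>

lemma tendsto_X_small_survival:
  assumes y: "0 < y" "y < 1" and m': "ennreal m' < pmf_mean \<mu>" "0 < m' * y + ln (1 - y)"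
  shows "(\<lambda>n. prob {\<omega>\<in>space M. gw_survives (K \<omega>) \<and> real (X n \<omega>) \<le> y * real n}) \<longlonglongrightarrow> 0"
proof (rule order_tendstoI)
  fix \<epsilon> :: real assume \<epsilon>: "0 < \<epsilon>"
  obtain B \<rho> where B: "0 \<le> B" "0 < \<rho>" "\<rho> < 1" and tail: "\<And>n j. 1 \<le> n \<Longrightarrow> real j \<le> y * real n \<Longrightarrow>
      prob {\<omega>\<in>space M. S n j \<omega> < T n j \<omega>} \<le> B * \<rho> ^ j"
    using lower_tail[OF y m'] by blast
  have "(\<lambda>A. B * (\<rho> ^ A / (1 - \<rho>))) \<longlonglongrightarrow> B * (0 / (1 - \<rho>))"
    using B by (intro tendsto_intros LIMSEQ_power_zero) auto
  then have "eventually (\<lambda>A. B * (\<rho> ^ A / (1 - \<rho>)) < \<epsilon> / 2) sequentially"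
    using \<epsilon> by (intro order_tendstoD(2)) auto
  then obtain A where A: "B * (\<rho> ^ A / (1 - \<rho>)) < \<epsilon> / 2" by (auto simp: eventually_sequentially)
  have "eventually (\<lambda>n. prob {\<omega>\<in>space M. T n A \<omega> \<noteq> A} < \<epsilon> / 2) sequentially"
    using \<epsilon> no_failure by (intro order_tendstoD(2)) auto
  then show "eventually (\<lambda>n. prob {\<omega>\<in>space M. gw_survives (K \<omega>) \<and> real (X n \<omega>) \<le> y * real n} < \<epsilon>) sequentially"
    using eventually_gt_at_top[of A]
  proof eventually_elim
    case (elim n)
    have n: "1 \<le> n" using elim by simp
    define J where "J = nat \<lfloor>y * real n\<rfloor>"
    have J: "real J \<le> y * real n" using y unfolding J_def by (intro of_nat_floor) auto
    have Jn: "J < n"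
    proof -
      have "y * real n < real n" using y n by simp
      then show ?thesis using J by linarith
    qed
    let ?F = "{\<omega>\<in>space M. T n A \<omega> \<noteq> A}" and ?G = "\<lambda>i. {\<omega>\<in>space M. S n i \<omega> < T n i \<omega>}"
    have F: "?F \<in> events" using measurable_T[OF elim(2)] by measurable
    have G: "?G i \<in> events" if "i \<in> {A..J}" for i
    proof -
      have [measurable]: "S n i \<in> measurable M (count_space UNIV)" "T n i \<in> measurable M (count_space UNIV)"
        using that Jn by (auto intro!: measurable_S measurable_T)
      have "{\<omega>\<in>space M. real (S n i \<omega>) < real (T n i \<omega>)} \<in> events" by measurable
      then show ?thesis by simp
    qed
    have "{\<omega>\<in>space M. gw_survives (K \<omega>) \<and> real (X n \<omega>) \<le> y * real n} \<subseteq> ?F \<union> (\<Union>i\<in>{A..J}. ?G i)"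
    proof
      fix \<omega> assume "\<omega> \<in> {\<omega>\<in>space M. gw_survives (K \<omega>) \<and> real (X n \<omega>) \<le> y * real n}"
      then have \<omega>: "\<omega> \<in> space M" "gw_survives (K \<omega>)" "real (X n \<omega>) \<le> y * real n" by auto
      from \<omega>(3) have "X n \<omega> \<le> J" unfolding J_def by (simp add: le_nat_floor)
      then obtain i where i: "i \<in> {1..J}" "S n i \<omega> < T n i \<omega>"
        using S_less_T_if_stopped[OF _ Jn] by blast
      show "\<omega> \<in> ?F \<union> (\<Union>i\<in>{A..J}. ?G i)"
      proof (cases "A \<le> i")
        case True
        then show ?thesis using i \<omega> by auto
      next
        case False
        \<comment> \<open>Going on past step \<open>i\<close> would require the clock to be at most
          the walk there.\<close>
        have "X n \<omega> \<le> i" using T_le_S_if_continued[of i n \<omega>] i by (cases "i < X n \<omega>") auto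
        then have "X n \<omega> \<le> A" using False by simp
        then have "T n A \<omega> \<noteq> A"
          using tree_explored(1)[of n A \<omega>] elim(2) \<omega>(2) by (auto simp: gw_survives_iff_infinite)
        then show ?thesis using \<omega> by auto
      qed
    qed
    then have "prob {\<omega>\<in>space M. gw_survives (K \<omega>) \<and> real (X n \<omega>) \<le> y * real n} \<le> prob (?F \<union> (\<Union>i\<in>{A..J}. ?G i))"
      using F G by (intro finite_measure_mono sets.Un sets.finite_UN) auto
    also have "\<dots> \<le> prob ?F + prob (\<Union>i\<in>{A..J}. ?G i)"
      using F G by (intro measure_Un_le sets.finite_UN) auto
    also have "prob (\<Union>i\<in>{A..J}. ?G i) \<le> (\<Sum>i\<in>{A..J}. prob (?G i))"
      using G by (intro finite_measure_subadditive_finite) auto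
    also have "\<dots> \<le> (\<Sum>i\<in>{A..J}. B * \<rho> ^ i)"
      using J n by (intro sum_mono tail) auto
    also have "\<dots> \<le> B * (\<rho> ^ A / (1 - \<rho>))"
      unfolding sum_distrib_left[symmetric] using B
      by (intro mult_left_mono) (auto simp: sum_gp divide_right_mono)
    finally show ?case using A elim(1) by linarith
  qed
qed (intro always_eventually allI, erule less_le_trans, simp)

text \<open>A level \<open>a\<close> strictly between \<open>m * y\<close> and
  \<open>- ln (1 - y)\<close> separates walk and clock at the step \<open>y * n\<close> rounded
  down, whereas going past that step requires the clock to be at most the walk.\<close>

lemma tendsto_X_large:
  assumes m: "pmf_mean \<mu> = ennreal m" "0 \<le> m" and y: "0 < y" "y < 1" "m * y + ln (1 - y) < 0"
  shows "(\<lambda>n. prob {\<omega>\<in>space M. y * real n < real (X n \<omega>)}) \<longlonglongrightarrow> 0"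
proof -
  define a where "a = (m * y - ln (1 - y)) / 2"
  have a: "m * y < a" "a < - ln (1 - y)" using y by (simp_all add: a_def)
  let ?J = "\<lambda>n. nat \<lfloor>y * real n\<rfloor>"
  let ?F = "\<lambda>n. {\<omega>\<in>space M. real (T n (?J n) \<omega>) \<le> a * real n}"
  let ?G = "\<lambda>n. {\<omega>\<in>space M. a * real n \<le> real (S n (?J n) \<omega>)}"
  have lim: "(\<lambda>n. prob (?F n) + prob (?G n)) \<longlonglongrightarrow> 0 + 0"
    using tendsto_T_small[OF y(1,2) a(2)] tendsto_S_large[OF m y(1) _ a(1)] y
    by (intro tendsto_add) auto
  have "eventually (\<lambda>n. prob {\<omega>\<in>space M. y * real n < real (X n \<omega>)} \<le> prob (?F n) + prob (?G n)) sequentially"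
    \<comment> \<open>Such \<open>n\<close> make the rounded step at least 1, as
      \<open>T_le_S_if_continued\<close> demands.\<close>
    using eventually_ge_at_top[of "nat \<lceil>1 / y\<rceil>"]
  proof eventually_elim
    case (elim n)
    have "1 / y \<le> real n" using elim by linarith
    then have yn: "1 \<le> y * real n" using y by (simp add: field_simps)
    then have J: "real (?J n) \<le> y * real n" "1 \<le> ?J n" "0 < n"
      by (auto intro: of_nat_floor simp: le_nat_floor) (use y in \<open>auto intro: Nat.gr0I\<close>)
    have Jn: "?J n < n"
    proof -
      have "y * real n < real n" using y J by simp
      then show ?thesis using J by linarith
    qed
    have FG: "?F n \<in> events" "?G n \<in> events"
    proof -
      have [measurable]: "S n (?J n) \<in> measurable M (count_space UNIV)" "T n (?J n) \<in> measurable M (count_space UNIV)"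
        using Jn by (auto intro!: measurable_S measurable_T)
      show "?F n \<in> events" "?G n \<in> events" by measurable
    qed
    have "{\<omega>\<in>space M. y * real n < real (X n \<omega>)} \<subseteq> ?F n \<union> ?G n"
    proof
      fix \<omega> assume \<omega>: "\<omega> \<in> {\<omega>\<in>space M. y * real n < real (X n \<omega>)}"
      then have "?J n < X n \<omega>" using J by simp
      then have "T n (?J n) \<omega> \<le> S n (?J n) \<omega>" using T_le_S_if_continued J by blast
      then show "\<omega> \<in> ?F n \<union> ?G n" using \<omega> by auto
    qed
    then have "prob {\<omega>\<in>space M. y * real n < real (X n \<omega>)} \<le> prob (?F n \<union> ?G n)"
      using FG by (intro finite_measure_mono) auto
    also have "\<dots> \<le> prob (?F n) + prob (?G n)" using FG by (intro measure_Un_le) auto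
    finally show ?case .
  qed
  note upper = this
  show ?thesis
  proof (rule tendsto_sandwich[OF _ upper tendsto_const])
    show "(\<lambda>n. prob (?F n) + prob (?G n)) \<longlonglongrightarrow> 0" using lim by simp
  qed simp
qed

end

section \<open>Walks of nonpositive drift\<close>

text \<open>With steps \<open>a - 1\<close> this follows the number of pending words in an
  exploration without failures, started from \<open>x\<close> of them; it has to be positive up to
  the end of the list. Positivity of \<open>x\<close> makes \<open>x - 1 + a\<close> the true next
  position.\<close>

primrec walk_alive :: "nat \<Rightarrow> nat list \<Rightarrow> bool" where
  "walk_alive x [] \<longleftrightarrow> 0 < x"
| "walk_alive x (a # as) \<longleftrightarrow> 0 < x \<and> walk_alive (x - 1 + a) as"

lemma walk_alive_if_sum_list:
  assumes "\<And>i. i \<le> length as \<Longrightarrow> i < x + sum_list (take i as)"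
  shows "walk_alive x as"
  using assms
proof (induction as arbitrary: x)
  case Nil
  from Nil[of 0] show ?case by simp
next
  case (Cons a as)
  have x: "0 < x" using Cons.prems[of 0] by simp
  have "i < (x - 1 + a) + sum_list (take i as)" if "i \<le> length as" for i
    using Cons.prems[of "Suc i"] that x by simp
  with x show ?case using Cons.IH by simp
qed

definition walk_prob :: "nat pmf \<Rightarrow> nat \<Rightarrow> nat \<Rightarrow> real" where
  "walk_prob \<mu> t x = measure_pmf.prob (replicate_pmf t \<mu>) {as. walk_alive x as}"

lemma replicate_pmf_Suc_map:
  "replicate_pmf (Suc t) \<mu> = bind_pmf \<mu> (\<lambda>a. map_pmf ((#) a) (replicate_pmf t \<mu>))"
  by (simp add: map_pmf_def)

lemma pmf_replicate_pmf:
  fixes \<mu> :: "nat pmf"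
  shows "pmf (replicate_pmf (length as) \<mu>) as = (\<Prod>i<length as. pmf \<mu> (as ! i))"
proof (induction as)
  case (Cons a as)
  have "replicate_pmf (length (a # as)) \<mu> =
      map_pmf (\<lambda>z. fst z # snd z) (pair_pmf \<mu> (replicate_pmf (length as) \<mu>))"
    by (simp add: pair_pmf_def map_bind_pmf)
  moreover have "inj (\<lambda>z::nat \<times> nat list. fst z # snd z)" by (auto simp: inj_on_def)
  then have "pmf (map_pmf (\<lambda>z. fst z # snd z) (pair_pmf \<mu> (replicate_pmf (length as) \<mu>))) (a # as) =
      pmf (pair_pmf \<mu> (replicate_pmf (length as) \<mu>)) (a, as)"
    using pmf_map_inj'[of "\<lambda>z. fst z # snd z" "pair_pmf \<mu> (replicate_pmf (length as) \<mu>)" "(a, as)"]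
    by simp
  ultimately have "pmf (replicate_pmf (length (a # as)) \<mu>) (a # as) =
      pmf \<mu> a * pmf (replicate_pmf (length as) \<mu>) as"
    by (simp add: pmf_pair)
  moreover have "(\<Prod>i<length (a # as). pmf \<mu> ((a # as) ! i)) = pmf \<mu> a * (\<Prod>i<length as. pmf \<mu> (as ! i))"
    by (simp add: prod.lessThan_Suc_shift del: prod.lessThan_Suc)
  ultimately show ?case unfolding Cons.IH by metis
qed simp

lemma walk_prob_0: "walk_prob \<mu> t 0 = 0"
proof -
  have "\<not> walk_alive 0 as" for as by (cases as) auto
  then show ?thesis by (simp add: walk_prob_def)
qed

lemma walk_prob_bounds: "0 \<le> walk_prob \<mu> t x" "walk_prob \<mu> t x \<le> 1"
  by (simp_all add: walk_prob_def)

lemma integrable_walk_prob: "integrable (measure_pmf \<mu>) (\<lambda>a. walk_prob \<mu> t (f a))"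
  by (intro measure_pmf.integrable_const_bound[where B = 1]) (auto simp: walk_prob_bounds)

text \<open>First-step analysis; for large \<open>t\<close> it becomes the harmonicity required by
  \<open>bounded_harmonic_eq_0\<close>.\<close>

lemma walk_prob_Suc:
  assumes "0 < x"
  shows "walk_prob \<mu> (Suc t) x = measure_pmf.expectation \<mu> (\<lambda>a. walk_prob \<mu> t (x - 1 + a))"
proof -
  have "(#) a -` {as. walk_alive x as} = {as. walk_alive (x - 1 + a) as}" for a
    using assms by auto
  then have "ennreal (walk_prob \<mu> (Suc t) x) = (\<integral>\<^sup>+a. ennreal (walk_prob \<mu> t (x - 1 + a)) \<partial>measure_pmf \<mu>)"
    unfolding walk_prob_def measure_pmf.emeasure_eq_measure[symmetric] replicate_pmf_Suc_map emeasure_bind_pmf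
    by simp
  also have "\<dots> = ennreal (measure_pmf.expectation \<mu> (\<lambda>a. walk_prob \<mu> t (x - 1 + a)))"
    by (intro nn_integral_eq_integral integrable_walk_prob) (simp add: walk_prob_bounds)
  finally show ?thesis by (simp add: walk_prob_bounds integral_nonneg_AE)
qed

lemma walk_prob_antimono: "walk_prob \<mu> (Suc t) x \<le> walk_prob \<mu> t x"
proof (induction t arbitrary: x)
  case 0
  show ?case
  proof (cases "x = 0")
    case False
    then have "walk_prob \<mu> 0 x = 1" by (simp add: walk_prob_def)
    then show ?thesis using walk_prob_bounds(2) by simp
  qed (simp add: walk_prob_0)
next
  case (Suc t)
  show ?case
  proof (cases "x = 0")
    case False
    then show ?thesis
      unfolding walk_prob_Suc[of x \<mu> t, simplified] walk_prob_Suc[of x \<mu> "Suc t", simplified]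
      by (subst walk_prob_Suc, simp, subst (2) walk_prob_Suc, simp)
        (intro integral_mono integrable_walk_prob Suc)
  qed (simp add: walk_prob_0)
qed

text \<open>\<open>H x - e * x\<close> is subharmonic because the mean is at most 1, so it cannot attain a positive
  maximum.\<close>

lemma bounded_harmonic_eq_0:
  fixes H :: "nat \<Rightarrow> real"
  assumes bounds: "\<And>x. 0 \<le> H x" "\<And>x. H x \<le> 1" and H0: "H 0 = 0"
    and harmonic: "\<And>x. 0 < x \<Longrightarrow> H x = measure_pmf.expectation \<mu> (\<lambda>a. H (x - 1 + a))"
    and mean: "pmf_mean \<mu> \<le> 1" and pos: "0 < pmf \<mu> 0"
  shows "H y = 0"
proof (rule ccontr)
  assume "H y \<noteq> 0"
  with bounds(1)[of y] have Hy: "0 < H y" by simp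
  with H0 have y: "0 < y" by (cases y) auto
  \<comment> \<open>Half the slope of the line from the origin to the value at \<open>y\<close>, so
    that \<open>u y = H y / 2\<close> is positive.\<close>
  define e where "e = H y / (2 * real y)"
  define u where "u x = H x - e * real x" for x
  have e: "0 < e" using Hy y by (simp add: e_def)
  have uy: "0 < u y" using Hy y by (simp add: u_def e_def)
  \<comment> \<open>Beyond \<open>B\<close> the linear term outweighs the bound 1 of
    \<open>H\<close>, so a maximum over a finite range is global.\<close>
  define B where "B = nat \<lceil>1 / e\<rceil>"
  have out: "u x \<le> 0" if "B < x" for x
  proof -
    have "1 / e \<le> real B" unfolding B_def by (rule real_nat_ceiling_ge)
    also have "real B \<le> real x" using that by simp
    finally have "1 \<le> e * real x" using e by (simp add: field_simps)
    then show ?thesis using bounds(2)[of x] by (simp add: u_def)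
  qed
  define M0 where "M0 = Max (u ` {..B})"
  have le: "u x \<le> M0" if "x \<le> B" for x unfolding M0_def using that by (intro Max_ge) auto
  have yB: "y \<le> B" using out[of y] uy by (meson not_le)
  have M0: "0 < M0" using le[OF yB] uy by simp
  have le': "u x \<le> M0" for x using le[of x] out[of x] M0 by (cases "x \<le> B") auto
  \<comment> \<open>At the leftmost maximum the left neighbour is strictly lower, and a step down
    has positive probability. The mean of \<open>u\<close> after one step is then strictly below
    \<open>M0\<close>, against subharmonicity.\<close>
  define z where "z = (LEAST x. u x = M0)"
  have "M0 \<in> u ` {..B}" unfolding M0_def by (intro Max_in) auto
  then have "\<exists>x. u x = M0" by blast
  then have uz: "u z = M0" unfolding z_def by (rule LeastI_ex)
  have z: "0 < z" using uz M0 H0 by (cases z) (auto simp: u_def)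
  have "u (z - 1) \<noteq> M0" using not_less_Least[of "z - 1" "\<lambda>x. u x = M0"] z by (simp add: z_def)
  with le'[of "z - 1"] have strict: "u (z - 1) < M0" by simp
  have int_H: "integrable (measure_pmf \<mu>) (\<lambda>a. H (z - 1 + a))"
    using bounds by (intro measure_pmf.integrable_const_bound[where B = 1]) auto
  have nn: "(\<integral>\<^sup>+a. ennreal (real a) \<partial>measure_pmf \<mu>) \<le> 1"
    using mean by (simp add: pmf_mean_def ennreal_of_nat_eq_real_of_nat)
  then have int_a: "integrable (measure_pmf \<mu>) real"
    by (intro integrableI_bounded) (auto intro: le_less_trans)
  have "ennreal (measure_pmf.expectation \<mu> real) \<le> 1"
    using nn nn_integral_eq_integral[OF int_a] by simp
  then have mean': "measure_pmf.expectation \<mu> real \<le> 1" by (simp add: ennreal_le_1)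
  have eq: "measure_pmf.expectation \<mu> (\<lambda>a. u (z - 1 + a)) =
      H z - e * (real (z - 1) + measure_pmf.expectation \<mu> real)"
    using harmonic[OF z] int_H int_a by (simp add: u_def algebra_simps)
  have "e * (real (z - 1) + measure_pmf.expectation \<mu> real) \<le> e * real z"
    using mean' z e by (intro mult_left_mono) auto
  then have ge: "M0 \<le> measure_pmf.expectation \<mu> (\<lambda>a. u (z - 1 + a))"
    unfolding eq uz[symmetric] by (simp add: u_def)
  have int_u: "integrable (measure_pmf \<mu>) (\<lambda>a. u (z - 1 + a))"
    using int_H int_a by (simp add: u_def algebra_simps)
  have "(M0 - u (z - 1)) * pmf \<mu> 0 = measure_pmf.expectation \<mu> (\<lambda>a. (M0 - u (z - 1)) * indicator {0} a)"
    by (simp add: measure_pmf_single)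
  also have "\<dots> \<le> measure_pmf.expectation \<mu> (\<lambda>a. M0 - u (z - 1 + a))"
  proof (rule integral_mono)
    show "integrable (measure_pmf \<mu>) (\<lambda>a. (M0 - u (z - 1)) * indicator {0} a)"
      by (intro integrable_mult_right measure_pmf.integrable_const_bound[where B = 1])
        (auto simp: indicator_def)
  qed (use int_u le' in \<open>auto simp: indicator_def\<close>)
  also have "\<dots> = M0 - measure_pmf.expectation \<mu> (\<lambda>a. u (z - 1 + a))" using int_u by simp
  finally have "(M0 - u (z - 1)) * pmf \<mu> 0 \<le> 0" using ge by linarith
  with strict pos show False by (simp add: mult_le_0_iff)
qed

text \<open>An integer variable that is at least 1 and has mean at most 1 is constantly 1, which the
  second assumption excludes.\<close>

lemma pmf_0_pos:
  assumes mean: "pmf_mean \<mu> \<le> 1" and "pmf \<mu> 1 < 1"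
  shows "0 < pmf \<mu> 0"
proof (rule ccontr)
  assume "\<not> 0 < pmf \<mu> 0"
  then have p0: "pmf \<mu> 0 = 0" using pmf_nonneg[of \<mu> 0] by linarith
  have nn: "(\<integral>\<^sup>+a. ennreal (real a) \<partial>measure_pmf \<mu>) \<le> 1"
    using mean by (simp add: pmf_mean_def ennreal_of_nat_eq_real_of_nat)
  then have int_a: "integrable (measure_pmf \<mu>) real"
    by (intro integrableI_bounded) (auto intro: le_less_trans)
  have "ennreal (measure_pmf.expectation \<mu> real) \<le> 1"
    using nn nn_integral_eq_integral[OF int_a] by simp
  then have mean': "measure_pmf.expectation \<mu> real \<le> 1" by (simp add: ennreal_le_1)
  have pos: "AE a in measure_pmf \<mu>. 0 \<le> real a - 1"
    unfolding AE_measure_pmf_iff using p0 by (metis One_nat_def Suc_leI diff_ge_0_iff_ge neq0_conv of_nat_1 of_nat_le_iff set_pmf_iff)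
  have "measure_pmf.expectation \<mu> (\<lambda>a. real a - 1) = measure_pmf.expectation \<mu> real - 1"
    using int_a by simp
  with mean' integral_nonneg_AE[OF pos] have "measure_pmf.expectation \<mu> (\<lambda>a. real a - 1) = 0" by linarith
  then have "AE a in measure_pmf \<mu>. real a - 1 = 0"
    using int_a pos by (subst (asm) integral_nonneg_eq_0_iff_AE) auto
  then have "AE a in measure_pmf \<mu>. a \<in> {1}" by eventually_elim simp
  then have "measure_pmf.prob \<mu> {1} = 1" by (subst measure_pmf.prob_eq_1) auto
  with assms(2) show False by (simp add: measure_pmf_single)
qed

text \<open>The probabilities decrease in \<open>t\<close>; their limit vanishes at 0 and inherits
  the first-step equation by dominated convergence.\<close>

lemma walk_prob_tendsto_0:
  assumes mean: "pmf_mean \<mu> \<le> 1" and "pmf \<mu> 1 < 1"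
  shows "(\<lambda>t. walk_prob \<mu> t x) \<longlonglongrightarrow> 0"
proof -
  have "\<exists>L. (\<lambda>t. walk_prob \<mu> t x) \<longlonglongrightarrow> L" for x
    using decseq_convergent[of "\<lambda>t. walk_prob \<mu> t x" 0] walk_prob_antimono walk_prob_bounds
    by (metis decseq_SucI)
  then obtain H where H: "\<And>x. (\<lambda>t. walk_prob \<mu> t x) \<longlonglongrightarrow> H x" by metis
  have "H x = 0" for x
  proof (rule bounded_harmonic_eq_0[of H \<mu>])
    show "0 \<le> H x" "H x \<le> 1" for x
      using H[of x] walk_prob_bounds by (auto intro: LIMSEQ_le_const LIMSEQ_le_const2)
    show "H 0 = 0" using LIMSEQ_unique[OF H[of 0], of 0] by (simp add: walk_prob_0)
    show "H x = measure_pmf.expectation \<mu> (\<lambda>a. H (x - 1 + a))" if "0 < x" for x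
    proof (rule LIMSEQ_unique)
      show "(\<lambda>t. walk_prob \<mu> (Suc t) x) \<longlonglongrightarrow> H x" using H by (rule LIMSEQ_Suc)
      show "(\<lambda>t. walk_prob \<mu> (Suc t) x) \<longlonglongrightarrow> measure_pmf.expectation \<mu> (\<lambda>a. H (x - 1 + a))"
        unfolding walk_prob_Suc[OF that] using H
        by (intro integral_dominated_convergence[where w = "\<lambda>_. 1"]) (auto simp: walk_prob_bounds)
    qed
  qed (use mean pmf_0_pos[OF assms] in auto)
  with H[of x] show ?thesis by simp
qed

section \<open>Survival and total progeny\<close>

context gw_coupon
begin

lemma prob_mono_AE:
  assumes "AE \<omega> in M. Q \<omega> \<longrightarrow> R \<omega>" "{\<omega>\<in>space M. R \<omega>} \<in> events"
  shows "prob {\<omega>\<in>space M. Q \<omega>} \<le> prob {\<omega>\<in>space M. R \<omega>}"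
  using assms emeasure_mono_AE[of "{\<omega>\<in>space M. Q \<omega>}" "{\<omega>\<in>space M. R \<omega>}" M]
  by (auto simp: emeasure_eq_measure)

text \<open>Transfers statements on the first \<open>A\<close> numbers read to i.i.d. lists free of
  \<open>n\<close>, so that the bound in \<open>prob_survival_subcritical\<close> is unaffected by
  the limit in \<open>n\<close>.\<close>

lemma prob_offspring_list:
  assumes "A \<le> n" "1 \<le> n"
  shows "prob {\<omega>\<in>space M. P (map (\<lambda>i. \<xi> n i \<omega>) [0..<A])} = measure_pmf.prob (replicate_pmf A \<mu>) {as. P as}"
proof -
  define L where "L \<omega> = map (\<lambda>i. \<xi> n i \<omega>) [0..<A]" for \<omega>
  have rv: "\<xi> n i \<in> measurable M (count_space UNIV)" if "i < A" for i
    using that assms by (intro measurable_\<xi>) auto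
  have [simp]: "length (L \<omega>) = A" "i < A \<Longrightarrow> L \<omega> ! i = \<xi> n i \<omega>" for i \<omega>
    by (simp_all add: L_def)
  have iff: "L \<omega> = as \<longleftrightarrow> length as = A \<and> (\<forall>i<A. \<xi> n i \<omega> = as ! i)" for \<omega> as
    by (auto simp: list_eq_iff_nth_eq)
  have meas: "L \<in> measurable M (count_space UNIV)"
    unfolding measurable_count_space_eq2_countable
  proof (intro conjI ballI)
    fix as :: "nat list"
    have "L -` {as} \<inter> space M = {\<omega>\<in>space M. length as = A \<and> (\<forall>i<A. \<xi> n i \<omega> = as ! i)}"
      by (auto simp: iff)
    also have "\<dots> \<in> events"
    proof -
      have "{\<omega>\<in>space M. \<xi> n i \<omega> = as ! i} \<in> events" if "i < A" for i
        using rv[OF that] by measurable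
      then have "{\<omega>\<in>space M. \<forall>i\<in>{..<A}. \<xi> n i \<omega> = as ! i} \<in> events"
        by (intro sets.sets_Collect_finite_All) auto
      then have all: "{\<omega>\<in>space M. \<forall>i<A. \<xi> n i \<omega> = as ! i} \<in> events"
        unfolding Ball_def lessThan_iff .
      show ?thesis
      proof (cases "length as = A")
        case True
        with all show ?thesis by (simp only: simp_thms)
      next
        case False
        then have "{\<omega>\<in>space M. length as = A \<and> (\<forall>i<A. \<xi> n i \<omega> = as ! i)} = {}" by blast
        then show ?thesis by (simp only: sets.empty_sets)
      qed
    qed
    finally show "L -` {as} \<inter> space M \<in> events" .
  qed simp
  have "distr M (count_space UNIV) L = measure_pmf (replicate_pmf A \<mu>)"
  proof (rule measure_eqI_countable[where A = UNIV])
    fix as :: "nat list"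
    have "emeasure (distr M (count_space UNIV) L) {as} = ennreal (prob (L -` {as} \<inter> space M))"
      by (simp add: emeasure_distr[OF meas] emeasure_eq_measure)
    also have "prob (L -` {as} \<inter> space M) = pmf (replicate_pmf A \<mu>) as"
    proof (cases "length as = A")
      case False
      then have "L -` {as} \<inter> space M = {}" by (auto simp: iff)
      moreover have "as \<notin> set_pmf (replicate_pmf A \<mu>)" using False by (simp add: set_replicate_pmf)
      ultimately show ?thesis by (simp add: set_pmf_iff)
    next
      case True
      show ?thesis
      proof (cases "A = 0")
        case True
        then have "L \<omega> = []" for \<omega> by (simp add: L_def)
        then have "L -` {as} \<inter> space M = space M" using \<open>length as = A\<close> True by auto
        then show ?thesis using \<open>length as = A\<close> True by (simp add: prob_space)
      next
        case False
        let ?Z = "\<lambda>z \<omega>. case z of Inl j \<Rightarrow> \<xi> n j \<omega> | Inr i \<Rightarrow> \<Delta> n \<omega> i"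
        let ?c = "\<lambda>z. case z of Inl i \<Rightarrow> {as ! i} | Inr _ \<Rightarrow> {}"
        have "L -` {as} \<inter> space M = (\<Inter>z\<in>Inl ` {..<A}. ?Z z -` ?c z \<inter> space M)"
          using \<open>length as = A\<close> False by (auto simp: iff)
        also have "prob \<dots> = (\<Prod>z\<in>Inl ` {..<A}. prob (?Z z -` ?c z \<inter> space M))"
          using False assms by (intro indep_varsD[OF indep_\<xi>_\<Delta>[of n]]) auto
        also have "\<dots> = (\<Prod>i<A. prob (\<xi> n i -` {as ! i} \<inter> space M))"
          by (simp add: prod.reindex vimage_def)
        also have "\<dots> = (\<Prod>i<A. pmf \<mu> (as ! i))"
        proof (rule prod.cong[OF refl])
          fix i assume "i \<in> {..<A}"
          then have i: "i < A" "i < n" using assms by auto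
          have "prob (\<xi> n i -` {as ! i} \<inter> space M) = measure (distr M (count_space UNIV) (\<xi> n i)) {as ! i}"
            using rv[OF i(1)] by (simp add: measure_distr)
          then show "prob (\<xi> n i -` {as ! i} \<inter> space M) = pmf \<mu> (as ! i)"
            by (simp add: \<xi>_law[OF assms(2) i(2)] measure_pmf_single)
        qed
        also have "\<dots> = pmf (replicate_pmf A \<mu>) as"
          using pmf_replicate_pmf[of as \<mu>] \<open>length as = A\<close> by simp
        finally show ?thesis .
      qed
    qed
    finally show "emeasure (distr M (count_space UNIV) L) {as} = emeasure (measure_pmf (replicate_pmf A \<mu>)) {as}"
      by (simp add: emeasure_pmf_single)
  qed auto
  then have "measure_pmf.prob (replicate_pmf A \<mu>) {as. P as} = measure (distr M (count_space UNIV) L) {as. P as}"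
    by simp
  also have "\<dots> = prob {\<omega>\<in>space M. P (L \<omega>)}"
    by (simp add: measure_distr[OF meas] vimage_def Int_def conj_commute)
  finally show ?thesis by (simp add: L_def)
qed

lemma survival_event: "{\<omega>\<in>space M. gw_survives (K \<omega>)} \<in> events"
  using pred_gw_survives[of K M, OF measurable_K] by (simp add: pred_def)

lemma event_failure: "j < n \<Longrightarrow> {\<omega>\<in>space M. T n j \<omega> \<noteq> j} \<in> events"
  using measurable_T[of j n] by measurable

text \<open>On survival with the first \<open>A\<close> waiting times equal to 1 the exploration
  goes past step \<open>A\<close>, so \<open>i \<le> T n i \<omega> \<le> S n i \<omega>\<close> for
  \<open>1 \<le> i \<le> A\<close> and the walk from 1 stays positive for \<open>A\<close> steps.
  Sending \<open>n\<close> to infinity removes the failures; then \<open>A\<close> goes to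
  infinity.\<close>

lemma prob_survival_subcritical:
  assumes "pmf_mean \<mu> \<le> 1" "pmf \<mu> 1 < 1"
  shows "prob {\<omega>\<in>space M. gw_survives (K \<omega>)} = 0"
proof -
  let ?s = "prob {\<omega>\<in>space M. gw_survives (K \<omega>)}"
  have "?s \<le> walk_prob \<mu> A 1" for A
  proof -
    have "eventually (\<lambda>n. ?s \<le> prob {\<omega>\<in>space M. T n A \<omega> \<noteq> A} + walk_prob \<mu> A 1) sequentially"
      using eventually_gt_at_top[of A]
    proof eventually_elim
      case (elim n)
      let ?L = "\<lambda>\<omega>. map (\<lambda>i. \<xi> n i \<omega>) [0..<A]"
      have alive: "walk_alive 1 (?L \<omega>)" if "gw_survives (K \<omega>)" "T n A \<omega> = A" for \<omega>
      proof (rule walk_alive_if_sum_list)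
        fix i assume "i \<le> length (?L \<omega>)"
        then have i: "i \<le> A" by simp
        then have "sum_list (take i (?L \<omega>)) = S n i \<omega>"
          by (simp add: take_map sum_list_distinct_conv_sum_set S_def atLeast0LessThan)
        moreover have "i \<le> S n i \<omega>"
        proof (cases "i = 0")
          case False
          have "A < X n \<omega>"
            using tree_explored(1)[of n A \<omega>] that elim by (auto simp: gw_survives_iff_infinite not_le[symmetric])
          then have "T n i \<omega> \<le> S n i \<omega>" using False i by (intro T_le_S_if_continued) auto
          moreover have "i \<le> T n i \<omega>"
            unfolding T_eq_coupon_time using elim
            by (intro coupon_collection.le_T[OF coupon_collection_D]) simp
          ultimately show ?thesis by simp
        qed simp
        ultimately show "i < 1 + sum_list (take i (?L \<omega>))" by simp
      qed
      let ?W = "{\<omega>\<in>space M. walk_alive 1 (?L \<omega>)}"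
      have W: "?W \<in> events"
      proof -
        have "\<xi> n i \<in> measurable M (count_space UNIV)" if "i < A" for i
          using that elim by (intro measurable_\<xi>) auto
        then have "?L \<in> measurable M (count_space UNIV)"
        proof (induction A)
          case (Suc A)
          have "(\<lambda>\<omega>. (\<lambda>as. as @ [\<xi> n A \<omega>]) (map (\<lambda>i. \<xi> n i \<omega>) [0..<A])) \<in> measurable M (count_space UNIV)"
          proof (rule measurable_compose_countable[where f = "\<lambda>as \<omega>. as @ [\<xi> n A \<omega>]"])
            show "(\<lambda>\<omega>. as @ [\<xi> n A \<omega>]) \<in> measurable M (count_space UNIV)" for as
              using Suc.prems[of A] by (intro measurable_compose[of "\<xi> n A" _ _ "\<lambda>a. as @ [a]"]) auto
          qed (use Suc in auto)
          then show ?case by simp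
        qed simp
        then have "(\<lambda>\<omega>. walk_alive 1 (?L \<omega>)) \<in> measurable M (count_space UNIV)"
          by (rule measurable_compose) simp
        then show ?thesis by (simp add: pred_def)
      qed
      have "?s \<le> prob ({\<omega>\<in>space M. T n A \<omega> \<noteq> A} \<union> ?W)"
        using alive W event_failure[OF elim] by (intro finite_measure_mono) auto
      also have "\<dots> \<le> prob {\<omega>\<in>space M. T n A \<omega> \<noteq> A} + prob ?W"
        using W event_failure[OF elim] by (intro measure_Un_le)
      also have "prob ?W = walk_prob \<mu> A 1"
        unfolding walk_prob_def using elim by (intro prob_offspring_list) auto
      finally show ?case .
    qed
    moreover have "(\<lambda>n. prob {\<omega>\<in>space M. T n A \<omega> \<noteq> A} + walk_prob \<mu> A 1) \<longlonglongrightarrow> 0 + walk_prob \<mu> A 1"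
      by (intro tendsto_intros no_failure)
    ultimately show ?thesis
      using tendsto_lowerbound[of _ "0 + walk_prob \<mu> A 1" sequentially ?s] by simp
  qed
  then have "?s \<le> 0"
    using walk_prob_tendsto_0[OF assms, of 1] by (intro LIMSEQ_le_const) auto
  then show ?thesis by (simp add: measure_le_0_iff)
qed

text \<open>The conversion sends an infinite total to 0, so \<open>Z\<close> is the total progeny on
  extinction only.\<close>

definition "Z \<omega> = enn2real (gw_total (K \<omega>))"

lemma measurable_Z: "Z \<in> borel_measurable M"
  unfolding Z_def[abs_def] using measurable_gw_total[of K M, OF measurable_K] by measurable

lemma finite_tree:
  assumes "\<not> gw_survives (K \<omega>)"
  shows "finite (gw_tree (K \<omega>))" "Z \<omega> = real (card (gw_tree (K \<omega>)))" "gw_total (K \<omega>) < \<infinity>"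
proof -
  show fin: "finite (gw_tree (K \<omega>))" using assms by (simp add: gw_survives_iff_infinite)
  from gw_total_eq_card[OF fin]
  show "Z \<omega> = real (card (gw_tree (K \<omega>)))" "gw_total (K \<omega>) < \<infinity>"
    by (simp_all add: Z_def ennreal_of_nat_eq_real_of_nat)
qed

lemma X_\<tau>_le_Z:
  assumes "\<not> gw_survives (K \<omega>)" "1 \<le> n"
  shows "real (X n \<omega>) \<le> Z \<omega>" "real (\<tau> n \<omega>) \<le> Z \<omega>"
  using finite_tree[OF assms(1)] tree_bounds[OF assms(2), of \<omega>] by auto

lemma event_Z_large: "{\<omega>\<in>space M. \<not> gw_survives (K \<omega>) \<and> c < Z \<omega>} \<in> events"
  using survival_event measurable_Z pred_gw_survives[of K M, OF measurable_K] by measurable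

text \<open>On extinction the total progeny is finite and does not depend on \<open>n\<close>, so it
  is negligible against \<open>n\<close>; there it dominates both the duration and the informed
  count.\<close>

lemma tendsto_Z_large:
  assumes "0 < c"
  shows "(\<lambda>n. prob {\<omega>\<in>space M. \<not> gw_survives (K \<omega>) \<and> c * real n < Z \<omega>}) \<longlonglongrightarrow> 0"
proof -
  let ?E = "\<lambda>n. {\<omega>\<in>space M. \<not> gw_survives (K \<omega>) \<and> c * real n < Z \<omega>}"
  have "decseq ?E"
    using assms by (auto simp: decseq_def intro: le_less_trans[rotated] mult_left_mono)
  then have "(\<lambda>n. prob (?E n)) \<longlonglongrightarrow> prob (\<Inter>n. ?E n)"
    using event_Z_large by (intro finite_Lim_measure_decseq) auto
  moreover have "(\<Inter>n. ?E n) = {}"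
  proof -
    have "\<exists>n. \<not> c * real n < Z \<omega>" for \<omega>
    proof -
      obtain n where "Z \<omega> / c < real n" using reals_Archimedean2 by blast
      then have "Z \<omega> < c * real n" using assms by (simp add: field_simps)
      then show ?thesis by (intro exI[of _ n]) simp
    qed
    then show ?thesis by auto
  qed
  ultimately show ?thesis by simp
qed

end

lemma tends_in_probI:
  assumes "\<And>n. X n \<in> borel_measurable M" "Y \<in> borel_measurable M"
    and "\<And>\<epsilon>. 0 < \<epsilon> \<Longrightarrow> \<exists>q. q \<longlonglongrightarrow> 0 \<and>
      (\<forall>\<^sub>F n in sequentially. measure M {\<omega>\<in>space M. \<epsilon> < d (X n \<omega>) (Y \<omega>)} \<le> q n)"
  shows "tends_in_prob M d X Y"
  unfolding tends_in_prob_def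
proof (intro conjI allI impI)
  fix \<epsilon> :: real assume "0 < \<epsilon>"
  then obtain q where "q \<longlonglongrightarrow> 0"
    "\<forall>\<^sub>F n in sequentially. measure M {\<omega>\<in>space M. \<epsilon> < d (X n \<omega>) (Y \<omega>)} \<le> q n"
    using assms(3) by blast
  note q = this
  show "(\<lambda>n. measure M {\<omega>\<in>space M. \<epsilon> < d (X n \<omega>) (Y \<omega>)}) \<longlonglongrightarrow> 0"
    by (rule tendsto_sandwich[OF _ q(2) tendsto_const q(1)]) simp
qed (use assms in auto)

text \<open>This is the slope of the chord of the strictly convex function
  \<open>- ln (1 - y)\<close> from the origin. In the supercritical case it equals \<open>m\<close>
  at \<open>p\<close>, which settles the sign of \<open>m * y + ln (1 - y)\<close> on either side of
  \<open>p\<close>.\<close>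

lemma neg_ln_one_minus_div_strict_mono:
  fixes x y :: real
  assumes "0 < x" "x < y" "y < 1"
  shows "- ln (1 - x) / x < - ln (1 - y) / y"
proof (rule DERIV_pos_imp_increasing[OF \<open>x < y\<close>])
  fix z assume "x \<le> z" "z \<le> y"
  with assms have z: "0 < z" "z < 1" by simp_all
  have "((\<lambda>z. - ln (1 - z) / z) has_real_derivative (1 / (1 - z) * z - (- ln (1 - z))) / (z * z)) (at z)"
    using z by (auto intro!: derivative_eq_intros simp: field_simps)
  moreover have "0 < 1 / (1 - z) * z - (- ln (1 - z))"
  proof -
    have "ln (1 / (1 - z)) < 1 / (1 - z) - 1" using z ln_le_minus_one[of "1 / (1 - z)"] ln_eq_minus_one[of "1 / (1 - z)"] by (fastforce simp: less_le)
    then show ?thesis using z by (simp add: ln_div field_simps)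
  qed
  ultimately show "\<exists>d. ((\<lambda>z. - ln (1 - z) / z) has_real_derivative d) (at z) \<and> 0 < d"
    using z by (intro exI[of _ "(1 / (1 - z) * z - (- ln (1 - z))) / (z * z)"]) auto
qed

section \<open>Limits\<close>

lemma enn2real_inverse_one_plus: "0 \<le> r \<Longrightarrow> enn2real (1 / (1 + ennreal r)) = 1 / (1 + r)"
proof -
  assume r: "0 \<le> r"
  then have "1 + ennreal r = ennreal (1 + r)" by simp
  then have "1 / (1 + ennreal r) = ennreal (1 / (1 + r))"
    using r divide_ennreal[of 1 "1 + r"] by simp
  then show ?thesis using r by simp
qed

context gw_coupon
begin

abbreviation "surv \<omega> \<equiv> gw_survives (K \<omega>)"

text \<open>If the informed count exceeds \<open>y * n\<close>, the run lasts at least until the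
  success numbered \<open>y * n\<close> rounded down, whose time exceeds \<open>a * n\<close> with
  high probability.\<close>

lemma tendsto_\<tau>_small_survival:
  assumes y: "0 < y" "y < 1" and m': "ennreal m' < pmf_mean \<mu>" "0 < m' * y + ln (1 - y)"
    and a: "a < - ln (1 - y)"
  shows "(\<lambda>n. prob {\<omega>\<in>space M. surv \<omega> \<and> real (\<tau> n \<omega>) \<le> a * real n}) \<longlonglongrightarrow> 0"
proof -
  let ?J = "\<lambda>n. nat \<lfloor>y * real n\<rfloor>"
  let ?F = "\<lambda>n. {\<omega>\<in>space M. real (T n (?J n) \<omega>) \<le> a * real n}"
  let ?G = "\<lambda>n. {\<omega>\<in>space M. surv \<omega> \<and> real (X n \<omega>) \<le> y * real n}"
  have lim: "(\<lambda>n. prob (?F n) + prob (?G n)) \<longlonglongrightarrow> 0 + 0"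
    using tendsto_T_small[OF y a] tendsto_X_small_survival[OF y m'] by (rule tendsto_add)
  have upper: "eventually (\<lambda>n. prob {\<omega>\<in>space M. surv \<omega> \<and> real (\<tau> n \<omega>) \<le> a * real n} \<le>
      prob (?F n) + prob (?G n)) sequentially"
    using eventually_ge_at_top[of 1]
  proof eventually_elim
    case (elim n)
    have J: "real (?J n) \<le> y * real n" using y by (intro of_nat_floor) auto
    have Jn: "?J n < n"
    proof -
      have "y * real n < real n" using y elim by simp
      then show ?thesis using J by linarith
    qed
    have [measurable]: "Measurable.pred M (\<lambda>\<omega>. surv \<omega>)" by (rule pred_gw_survives[OF measurable_K])
    have [measurable]: "T n (?J n) \<in> measurable M (count_space UNIV)" using Jn by (rule measurable_T)
    have [measurable]: "X n \<in> measurable M (count_space UNIV)" by (rule measurable_X)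
    have FG: "?F n \<in> events" "?G n \<in> events" by measurable
    have "{\<omega>\<in>space M. surv \<omega> \<and> real (\<tau> n \<omega>) \<le> a * real n} \<subseteq> ?F n \<union> ?G n"
    proof
      fix \<omega> assume \<omega>: "\<omega> \<in> {\<omega>\<in>space M. surv \<omega> \<and> real (\<tau> n \<omega>) \<le> a * real n}"
      show "\<omega> \<in> ?F n \<union> ?G n"
      proof (cases "real (X n \<omega>) \<le> y * real n")
        case False
        then have "?J n < X n \<omega>" using J by linarith
        then have "T n (?J n) \<omega> \<le> \<tau> n \<omega>" by (rule T_le_\<tau>)
        then show ?thesis using \<omega> by auto
      qed (use \<omega> in auto)
    qed
    then have "prob {\<omega>\<in>space M. surv \<omega> \<and> real (\<tau> n \<omega>) \<le> a * real n} \<le> prob (?F n \<union> ?G n)"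
      using FG by (intro finite_measure_mono) auto
    also have "\<dots> \<le> prob (?F n) + prob (?G n)" using FG by (rule measure_Un_le)
    finally show ?case .
  qed
  show ?thesis
  proof (rule tendsto_sandwich[OF _ upper tendsto_const])
    show "(\<lambda>n. prob (?F n) + prob (?G n)) \<longlonglongrightarrow> 0" using lim by simp
  qed simp
qed

text \<open>The duration is the sum of the numbers read, hence at most \<open>S\<close> at step
  \<open>y * n\<close> rounded down when the informed count is at most \<open>y * n\<close>.\<close>

lemma tendsto_\<tau>_large:
  assumes m: "pmf_mean \<mu> = ennreal m" "0 \<le> m" and y: "0 < y" "y < 1" "m * y + ln (1 - y) < 0"
    and a: "m * y < a"
  shows "(\<lambda>n. prob {\<omega>\<in>space M. a * real n < real (\<tau> n \<omega>)}) \<longlonglongrightarrow> 0"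
proof -
  let ?J = "\<lambda>n. nat \<lfloor>y * real n\<rfloor>"
  let ?F = "\<lambda>n. {\<omega>\<in>space M. a * real n \<le> real (S n (?J n) \<omega>)}"
  let ?G = "\<lambda>n. {\<omega>\<in>space M. y * real n < real (X n \<omega>)}"
  have lim: "(\<lambda>n. prob (?F n) + prob (?G n)) \<longlonglongrightarrow> 0 + 0"
    using tendsto_S_large[OF m y(1) less_imp_le[OF y(2)] a] tendsto_X_large[OF m y] by (rule tendsto_add)
  have upper: "eventually (\<lambda>n. prob {\<omega>\<in>space M. a * real n < real (\<tau> n \<omega>)} \<le>
      prob (?F n) + prob (?G n)) sequentially"
    using eventually_ge_at_top[of 1]
  proof eventually_elim
    case (elim n)
    have J: "real (?J n) \<le> y * real n" using y by (intro of_nat_floor) auto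
    have Jn: "?J n \<le> n"
    proof -
      have "y * real n \<le> real n" using y by (simp add: mult_left_le_one_le)
      then show ?thesis using J by linarith
    qed
    have [measurable]: "S n (?J n) \<in> measurable M (count_space UNIV)" using Jn by (rule measurable_S)
    have [measurable]: "X n \<in> measurable M (count_space UNIV)" by (rule measurable_X)
    have FG: "?F n \<in> events" "?G n \<in> events" by measurable
    have "{\<omega>\<in>space M. a * real n < real (\<tau> n \<omega>)} \<subseteq> ?F n \<union> ?G n"
    proof
      fix \<omega> assume \<omega>: "\<omega> \<in> {\<omega>\<in>space M. a * real n < real (\<tau> n \<omega>)}"
      show "\<omega> \<in> ?F n \<union> ?G n"
      proof (cases "y * real n < real (X n \<omega>)")
        case False
        then have "X n \<omega> \<le> ?J n" by (simp add: le_nat_floor)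
        then have "S n (X n \<omega>) \<omega> \<le> S n (?J n) \<omega>" unfolding S_def by (intro sum_mono2) auto
        then have "\<tau> n \<omega> \<le> S n (?J n) \<omega>" using \<tau>_eq_S[OF elim] by simp
        then show ?thesis using \<omega> by auto
      qed (use \<omega> in auto)
    qed
    then have "prob {\<omega>\<in>space M. a * real n < real (\<tau> n \<omega>)} \<le> prob (?F n \<union> ?G n)"
      using FG by (intro finite_measure_mono) auto
    also have "\<dots> \<le> prob (?F n) + prob (?G n)" using FG by (rule measure_Un_le)
    finally show ?case .
  qed
  show ?thesis
  proof (rule tendsto_sandwich[OF _ upper tendsto_const])
    show "(\<lambda>n. prob (?F n) + prob (?G n)) \<longlonglongrightarrow> 0" using lim by simp
  qed simp
qed

text \<open>\<open>V\<close> is the given variable and \<open>W\<close> its version built from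
  \<open>D\<close>. On extinction \<open>W\<close> is dominated by the total progeny, so each
  application has to supply only the two tails on survival.\<close>

lemma tends_in_prob_ratio:
  assumes V: "\<And>n. AE \<omega> in M. V n \<omega> = W n \<omega>" "\<And>n. W n \<in> measurable M (count_space UNIV)"
    "\<And>n. V n \<in> measurable M (count_space UNIV)"
    and le_Z: "\<And>n \<omega>. 1 \<le> n \<Longrightarrow> \<not> surv \<omega> \<Longrightarrow> real (W n \<omega>) \<le> Z \<omega>"
    and low: "\<And>b. b < c \<Longrightarrow> (\<lambda>n. prob {\<omega>\<in>space M. surv \<omega> \<and> real (W n \<omega>) \<le> b * real n}) \<longlonglongrightarrow> 0"
    and up: "\<And>b. c < b \<Longrightarrow> (\<lambda>n. prob {\<omega>\<in>space M. surv \<omega> \<and> b * real n < real (W n \<omega>)}) \<longlonglongrightarrow> 0"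
  shows "tends_in_prob M dist (\<lambda>n \<omega>. real (V n \<omega>) / real n) (\<lambda>\<omega>. c * indicator {\<omega>. surv \<omega>} \<omega>)"
proof (rule tends_in_probI)
  have [measurable]: "Measurable.pred M (\<lambda>\<omega>. surv \<omega>)" by (rule pred_gw_survives[OF measurable_K])
  note [measurable] = V(2,3) measurable_Z
  show "(\<lambda>\<omega>. real (V n \<omega>) / real n) \<in> borel_measurable M" for n by measurable
  have "(\<lambda>\<omega>. c * indicator {\<omega>. surv \<omega>} \<omega>) = (\<lambda>\<omega>. if surv \<omega> then c else 0)" by (auto simp: indicator_def)
  then show "(\<lambda>\<omega>. c * indicator {\<omega>. surv \<omega>} \<omega>) \<in> borel_measurable M" by simp
  fix \<epsilon> :: real assume \<epsilon>: "0 < \<epsilon>"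
  let ?A = "\<lambda>n. {\<omega>\<in>space M. surv \<omega> \<and> real (W n \<omega>) \<le> (c - \<epsilon>) * real n}"
  let ?B = "\<lambda>n. {\<omega>\<in>space M. surv \<omega> \<and> (c + \<epsilon>) * real n < real (W n \<omega>)}"
  let ?C = "\<lambda>n. {\<omega>\<in>space M. \<not> surv \<omega> \<and> \<epsilon> * real n < Z \<omega>}"
  let ?q = "\<lambda>n. prob (?A n) + prob (?B n) + prob (?C n)"
  have "?q \<longlonglongrightarrow> 0 + 0 + 0"
    using \<epsilon> by (intro tendsto_add low up tendsto_Z_large) auto
  moreover have "eventually (\<lambda>n. prob {\<omega>\<in>space M. \<epsilon> < dist (real (V n \<omega>) / real n) (c * indicator {\<omega>. surv \<omega>} \<omega>)} \<le> ?q n) sequentially"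
    using eventually_ge_at_top[of 1]
  proof eventually_elim
    case (elim n)
    let ?R = "\<lambda>\<omega>. surv \<omega> \<and> real (W n \<omega>) \<le> (c - \<epsilon>) * real n \<or>
      surv \<omega> \<and> (c + \<epsilon>) * real n < real (W n \<omega>) \<or> \<not> surv \<omega> \<and> \<epsilon> * real n < Z \<omega>"
    have "prob {\<omega>\<in>space M. \<epsilon> < dist (real (V n \<omega>) / real n) (c * indicator {\<omega>. surv \<omega>} \<omega>)} \<le> prob {\<omega>\<in>space M. ?R \<omega>}"
    proof (rule prob_mono_AE)
      show "AE \<omega> in M. \<epsilon> < dist (real (V n \<omega>) / real n) (c * indicator {\<omega>. surv \<omega>} \<omega>) \<longrightarrow> ?R \<omega>"
        using V(1)[of n]
      proof eventually_elim
        case (elim \<omega>)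
        have n: "0 < real n" using \<open>1 \<le> n\<close> by simp
        show ?case
        proof
          assume "\<epsilon> < dist (real (V n \<omega>) / real n) (c * indicator {\<omega>. surv \<omega>} \<omega>)"
          then have d: "\<epsilon> < \<bar>real (W n \<omega>) / real n - (if surv \<omega> then c else 0)\<bar>"
            using elim by (cases "surv \<omega>") (simp_all add: dist_real_def)
          show "?R \<omega>"
          proof (cases "surv \<omega>")
            case True
            with d have "real (W n \<omega>) / real n < c - \<epsilon> \<or> c + \<epsilon> < real (W n \<omega>) / real n" by auto
            then show ?thesis using n True by (auto simp: pos_divide_less_eq pos_less_divide_eq)
          next
            case False
            with d have "\<epsilon> < real (W n \<omega>) / real n" by simp
            then have "\<epsilon> * real n < real (W n \<omega>)" using n by (simp add: pos_less_divide_eq)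
            then show ?thesis using False le_Z[OF \<open>1 \<le> n\<close> False] by simp
          qed
        qed
      qed
    qed measurable
    also have "{\<omega>\<in>space M. ?R \<omega>} = ?A n \<union> ?B n \<union> ?C n" by auto
    also have "prob (?A n \<union> ?B n \<union> ?C n) \<le> prob (?A n \<union> ?B n) + prob (?C n)"
      by (rule measure_Un_le; measurable)
    also have "prob (?A n \<union> ?B n) \<le> prob (?A n) + prob (?B n)"
      by (rule measure_Un_le; measurable)
    finally show ?case by simp
  qed
  ultimately show "\<exists>q. q \<longlonglongrightarrow> 0 \<and> (\<forall>\<^sub>F n in sequentially.
      prob {\<omega>\<in>space M. \<epsilon> < dist (real (V n \<omega>) / real n) (c * indicator {\<omega>. surv \<omega>} \<omega>)} \<le> q n)"
    by (intro exI[of _ ?q]) simp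
qed

text \<open>On survival the distance to infinity is \<open>1 / (1 + x)\<close>, so a distance above
  \<epsilon> forces \<open>x < 1 / \<epsilon>\<close>; on extinction the distance to 0 is at most
  \<open>x\<close>. A lower tail on survival therefore suffices.\<close>

lemma tends_in_prob_ratio_infinite:
  assumes V: "\<And>n. AE \<omega> in M. V n \<omega> = W n \<omega>" "\<And>n. W n \<in> measurable M (count_space UNIV)"
    "\<And>n. V n \<in> measurable M (count_space UNIV)"
    and le_Z: "\<And>n \<omega>. 1 \<le> n \<Longrightarrow> \<not> surv \<omega> \<Longrightarrow> real (W n \<omega>) \<le> Z \<omega>"
    and low: "\<And>b. 0 < b \<Longrightarrow> (\<lambda>n. prob {\<omega>\<in>space M. surv \<omega> \<and> real (W n \<omega>) \<le> b * real n}) \<longlonglongrightarrow> 0"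
  shows "tends_in_prob M ennreal_dist (\<lambda>n \<omega>. ennreal (real (V n \<omega>) / real n)) (\<lambda>\<omega>. \<infinity> * indicator {\<omega>. surv \<omega>} \<omega>)"
proof (rule tends_in_probI)
  have [measurable]: "Measurable.pred M (\<lambda>\<omega>. surv \<omega>)" by (rule pred_gw_survives[OF measurable_K])
  note [measurable] = V(2,3) measurable_Z
  show "(\<lambda>\<omega>. ennreal (real (V n \<omega>) / real n)) \<in> borel_measurable M" for n by measurable
  have "(\<lambda>\<omega>. \<infinity> * indicator {\<omega>. surv \<omega>} \<omega>) = (\<lambda>\<omega>. if surv \<omega> then \<infinity> else 0 :: ennreal)"
    by (auto simp: indicator_def)
  then show "(\<lambda>\<omega>. \<infinity> * indicator {\<omega>. surv \<omega>} \<omega> :: ennreal) \<in> borel_measurable M" by simp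
  fix \<epsilon> :: real assume \<epsilon>: "0 < \<epsilon>"
  let ?A = "\<lambda>n. {\<omega>\<in>space M. surv \<omega> \<and> real (W n \<omega>) \<le> 1 / \<epsilon> * real n}"
  let ?C = "\<lambda>n. {\<omega>\<in>space M. \<not> surv \<omega> \<and> \<epsilon> * real n < Z \<omega>}"
  let ?q = "\<lambda>n. prob (?A n) + prob (?C n)"
  have "?q \<longlonglongrightarrow> 0 + 0"
    using \<epsilon> by (intro tendsto_add low tendsto_Z_large) auto
  moreover have "eventually (\<lambda>n. prob {\<omega>\<in>space M. \<epsilon> < ennreal_dist (ennreal (real (V n \<omega>) / real n)) (\<infinity> * indicator {\<omega>. surv \<omega>} \<omega>)} \<le> ?q n) sequentially"
    using eventually_ge_at_top[of 1]
  proof eventually_elim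
    case (elim n)
    let ?R = "\<lambda>\<omega>. surv \<omega> \<and> real (W n \<omega>) \<le> 1 / \<epsilon> * real n \<or> \<not> surv \<omega> \<and> \<epsilon> * real n < Z \<omega>"
    have "prob {\<omega>\<in>space M. \<epsilon> < ennreal_dist (ennreal (real (V n \<omega>) / real n)) (\<infinity> * indicator {\<omega>. surv \<omega>} \<omega>)} \<le> prob {\<omega>\<in>space M. ?R \<omega>}"
    proof (rule prob_mono_AE)
      show "AE \<omega> in M. \<epsilon> < ennreal_dist (ennreal (real (V n \<omega>) / real n)) (\<infinity> * indicator {\<omega>. surv \<omega>} \<omega>) \<longrightarrow> ?R \<omega>"
        using V(1)[of n]
      proof eventually_elim
        case (elim \<omega>)
        have n: "0 < real n" using \<open>1 \<le> n\<close> by simp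
        define x where "x = real (W n \<omega>) / real n"
        have x: "0 \<le> x" by (simp add: x_def)
        show ?case
        proof
          assume "\<epsilon> < ennreal_dist (ennreal (real (V n \<omega>) / real n)) (\<infinity> * indicator {\<omega>. surv \<omega>} \<omega>)"
          then have d: "\<epsilon> < ennreal_dist (ennreal x) (if surv \<omega> then \<infinity> else 0)"
            using elim by (auto simp: indicator_def x_def)
          show "?R \<omega>"
          proof (cases "surv \<omega>")
            case True
            with d x have "\<epsilon> < 1 / (1 + x)"
              by (simp add: ennreal_dist_def enn2real_inverse_one_plus)
            then have "\<epsilon> * (1 + x) < 1" using x by (simp add: pos_less_divide_eq)
            then have "\<epsilon> * x < 1" using \<epsilon> by (simp add: distrib_left)
            then have "x < 1 / \<epsilon>" using \<epsilon> by (simp add: pos_less_divide_eq mult.commute)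
            then show ?thesis using n True by (simp add: x_def pos_divide_less_eq)
          next
            case False
            with d x have "\<epsilon> < \<bar>1 / (1 + x) - 1\<bar>"
              using enn2real_inverse_one_plus[of 0] by (simp add: ennreal_dist_def enn2real_inverse_one_plus)
            also have "\<dots> \<le> x"
            proof -
              have "1 - x \<le> 1 / (1 + x)" "1 / (1 + x) \<le> 1"
                using x by (simp_all add: divide_simps algebra_simps)
              then show ?thesis by simp
            qed
            finally have "\<epsilon> * real n < real (W n \<omega>)" using n by (simp add: x_def pos_less_divide_eq)
            then show ?thesis using False le_Z[OF \<open>1 \<le> n\<close> False] by simp
          qed
        qed
      qed
    qed measurable
    also have "{\<omega>\<in>space M. ?R \<omega>} = ?A n \<union> ?C n" by auto
    also have "prob (?A n \<union> ?C n) \<le> prob (?A n) + prob (?C n)"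
      by (rule measure_Un_le; measurable)
    finally show ?case by simp
  qed
  ultimately show "\<exists>q. q \<longlonglongrightarrow> 0 \<and> (\<forall>\<^sub>F n in sequentially.
      prob {\<omega>\<in>space M. \<epsilon> < ennreal_dist (ennreal (real (V n \<omega>) / real n)) (\<infinity> * indicator {\<omega>. surv \<omega>} \<omega>)} \<le> q n)"
    by (intro exI[of _ ?q]) simp
qed

text \<open>With high probability the variables are equal, not merely close: once \<open>A\<close>
  bounds the total progeny and the first \<open>A\<close> waiting times are 1, the informed set is
  the tree. The hypothesis \<open>eq\<close> lets the duration plus one take the place of the
  informed count.\<close>

lemma tends_in_prob_total:
  assumes sub: "prob {\<omega>\<in>space M. surv \<omega>} = 0"
    and V: "\<And>n. AE \<omega> in M. V n \<omega> = W n \<omega>" "\<And>n. V n \<in> measurable M (count_space UNIV)"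
    and eq: "\<And>n A \<omega>. A < n \<Longrightarrow> T n A \<omega> = A \<Longrightarrow> X n \<omega> \<le> A \<Longrightarrow> W n \<omega> = X n \<omega>"
  shows "tends_in_prob M dist (\<lambda>n \<omega>. real (V n \<omega>)) (\<lambda>\<omega>. Z \<omega>)"
proof -
  have [measurable]: "Measurable.pred M (\<lambda>\<omega>. surv \<omega>)" by (rule pred_gw_survives[OF measurable_K])
  note [measurable] = V(2) measurable_Z
  have "(\<lambda>n. prob {\<omega>\<in>space M. \<epsilon> < dist (real (V n \<omega>)) (Z \<omega>)}) \<longlonglongrightarrow> 0" if \<epsilon>: "0 < \<epsilon>" for \<epsilon> :: real
  proof (rule order_tendstoI)
    fix e :: real assume e: "0 < e"
    have "eventually (\<lambda>A. prob {\<omega>\<in>space M. \<not> surv \<omega> \<and> 1 * real A < Z \<omega>} < e / 2) sequentially"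
      using e tendsto_Z_large[of 1] by (intro order_tendstoD(2)) auto
    then obtain A where A: "prob {\<omega>\<in>space M. \<not> surv \<omega> \<and> 1 * real A < Z \<omega>} < e / 2"
      by (auto simp: eventually_sequentially)
    have "eventually (\<lambda>n. prob {\<omega>\<in>space M. T n A \<omega> \<noteq> A} < e / 2) sequentially"
      using e no_failure by (intro order_tendstoD(2)) auto
    then show "eventually (\<lambda>n. prob {\<omega>\<in>space M. \<epsilon> < dist (real (V n \<omega>)) (Z \<omega>)} < e) sequentially"
      using eventually_gt_at_top[of A]
    proof eventually_elim
      case (elim n)
      have [measurable]: "T n A \<in> measurable M (count_space UNIV)" using elim(2) by (rule measurable_T)
      let ?R = "\<lambda>\<omega>. (\<not> surv \<omega> \<and> 1 * real A < Z \<omega>) \<or> T n A \<omega> \<noteq> A"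
      have not_surv: "AE \<omega> in M. \<not> surv \<omega>"
        using sub survival_event by (subst AE_iff_measurable[OF _ refl]) (auto simp: emeasure_eq_measure)
      have "prob {\<omega>\<in>space M. \<epsilon> < dist (real (V n \<omega>)) (Z \<omega>)} \<le> prob {\<omega>\<in>space M. ?R \<omega>}"
      proof (rule prob_mono_AE)
        show "AE \<omega> in M. \<epsilon> < dist (real (V n \<omega>)) (Z \<omega>) \<longrightarrow> ?R \<omega>"
          using V(1)[of n] not_surv
        proof eventually_elim
          case (elim \<omega>)
          show ?case
          proof (rule impI, rule ccontr)
            assume d: "\<epsilon> < dist (real (V n \<omega>)) (Z \<omega>)" and "\<not> ?R \<omega>"
            then have *: "Z \<omega> \<le> real A" "T n A \<omega> = A" using elim by auto
            with X_\<tau>_le_Z(1)[OF elim(2), of n] \<open>A < n\<close> have XA: "X n \<omega> \<le> A" by simp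
            have "real (X n \<omega>) = Z \<omega>"
              using tree_explored(2)[OF *(2) XA \<open>A < n\<close>] finite_tree[OF elim(2)] by simp
            then show False using d \<epsilon> eq[OF \<open>A < n\<close> *(2) XA] elim(1) by simp
          qed
        qed
      qed measurable
      also have "{\<omega>\<in>space M. ?R \<omega>} = {\<omega>\<in>space M. \<not> surv \<omega> \<and> 1 * real A < Z \<omega>} \<union> {\<omega>\<in>space M. T n A \<omega> \<noteq> A}" by auto
      also have "prob \<dots> \<le> prob {\<omega>\<in>space M. \<not> surv \<omega> \<and> 1 * real A < Z \<omega>} + prob {\<omega>\<in>space M. T n A \<omega> \<noteq> A}"
        by (rule measure_Un_le; measurable)
      finally show ?case using A elim(1) by linarith
    qed
  qed (intro always_eventually allI, erule less_le_trans, simp)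
  moreover have "(\<lambda>\<omega>. real (V n \<omega>)) \<in> borel_measurable M" for n by measurable
  ultimately show ?thesis using measurable_Z unfolding tends_in_prob_def by blast
qed

lemma tendsto_prob_mono:
  assumes lim: "(\<lambda>n. prob {\<omega>\<in>space M. Q' n \<omega>}) \<longlonglongrightarrow> 0"
    and "\<And>n \<omega>. Q n \<omega> \<Longrightarrow> Q' n \<omega>" and "\<And>n. {\<omega>\<in>space M. Q' n \<omega>} \<in> events"
  shows "(\<lambda>n. prob {\<omega>\<in>space M. Q n \<omega>}) \<longlonglongrightarrow> 0"
proof (rule tendsto_sandwich[OF _ _ tendsto_const lim])
  show "eventually (\<lambda>n. prob {\<omega>\<in>space M. Q n \<omega>} \<le> prob {\<omega>\<in>space M. Q' n \<omega>}) sequentially"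
    using assms(2,3) by (intro always_eventually allI prob_mono_AE) auto
qed simp

text \<open>Strict inequality leaves room for a real \<open>m'\<close>; density is used in
  \<open>ennreal\<close> so that an infinite mean is covered too.\<close>

lemma drift_below_mean:
  assumes "0 < y" "y < 1" "ennreal (- ln (1 - y) / y) < pmf_mean \<mu>"
  shows "\<exists>m'. ennreal m' < pmf_mean \<mu> \<and> 0 < m' * y + ln (1 - y)"
proof -
  obtain z where z: "ennreal (- ln (1 - y) / y) < z" "z < pmf_mean \<mu>"
    using dense[OF assms(3)] by blast
  then have "z \<noteq> \<infinity>" by auto
  then obtain m' where m': "z = ennreal m'" "0 \<le> m'" by (cases z) auto
  have "0 \<le> - ln (1 - y) / y" using assms(1,2) by (intro divide_nonneg_pos) auto
  then have "- ln (1 - y) / y < m'" using z(1) unfolding m'(1) by (metis ennreal_less_iff)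
  then have "- ln (1 - y) < m' * y" using pos_divide_less_eq[OF assms(1)] by blast
  then have "0 < m' * y + ln (1 - y)" by linarith
  with z m' show ?thesis by blast
qed

lemma X_lower_limit:
  assumes "0 < y" "y < 1" "ennreal (- ln (1 - y) / y) < pmf_mean \<mu>" "b \<le> y"
  shows "(\<lambda>n. prob {\<omega>\<in>space M. surv \<omega> \<and> real (X n \<omega>) \<le> b * real n}) \<longlonglongrightarrow> 0"
proof -
  obtain m' where m': "ennreal m' < pmf_mean \<mu>" "0 < m' * y + ln (1 - y)"
    using drift_below_mean[OF assms(1-3)] by blast
  have [measurable]: "Measurable.pred M (\<lambda>\<omega>. surv \<omega>)" by (rule pred_gw_survives[OF measurable_K])
  note [measurable] = measurable_X
  show ?thesis
  proof (rule tendsto_prob_mono[OF tendsto_X_small_survival[OF assms(1,2) m']])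
    fix n \<omega> assume "surv \<omega> \<and> real (X n \<omega>) \<le> b * real n"
    moreover have "b * real n \<le> y * real n" using assms(4) by (intro mult_right_mono) auto
    ultimately show "surv \<omega> \<and> real (X n \<omega>) \<le> y * real n" by linarith
  qed measurable
qed

lemma \<tau>_lower_limit:
  assumes "0 < y" "y < 1" "ennreal (- ln (1 - y) / y) < pmf_mean \<mu>" "b < - ln (1 - y)"
  shows "(\<lambda>n. prob {\<omega>\<in>space M. surv \<omega> \<and> real (\<tau> n \<omega>) \<le> b * real n}) \<longlonglongrightarrow> 0"
  using drift_below_mean[OF assms(1-3)] tendsto_\<tau>_small_survival[OF assms(1,2) _ _ assms(4)] by blast

lemma duration_facts:
  shows "AE \<omega> in M. duration n (K \<omega>) (\<Delta> n \<omega>) = \<tau> n \<omega>"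
    and "AE \<omega> in M. coupon_count n (\<Delta> n \<omega>) (duration n (K \<omega>) (\<Delta> n \<omega>)) = X n \<omega>"
    and "(\<lambda>\<omega>. duration n (K \<omega>) (\<Delta> n \<omega>)) \<in> measurable M (count_space UNIV)"
    and "(\<lambda>\<omega>. coupon_count n (\<Delta> n \<omega>) (duration n (K \<omega>) (\<Delta> n \<omega>))) \<in> measurable M (count_space UNIV)"
proof -
  show "AE \<omega> in M. duration n (K \<omega>) (\<Delta> n \<omega>) = \<tau> n \<omega>"
    using AE_\<tau>_X_eq[of n] by eventually_elim simp
  show "AE \<omega> in M. coupon_count n (\<Delta> n \<omega>) (duration n (K \<omega>) (\<Delta> n \<omega>)) = X n \<omega>"
    using AE_\<tau>_X_eq[of n] by eventually_elim simp
  show "(\<lambda>\<omega>. duration n (K \<omega>) (\<Delta> n \<omega>)) \<in> measurable M (count_space UNIV)"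
    by (intro measurable_duration measurable_K measurable_\<Delta>)
  show "(\<lambda>\<omega>. coupon_count n (\<Delta> n \<omega>) (duration n (K \<omega>) (\<Delta> n \<omega>))) \<in> measurable M (count_space UNIV)"
    by (intro measurable_coupon_count_duration measurable_K measurable_\<Delta>)
qed

lemmas tends_in_prob_\<tau> = tends_in_prob_ratio[OF duration_facts(1) measurable_\<tau> duration_facts(3) X_\<tau>_le_Z(2)]
lemmas tends_in_prob_\<tau>_infinite =
  tends_in_prob_ratio_infinite[OF duration_facts(1) measurable_\<tau> duration_facts(3) X_\<tau>_le_Z(2)]
lemmas tends_in_prob_X = tends_in_prob_ratio[OF duration_facts(2) measurable_X duration_facts(4) X_\<tau>_le_Z(1)]

abbreviation "\<tau>_ratio n \<omega> \<equiv> real (duration n (K \<omega>) (\<Delta> n \<omega>)) / real n"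
abbreviation "X_ratio n \<omega> \<equiv> real (coupon_count n (\<Delta> n \<omega>) (duration n (K \<omega>) (\<Delta> n \<omega>))) / real n"

section \<open>The three regimes of the mean\<close>

lemma subcritical_limits:
  assumes "pmf_mean \<mu> \<le> 1" "pmf \<mu> 1 < 1"
  shows "tends_in_prob M dist \<tau>_ratio (\<lambda>\<omega>. 0 * indicator {\<omega>. surv \<omega>} \<omega>)"
    and "tends_in_prob M dist X_ratio (\<lambda>\<omega>. 0 * indicator {\<omega>. surv \<omega>} \<omega>)"
    and "AE \<omega> in M. gw_total (K \<omega>) < \<infinity>"
    and "tends_in_prob M dist (\<lambda>n \<omega>. real (duration n (K \<omega>) (\<Delta> n \<omega>) + 1)) (\<lambda>\<omega>. enn2real (gw_total (K \<omega>)))"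
    and "tends_in_prob M dist (\<lambda>n \<omega>. real (coupon_count n (\<Delta> n \<omega>) (duration n (K \<omega>) (\<Delta> n \<omega>))))
      (\<lambda>\<omega>. enn2real (gw_total (K \<omega>)))"
proof -
  note sub = prob_survival_subcritical[OF assms]
  \<comment> \<open>Survival is a null event here, so both tail conditions hold with limit constant
    0.\<close>
  have lim: "(\<lambda>n. prob {\<omega>\<in>space M. surv \<omega> \<and> Q n \<omega>}) \<longlonglongrightarrow> 0" for Q
    by (rule tendsto_prob_mono[where Q' = "\<lambda>n \<omega>. surv \<omega>"]) (use sub survival_event in auto)
  show "tends_in_prob M dist \<tau>_ratio (\<lambda>\<omega>. 0 * indicator {\<omega>. surv \<omega>} \<omega>)"
    by (intro tends_in_prob_\<tau> lim)
  show "tends_in_prob M dist X_ratio (\<lambda>\<omega>. 0 * indicator {\<omega>. surv \<omega>} \<omega>)"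
    by (intro tends_in_prob_X lim)
  have "AE \<omega> in M. \<not> surv \<omega>"
    using sub survival_event by (subst AE_iff_measurable[OF _ refl]) (auto simp: emeasure_eq_measure)
  then show "AE \<omega> in M. gw_total (K \<omega>) < \<infinity>"
    by eventually_elim (rule finite_tree(3))
  have "AE \<omega> in M. duration n (K \<omega>) (\<Delta> n \<omega>) + 1 = \<tau> n \<omega> + 1" for n
    using duration_facts(1)[of n] by eventually_elim simp
  moreover have "(\<lambda>\<omega>. duration n (K \<omega>) (\<Delta> n \<omega>) + 1) \<in> measurable M (count_space UNIV)" for n
    using duration_facts(3)[of n] by measurable
  ultimately show "tends_in_prob M dist (\<lambda>n \<omega>. real (duration n (K \<omega>) (\<Delta> n \<omega>) + 1))
      (\<lambda>\<omega>. enn2real (gw_total (K \<omega>)))"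
    unfolding Z_def[symmetric] by (rule tends_in_prob_total[OF sub]) (rule tree_explored(3))
  show "tends_in_prob M dist (\<lambda>n \<omega>. real (coupon_count n (\<Delta> n \<omega>) (duration n (K \<omega>) (\<Delta> n \<omega>))))
      (\<lambda>\<omega>. enn2real (gw_total (K \<omega>)))"
    unfolding Z_def[symmetric] by (rule tends_in_prob_total[OF sub duration_facts(2,4)]) simp
qed

lemma infinite_mean_limits:
  assumes "pmf_mean \<mu> = \<infinity>"
  shows "tends_in_prob M ennreal_dist (\<lambda>n \<omega>. ennreal (\<tau>_ratio n \<omega>)) (\<lambda>\<omega>. \<infinity> * indicator {\<omega>. surv \<omega>} \<omega>)"
    and "tends_in_prob M dist X_ratio (\<lambda>\<omega>. 1 * indicator {\<omega>. surv \<omega>} \<omega>)"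
proof -
  show "tends_in_prob M ennreal_dist (\<lambda>n \<omega>. ennreal (\<tau>_ratio n \<omega>)) (\<lambda>\<omega>. \<infinity> * indicator {\<omega>. surv \<omega>} \<omega>)"
  proof (rule tends_in_prob_\<tau>_infinite)
    fix b :: real assume "0 < b"
    then show "(\<lambda>n. prob {\<omega>\<in>space M. surv \<omega> \<and> real (\<tau> n \<omega>) \<le> b * real n}) \<longlonglongrightarrow> 0"
      \<comment> \<open>For this fraction \<open>- ln (1 - y) = b + 1\<close>, which exceeds
        \<open>b\<close>.\<close>
      by (intro \<tau>_lower_limit[of "1 - exp (- (b + 1))"]) (auto simp: assms)
  qed
  show "tends_in_prob M dist X_ratio (\<lambda>\<omega>. 1 * indicator {\<omega>. surv \<omega>} \<omega>)"
  proof (rule tends_in_prob_X)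
    fix b :: real
    show "(\<lambda>n. prob {\<omega>\<in>space M. surv \<omega> \<and> real (X n \<omega>) \<le> b * real n}) \<longlonglongrightarrow> 0" if "b < 1"
      using that by (intro X_lower_limit[of "max b (1 / 2)"]) (auto simp: assms)
    show "(\<lambda>n. prob {\<omega>\<in>space M. surv \<omega> \<and> b * real n < real (X n \<omega>)}) \<longlonglongrightarrow> 0" if "1 < b"
    proof -
      have "\<not> b * real n < real (X n \<omega>)" for n \<omega>
      proof -
        have "real (X n \<omega>) \<le> 1 * real n" using X_le[of n \<omega>] by simp
        also have "\<dots> \<le> b * real n" using that by (intro mult_right_mono) auto
        finally show ?thesis by simp
      qed
      then show ?thesis by simp
    qed
  qed
qed

lemma supercritical_limits:
  assumes m: "pmf_mean \<mu> = ennreal m" "1 < m" and \<theta>: "0 < \<theta>" "(1 - exp (- \<theta>)) / \<theta> = 1 / m"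
  shows "tends_in_prob M dist \<tau>_ratio (\<lambda>\<omega>. \<theta> * indicator {\<omega>. surv \<omega>} \<omega>)"
    and "tends_in_prob M dist X_ratio (\<lambda>\<omega>. (1 - exp (- \<theta>)) * indicator {\<omega>. surv \<omega>} \<omega>)"
proof -
  define p where "p = 1 - exp (- \<theta>)"
  \<comment> \<open>The equation for \<theta> says \<open>m * p = \<theta>\<close>, and
    \<open>\<theta> = - ln (1 - p)\<close> by the choice of \<open>p\<close>; so \<open>p\<close> is
    the point at which the chord slope is \<open>m\<close>.\<close>
  have p: "0 < p" "p < 1" "m * p = \<theta>" "- ln (1 - p) / p = m"
    using m \<theta> by (auto simp: p_def field_simps)
  have below: "ennreal (- ln (1 - y) / y) < pmf_mean \<mu>" if "0 < y" "y < p" for y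
    using neg_ln_one_minus_div_strict_mono[of y p] that p m by (simp add: ennreal_less_iff divide_nonneg_pos ennreal_lessI)
  have above: "m * y + ln (1 - y) < 0" if "p < y" "y < 1" for y
  proof -
    have "m < - ln (1 - y) / y"
      using neg_ln_one_minus_div_strict_mono[of p y] that p(1) unfolding p(4) by blast
    moreover have "0 < y" using that p(1) by linarith
    ultimately have "m * y < - ln (1 - y)" using pos_less_divide_eq by blast
    then show ?thesis by linarith
  qed
  have [measurable]: "Measurable.pred M (\<lambda>\<omega>. surv \<omega>)" by (rule pred_gw_survives[OF measurable_K])
  note [measurable] = measurable_X measurable_\<tau>
  have m0: "0 \<le> m" using m by simp
  show "tends_in_prob M dist \<tau>_ratio (\<lambda>\<omega>. \<theta> * indicator {\<omega>. surv \<omega>} \<omega>)"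
  proof (rule tends_in_prob_\<tau>)
    fix b :: real
    show "(\<lambda>n. prob {\<omega>\<in>space M. surv \<omega> \<and> real (\<tau> n \<omega>) \<le> b * real n}) \<longlonglongrightarrow> 0" if "b < \<theta>"
    proof -
      \<comment> \<open>A point strictly between \<open>b\<close> and \<theta> that is positive even
        for negative \<open>b\<close>.\<close>
      define z where "z = max (\<theta> / 2) ((b + \<theta>) / 2)"
      have z: "0 < z" "z < \<theta>" "b < z" using that \<theta>(1) by (auto simp: z_def less_max_iff_disj)
      then have y: "0 < 1 - exp (- z)" "1 - exp (- z) < p" by (auto simp: p_def)
      show ?thesis
        using z y p below[OF y] by (intro \<tau>_lower_limit[of "1 - exp (- z)"]) auto
    qed
    show "(\<lambda>n. prob {\<omega>\<in>space M. surv \<omega> \<and> b * real n < real (\<tau> n \<omega>)}) \<longlonglongrightarrow> 0" if "\<theta> < b"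
    proof -
      \<comment> \<open>Above \<open>p\<close>, so that the informed count stays below
        \<open>y * n\<close>, but with \<open>y < 1\<close> and \<open>m * y < b\<close>; the value
        \<open>b / m\<close> exceeds \<open>p\<close> because
        \<open>m * p = \<theta>\<close>.\<close>
      define y where "y = min ((p + 1) / 2) ((p + b / m) / 2)"
      have "p < b / m" using that p m by (simp add: pos_less_divide_eq mult.commute)
      then have y: "p < y" "y < 1" using p(1,2) by (auto simp: y_def min_less_iff_disj)
      have "m * y \<le> m * ((p + b / m) / 2)" using m0 unfolding y_def by (intro mult_left_mono min.cobounded2)
      also have "\<dots> = (\<theta> + b) / 2" using m p by (simp add: field_simps)
      also have "\<dots> < b" using that by simp
      finally have mb: "m * y < b" .
      show ?thesis
        using y p by (intro tendsto_prob_mono[OF tendsto_\<tau>_large[OF m(1) m0 _ y(2) above[OF y] mb]]) (simp, simp, measurable)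
    qed
  qed
  show "tends_in_prob M dist X_ratio (\<lambda>\<omega>. (1 - exp (- \<theta>)) * indicator {\<omega>. surv \<omega>} \<omega>)"
    unfolding p_def[symmetric]
  proof (rule tends_in_prob_X)
    fix b :: real
    show "(\<lambda>n. prob {\<omega>\<in>space M. surv \<omega> \<and> real (X n \<omega>) \<le> b * real n}) \<longlonglongrightarrow> 0" if "b < p"
      using that p below[of "max b (p / 2)"] by (intro X_lower_limit[of "max b (p / 2)"]) auto
    show "(\<lambda>n. prob {\<omega>\<in>space M. surv \<omega> \<and> b * real n < real (X n \<omega>)}) \<longlonglongrightarrow> 0" if "p < b"
    proof -
      define y where "y = min b ((p + 1) / 2)"
      have y: "p < y" "y < 1" "0 < y" "y \<le> b" using p(1,2) that by (auto simp: y_def min_less_iff_disj)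
      show ?thesis
      proof (rule tendsto_prob_mono[OF tendsto_X_large[OF m(1) m0 y(3,2) above[OF y(1,2)]]])
        fix n \<omega> assume "surv \<omega> \<and> b * real n < real (X n \<omega>)"
        moreover have "y * real n \<le> b * real n" using y by (intro mult_right_mono) auto
        ultimately show "y * real n < real (X n \<omega>)" by linarith
      qed measurable
    qed
  qed
qed

end

theorem theorem2p2:
  fixes M :: "'a measure" and \<mu> :: "nat pmf"
    and K :: "'a \<Rightarrow> nat list \<Rightarrow> nat" and \<Delta> :: "nat \<Rightarrow> 'a \<Rightarrow> nat \<Rightarrow> nat"
  assumes "prob_space M"
    and "pmf \<mu> 0 < 1" and "pmf \<mu> 1 < 1" and "0 < pmf_mean \<mu>"
    and "\<And>w. w \<in> words \<Longrightarrow> distr M (count_space UNIV) (\<lambda>\<omega>. K \<omega> w) = measure_pmf \<mu>"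
    and "\<And>n i. 1 \<le> i \<Longrightarrow> i \<le> n - 1 \<Longrightarrow>
      distr M (count_space UNIV) (\<lambda>\<omega>. \<Delta> n \<omega> i) =
        measure_pmf (map_pmf Suc (geometric_pmf (1 - real i / real n)))"
    and "\<And>n. 1 \<le> n \<Longrightarrow>
      prob_space.indep_vars M (\<lambda>_. count_space UNIV)
        (\<lambda>j \<omega>. case j of Inl w \<Rightarrow> K \<omega> w | Inr i \<Rightarrow> \<Delta> n \<omega> i)
        (words <+> {1..n - 1})"
  shows
    "(limit_theta (pmf_mean \<mu>) < \<infinity> \<longrightarrow>
        tends_in_prob M dist
          (\<lambda>n \<omega>. real (duration n (K \<omega>) (\<Delta> n \<omega>)) / real n)
          (\<lambda>\<omega>. enn2real (limit_theta (pmf_mean \<mu>)) *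
                indicator {\<omega>. gw_survives (K \<omega>)} \<omega>)) \<and>
     (limit_theta (pmf_mean \<mu>) = \<infinity> \<longrightarrow>
        tends_in_prob M ennreal_dist
          (\<lambda>n \<omega>. ennreal (real (duration n (K \<omega>) (\<Delta> n \<omega>)) / real n))
          (\<lambda>\<omega>. limit_theta (pmf_mean \<mu>) *
                indicator {\<omega>. gw_survives (K \<omega>)} \<omega>)) \<and>
     tends_in_prob M dist
       (\<lambda>n \<omega>. real (coupon_count n (\<Delta> n \<omega>) (duration n (K \<omega>) (\<Delta> n \<omega>))) / real n)
       (\<lambda>\<omega>. limit_p (pmf_mean \<mu>) * indicator {\<omega>. gw_survives (K \<omega>)} \<omega>) \<and>
     (pmf_mean \<mu> \<le> 1 \<longrightarrow>
        (AE \<omega> in M. gw_total (K \<omega>) < \<infinity>) \<and>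
        tends_in_prob M dist
          (\<lambda>n \<omega>. real (duration n (K \<omega>) (\<Delta> n \<omega>) + 1))
          (\<lambda>\<omega>. enn2real (gw_total (K \<omega>))) \<and>
        tends_in_prob M dist
          (\<lambda>n \<omega>. real (coupon_count n (\<Delta> n \<omega>) (duration n (K \<omega>) (\<Delta> n \<omega>))))
          (\<lambda>\<omega>. enn2real (gw_total (K \<omega>))))"
proof -
  interpret prob_space M by fact
  interpret gw_coupon M \<mu> K \<Delta>
    by unfold_locales (fact assms(5-7))+
  consider "pmf_mean \<mu> \<le> 1" | "pmf_mean \<mu> = \<infinity>" | "1 < pmf_mean \<mu>" "pmf_mean \<mu> \<noteq> \<infinity>"
    by (meson not_le)
  then show ?thesis
  proof cases
    case 1
    then have "limit_theta (pmf_mean \<mu>) = 0" by (simp add: limit_theta_def)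
    moreover from this have "limit_p (pmf_mean \<mu>) = 0" by (simp add: limit_p_def)
    ultimately show ?thesis using subcritical_limits[OF 1 assms(3)] by simp
  next
    case 2
    have "1 < pmf_mean \<mu>" unfolding 2 by simp
    then have gt: "\<not> pmf_mean \<mu> \<le> 1" by (simp only: not_le)
    with 2 have "limit_theta (pmf_mean \<mu>) = \<infinity>" by (simp add: limit_theta_def)
    moreover from this have "limit_p (pmf_mean \<mu>) = 1" by (simp add: limit_p_def)
    ultimately show ?thesis using infinite_mean_limits[OF 2] gt by simp
  next
    case 3
    then obtain m where m: "pmf_mean \<mu> = ennreal m" "0 \<le> m" by (cases "pmf_mean \<mu>") auto
    with 3 have m1: "1 < m" by simp
    define \<theta> where "\<theta> = (THE x. 0 < x \<and> (1 - exp (- x)) / x = 1 / m)"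
    have \<theta>: "0 < \<theta>" "(1 - exp (- \<theta>)) / \<theta> = 1 / m"
      using theI'[OF limit_theta_root[OF m1]] unfolding \<theta>_def by blast+
    have "limit_theta (pmf_mean \<mu>) = ennreal \<theta>"
      using 3 m by (simp add: limit_theta_def \<theta>_def not_le[symmetric])
    moreover from this have "limit_p (pmf_mean \<mu>) = 1 - exp (- \<theta>)"
      using \<theta> by (simp add: limit_p_def)
    moreover have "\<not> pmf_mean \<mu> \<le> 1" using 3(1) by (simp only: not_le)
    ultimately show ?thesis using supercritical_limits[OF m(1) m1 \<theta>] \<theta>(1) by simp
  qed
qed

end
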